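(* Let $G=(V,E)$ be a finite graph whose maximal degree is at most $K\in\mathbb N$, let $\beta>0$, $\theta>0$ and $u\in(0,1]$, and let $\mathbb P$ be the random loop measure on $G$ with parameters $(\beta,u,\theta)$ (defined in the context). Put $\hat\theta=\max\{\theta,1/\theta\}$, $\check\theta=\min\{\theta,1/\theta\}$ and \[ \delta(\beta,u,\theta)=\frac{1}{2}\left(\frac{u\check\theta}{K}\right)^2\frac{\beta\check\theta^3}{\beta\check\theta^3+3\cdot 4^{K+1}}\left(\frac{\beta\hat\theta}{e^{\beta\hat\theta}-1}\right)^{2K-1}. \] Then for every subset $\tilde E\subseteq E$ the following holds. Under $\mathbb P$ conditioned on the event that $N_e\ge 1$ for every $e\in\tilde E$ and $N_e=0$ for every $e\in E\setminus\tilde E$, the random vector $(B_e)_{e\in\tilde E}$ of blocking-edge indicators stochastically dominates Bernoulli edge percolation on $\tilde E$ with parameter $\delta(\beta,u,\theta)$. That is, there is a coupling of the two such that, almost surely, every edge of $\tilde E$ that is open in the Bernoulli percolation is blocking.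
   Context: A link configuration on a finite graph $G=(V,E)$ is a finite sequence $c=(e_i,s_i)_{i\le n}$ with $n\in\mathbb N_0$, $e_i\in E$ and $s_i\in\{-1,1\}$. A pair with $s_i=1$ is a "cross" and a pair with $s_i=-1$ is a "double bar". Let $N_e(c)=|\{i:e_i=e\}|$. Loops: place the $i$-th link at time $t_i=i/(n+1)$ on the edge $e_i$. Consider $V\times[0,1)$, where $[0,1)$ is viewed as a circle (periodic time). A loop is traced by moving in time along $\{v\}\times[0,1)$. When the trajectory meets a time $t_i$ with $v\in e_i$, it jumps to the other endpoint $w$ of $e_i$. After a cross it continues in the same time direction, and after a double bar it reverses the time direction. The closed trajectories obtained in this way are the loops of $c$, and $|\mathcal L(c)|$ denotes their number. Random loop measure: for $\theta=1$, draw independent $\mathrm{Poisson}(\beta)$ numbers of links $N_e$ for each $e\in E$. Order the resulting multiset of $n=\sum_e N_e$ edges by a uniformly random permutation, and give each link independently type $s_i=1$ with probability $u$ and $s_i=-1$ otherwise. Equivalently, a configuration $c$ of length $n$ has probability proportional to $\frac{\beta^n}{n!}u^{\#\text{crosses}}(1-u)^{\#\text{double bars}}$. For general $\theta>0$, this measure is reweighted by $\theta^{|\mathcal L(c)|}$ and normalised. Blocking edge: an edge $e$ is blocking in $c$, written $B_e(c)=1$ (and $B_e(c)=0$ otherwise), if all of the following hold: (i) $N_e(c)=2$; (ii) both links on $e$ are crosses; (iii) if $i<j$ are the two indices with $e_i=e_j=e$, then every $k$ with $i<k<j$ satisfies $e_k\cap e=\emptyset$. *)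

theory Defs
  imports "HOL-Probability.Probability"
begin

text \<open>A link is a pair (edge, sign) with sign 1 (cross) or -1 (double bar).
  A link configuration is a list of links; the list entry with index i-1 is the
  i-th link, placed at time i/(n+1) where n is the length of the list.\<close>

type_synonym 'v link_conf = "('v set \<times> int) list"

definition confs :: "'v set set \<Rightarrow> 'v link_conf set" where
  "confs E = {c. set c \<subseteq> E \<times> {-1, 1}}"

definition N_e :: "'v set \<Rightarrow> 'v link_conf \<Rightarrow> nat" where
  "N_e e c = length (filter (\<lambda>l. fst l = e) c)"

definition n_cross :: "'v link_conf \<Rightarrow> nat" where
  "n_cross c = length (filter (\<lambda>l. snd l = 1) c)"

definition n_dbar :: "'v link_conf \<Rightarrow> nat" where
  "n_dbar c = length (filter (\<lambda>l. snd l = -1) c)"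

text \<open>Loops. The time circle [0,1) is cut at the points k/(n+1), k = 0..n; the
  point k/(n+1) for k \<ge> 1 carries link k (list index k-1), the point 0 carries
  no link. Gap g (0 \<le> g \<le> n) is the open interval (g/(n+1),(g+1)/(n+1)),
  indices taken modulo n+1. A trajectory piece is a pair (v,g).
  up_next gives the next piece when moving upward in time, down_next when moving
  downward.\<close>

definition other_end :: "'v set \<Rightarrow> 'v \<Rightarrow> 'v" where
  "other_end e v = (THE w. e = {v, w})"

definition up_next :: "'v link_conf \<Rightarrow> 'v \<times> nat \<Rightarrow> 'v \<times> nat" where
  "up_next c s = (let v = fst s; g = snd s; n = length c; p = (g + 1) mod (n + 1) in
     if p \<noteq> 0 \<and> v \<in> fst (c ! (p - 1)) then
       (let w = other_end (fst (c ! (p - 1))) v in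
        if snd (c ! (p - 1)) = 1 then (w, p) else (w, g))
     else (v, p))"

definition down_next :: "'v link_conf \<Rightarrow> 'v \<times> nat \<Rightarrow> 'v \<times> nat" where
  "down_next c s = (let v = fst s; g = snd s; n = length c; p = g in
     if p \<noteq> 0 \<and> v \<in> fst (c ! (p - 1)) then
       (let w = other_end (fst (c ! (p - 1))) v in
        if snd (c ! (p - 1)) = 1 then (w, (g + n) mod (n + 1)) else (w, g))
     else (v, (g + n) mod (n + 1)))"

definition pieces :: "'v set \<Rightarrow> 'v link_conf \<Rightarrow> ('v \<times> nat) set" where
  "pieces V c = V \<times> {0..length c}"

definition loop_adj :: "'v set \<Rightarrow> 'v link_conf \<Rightarrow> (('v \<times> nat) \<times> ('v \<times> nat)) set" where
  "loop_adj V c = {(s, t). s \<in> pieces V c \<and> (t = up_next c s \<or> t = down_next c s)}"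

definition loops :: "'v set \<Rightarrow> 'v link_conf \<Rightarrow> ('v \<times> nat) set set" where
  "loops V c = {{t. (s, t) \<in> (loop_adj V c \<union> (loop_adj V c)\<inverse>)\<^sup>*} | s. s \<in> pieces V c}"

definition num_loops :: "'v set \<Rightarrow> 'v link_conf \<Rightarrow> nat" where
  "num_loops V c = card (loops V c)"

definition loop_weight :: "'v set \<Rightarrow> 'v set set \<Rightarrow> real \<Rightarrow> real \<Rightarrow> real \<Rightarrow> 'v link_conf \<Rightarrow> real" where
  "loop_weight V E \<beta> u \<theta> c =
     (if c \<in> confs E then
        \<beta> ^ length c / fact (length c) * u ^ n_cross c * (1 - u) ^ n_dbar c * \<theta> ^ num_loops V c
      else 0)"

definition loop_measure :: "'v set \<Rightarrow> 'v set set \<Rightarrow> real \<Rightarrow> real \<Rightarrow> real \<Rightarrow> 'v link_conf pmf" where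
  "loop_measure V E \<beta> u \<theta> =
     embed_pmf (\<lambda>c. loop_weight V E \<beta> u \<theta> c / (\<Sum>\<^sub>\<infinity>c'. loop_weight V E \<beta> u \<theta> c'))"

definition blocking :: "'v set \<Rightarrow> 'v link_conf \<Rightarrow> bool" where
  "blocking e c \<longleftrightarrow>
     N_e e c = 2 \<and>
     (\<forall>i < length c. fst (c ! i) = e \<longrightarrow> snd (c ! i) = 1) \<and>
     (\<forall>i j k. i < j \<and> j < length c \<and> fst (c ! i) = e \<and> fst (c ! j) = e \<and> i < k \<and> k < j
        \<longrightarrow> fst (c ! k) \<inter> e = {})"

definition occ_event :: "'v set set \<Rightarrow> 'v set set \<Rightarrow> 'v link_conf set" where
  "occ_event E Et = {c. (\<forall>e\<in>Et. N_e e c \<ge> 1) \<and> (\<forall>e\<in>E - Et. N_e e c = 0)}"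

definition delta :: "nat \<Rightarrow> real \<Rightarrow> real \<Rightarrow> real \<Rightarrow> real" where
  "delta K \<beta> u \<theta> =
     (let th = max \<theta> (1 / \<theta>); tl = min \<theta> (1 / \<theta>) in
      1 / 2 * (u * tl / real K) ^ 2 * (\<beta> * tl ^ 3 / (\<beta> * tl ^ 3 + 3 * 4 ^ (K + 1)))
        * (\<beta> * th / (exp (\<beta> * th) - 1)) ^ (2 * K - 1))"

end

theory Submission
  imports Defs
begin

text \<open>Fix an edge \<open>e\<close> and prescribe the indicators \<open>B\<^sub>f = b\<^sub>f\<close> of all other edges. It suffices that, given any
  such prescription, \<open>B\<^sub>e = 1\<close> has conditional probability at least \<open>\<delta>\<close>; a coupling is then
  built edge by edge. Everything is compared with the configurations \<open>\<Omega>\<close> without links on \<open>e\<close> that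
  satisfy the prescription, writing \<open>x = \<beta> max(\<theta>, 1/\<theta>)\<close>.

  Upper bound for all configurations: removing the links on \<open>e\<close> costs a factor \<open>exp x - 1\<close>, since every link
  changes the number of loops by at most one. This may turn neighbours \<open>f\<close> with \<open>b\<^sub>f = 0\<close> into blocking edges;
  removing the second link of such an \<open>f\<close> affects no other indicator and costs at most \<open>1 + x\<close> for each of
  the at most \<open>2K - 2\<close> neighbours.

  Lower bound for \<open>B\<^sub>e = 1\<close>: insert into a configuration of \<open>\<Omega>\<close> one cross on \<open>e\<close> at a uniform place and a
  second one in the same gap between incident links; the two cancel, so the number of loops is that of the
  configuration in \<open>\<Omega>\<close>. If the first cross falls inside a blocking neighbour \<open>f\<close>, exchange it with the second
  link of \<open>f\<close>; iterating this, alternately at the two endpoints of \<open>e\<close>, at most \<open>4K - 3\<close> positions lead to the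
  same admissible one. The gap lengths are controlled by the Cauchy-Schwarz inequality and the
  mean number of links incident to \<open>e\<close>, which in turn is bounded by removing superfluous links.\<close>

section \<open>Connected components and loops\<close>

text \<open>On the conditioning event all links lie on \<open>Et\<close>, so the estimates are made
  for the graph \<open>(V, Et)\<close>, whose degrees are still at most \<open>K\<close>.
  Prescribing the other indicators permits an edge-by-edge coupling, and it is also the obstacle:
  deleting links on \<open>e\<close> can create blocking neighbours and inserting a cross can
  destroy them, so both directions need a repair that leaves all other indicators alone. Both
  repairs rest on one fact: an edge meeting a blocking \<open>f\<close> has no link between the two
  crosses on \<open>f\<close> and hence sees them as one. Powers of \<theta> are lost only where
  links are deleted; inserting the two crosses keeps the number of loops. With M = 1 + (2K-2)(2K+x)
  this gives a conditional probability of at least (\<beta> u)^2 / (2 (4K-3)^2 M (e^x-1)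
  (1+x)^(2K-2)). In \<delta>, one factor x/(e^x-1) matches the links on \<open>e\<close>, and the
  other 2K-2 are compared with 1/(1+x). As (e^x-1)/(x(1+x)) drops below 1 for small x, the term
  4^(K+1) in \<delta> has to pay for that comparison as well as for the polynomial factors in
  K.\<close>

definition conn :: "('a \<times> 'a) set \<Rightarrow> ('a \<times> 'a) set" where
  "conn R = (R \<union> R\<inverse>)\<^sup>*"

definition comps :: "'a set \<Rightarrow> ('a \<times> 'a) set \<Rightarrow> 'a set set" where
  "comps X R = (\<lambda>s. conn R `` {s}) ` X"

lemma conn_refl [simp]: "(s, s) \<in> conn R"
  by (simp add: conn_def)

lemma conn_sym: "(s, t) \<in> conn R \<Longrightarrow> (t, s) \<in> conn R"
  unfolding conn_def by (metis sym_Un_converse sym_rtrancl symD)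

lemma conn_trans: "(s, t) \<in> conn R \<Longrightarrow> (t, r) \<in> conn R \<Longrightarrow> (s, r) \<in> conn R"
  unfolding conn_def by (rule rtrancl_trans)

lemma conn_base: "(s, t) \<in> R \<Longrightarrow> (s, t) \<in> conn R"
  unfolding conn_def by blast

lemma conn_class_eq: "conn R `` {s} = conn R `` {t} \<longleftrightarrow> (s, t) \<in> conn R"
  by (auto intro: conn_sym conn_trans)

lemma conn_least:
  assumes "R \<subseteq> conn S" shows "conn R \<subseteq> conn S"
proof -
  have "R \<union> R\<inverse> \<subseteq> conn S"
    using assms by (auto intro: conn_sym)
  then have "(R \<union> R\<inverse>)\<^sup>* \<subseteq> (conn S)\<^sup>*" by (rule rtrancl_mono)
  also have "(conn S)\<^sup>* = conn S" by (simp add: conn_def)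
  finally show ?thesis by (simp add: conn_def)
qed

text \<open>A class of the coarser relation is the saturation of any finer class inside it. Counting
  components thus becomes counting the image of a map.\<close>

lemma comps_image:
  assumes "R \<subseteq> conn S"
  shows "comps X S = (\<lambda>C. conn S `` C) ` comps X R"
proof -
  have "conn S `` (conn R `` {s}) = conn S `` {s}" for s
    using conn_least[OF assms] by (auto intro: conn_trans)
  then show ?thesis by (simp add: comps_def image_image)
qed

lemma card_comps_mono:
  assumes "finite X" "R \<subseteq> conn S"
  shows "card (comps X S) \<le> card (comps X R)"
  unfolding comps_image[OF assms(2)]
  using assms(1) by (intro card_image_le) (simp add: comps_def)

lemma conn_insert:
  assumes "(s, t) \<in> conn (insert (a, b) R)"
  shows "(s, t) \<in> conn R \<or> ((s, a) \<in> conn R \<or> (s, b) \<in> conn R) \<and> ((t, a) \<in> conn R \<or> (t, b) \<in> conn R)"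
  using assms unfolding conn_def[of "insert (a,b) R"]
proof (induction rule: rtrancl_induct)
  case base
  then show ?case by simp
next
  case (step y z)
  then have yz: "(y, z) \<in> conn R \<or> y = a \<and> z = b \<or> y = b \<and> z = a"
    by (auto intro: conn_base conn_sym)
  have z1: "(z, c) \<in> conn R" if "(y, z) \<in> conn R" "(y, c) \<in> conn R" for c
    using that by (blast intro: conn_sym conn_trans)
  have z2: "(s, z) \<in> conn R" if "(y, z) \<in> conn R" "(s, y) \<in> conn R"
    using that by (blast intro: conn_sym conn_trans)
  show ?case
    using yz
  proof (elim disjE)
    assume "(y, z) \<in> conn R"
    then show ?thesis using step.IH z1 z2 by blast
  next
    assume "y = a \<and> z = b"
    then show ?thesis using step.IH conn_refl by metis
  next
    assume "y = b \<and> z = a"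
    then show ?thesis using step.IH conn_refl by metis
  qed
qed

text \<open>Only the classes of \<open>a\<close> and \<open>b\<close> can merge; once the class of
  \<open>a\<close> is set aside, saturation is injective on the others.\<close>

lemma card_comps_insert:
  assumes "finite X"
  shows "card (comps X R) \<le> Suc (card (comps X (insert (a, b) R)))"
proof -
  let ?S = "insert (a, b) R" and ?f = "\<lambda>C. conn (insert (a, b) R) `` C"
  have sub: "R \<subseteq> conn ?S" by (auto intro: conn_base)
  have img: "comps X ?S = ?f ` comps X R" by (rule comps_image[OF sub])
  have cls: "?f (conn R `` {s}) = conn ?S `` {s}" for s
    using conn_least[OF sub] by (auto intro: conn_trans)
  have inj: "inj_on ?f (comps X R - {conn R `` {a}})"
  proof (rule inj_onI)
    fix C D assume C: "C \<in> comps X R - {conn R `` {a}}" and D: "D \<in> comps X R - {conn R `` {a}}"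
      and eq: "?f C = ?f D"
    obtain s t where s: "C = conn R `` {s}" and t: "D = conn R `` {t}"
      using C D by (auto simp: comps_def)
    have "(s, t) \<in> conn ?S" using eq by (simp add: s t cls conn_class_eq)
    moreover have "(s, a) \<notin> conn R" "(t, a) \<notin> conn R"
      using C D by (auto simp: s t conn_class_eq)
    ultimately have "(s, t) \<in> conn R"
      using conn_insert[of s t a b R] by (auto intro: conn_sym conn_trans)
    then show "C = D" by (simp add: s t conn_class_eq)
  qed
  have fin: "finite (comps X R)" using assms by (simp add: comps_def)
  have "card (comps X R) \<le> Suc (card (comps X R - {conn R `` {a}}))"
    using diff_le_self[of "card (comps X R)" 1] by (simp only: card_Diff_singleton_if split: if_split) linarith
  also have "card (comps X R - {conn R `` {a}}) = card (?f ` (comps X R - {conn R `` {a}}))"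
    using inj by (simp add: card_image)
  also have "\<dots> \<le> card (comps X ?S)"
    unfolding img by (rule card_mono) (use fin in auto)
  finally show ?thesis by simp
qed

lemma card_image_eq_card_image:
  assumes "\<And>x y. x \<in> X \<Longrightarrow> y \<in> X \<Longrightarrow> f x = f y \<longleftrightarrow> h x = h y"
  shows "card (f ` X) = card (h ` X)"
proof (rule bij_betw_same_card)
  have *: "h (inv_into X f (f x)) = h x" if "x \<in> X" for x
    using that assms by (meson f_inv_into_f imageI inv_into_into)
  show "bij_betw (\<lambda>c. h (inv_into X f c)) (f ` X) (h ` X)"
    unfolding bij_betw_def inj_on_def using assms by (auto simp: * image_image)
qed

text \<open>\<open>\<phi>\<close> need not be injective, only its fibres have to be connected. It is
  applied to the collapse of two adjacent time gaps and to an involution that exchanges two vertices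
  for some time.\<close>

lemma card_comps_reindex:
  assumes surj: "\<phi> ` X = Y"
    and edge: "\<And>x x'. (x, x') \<in> R \<Longrightarrow> (\<phi> x, \<phi> x') \<in> conn S"
    and lift: "\<And>y y'. (y, y') \<in> S \<Longrightarrow> \<exists>x\<in>X. \<exists>x'\<in>X. \<phi> x = y \<and> \<phi> x' = y' \<and> (x, x') \<in> conn R"
    and fibre: "\<And>x x'. x \<in> X \<Longrightarrow> x' \<in> X \<Longrightarrow> \<phi> x = \<phi> x' \<Longrightarrow> (x, x') \<in> conn R"
  shows "card (comps X R) = card (comps Y S)"
proof -
  have fwd: "(\<phi> x, \<phi> x') \<in> conn S" if "(x, x') \<in> conn R" for x x'
    using that unfolding conn_def[of R]
  proof (induction rule: rtrancl_induct)
    case (step y z)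
    then have "(\<phi> y, \<phi> z) \<in> conn S" using edge by (auto intro: conn_sym)
    with step.IH show ?case by (rule conn_trans)
  qed simp
  have bwd: "(x, x') \<in> conn R" if "(\<phi> x, y) \<in> conn S" "x \<in> X" "x' \<in> X" "\<phi> x' = y" for x x' y
    using that(1,3,4) unfolding conn_def[of S]
  proof (induction arbitrary: x' rule: rtrancl_induct)
    case base
    then show ?case using fibre that(2) by metis
  next
    case (step y z)
    from step.hyps(2) obtain p q where pq: "p \<in> X" "q \<in> X" "\<phi> p = y" "\<phi> q = z" "(p, q) \<in> conn R"
      using lift by (blast intro: conn_sym)
    have "(x, p) \<in> conn R" using step.IH pq by blast
    moreover have "(q, x') \<in> conn R" using fibre pq step.prems by metis
    ultimately show ?case using pq(5) by (blast intro: conn_trans)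
  qed
  have "comps Y S = (\<lambda>x. conn S `` {\<phi> x}) ` X"
    by (auto simp: comps_def surj[symmetric] image_image)
  moreover have "card ((\<lambda>x. conn R `` {x}) ` X) = card ((\<lambda>x. conn S `` {\<phi> x}) ` X)"
    by (rule card_image_eq_card_image) (use fwd bwd in \<open>auto simp only: conn_class_eq\<close>)
  ultimately show ?thesis by (simp add: comps_def)
qed

text \<open>The edges between the pieces in gaps \<open>g\<close> and \<open>Suc g\<close> when the time between them carries the given
  link. \<open>None\<close> is a time without a link; it allows two configurations that differ by a link to be
  compared on the same set of pieces.\<close>

definition link_rel :: "'v set \<Rightarrow> ('v set \<times> int) option \<Rightarrow> nat \<Rightarrow> (('v \<times> nat) \<times> ('v \<times> nat)) set" where
  "link_rel V l g = (case l of
      None \<Rightarrow> {((x, g), (x, Suc g)) | x. x \<in> V}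
    | Some (e, s) \<Rightarrow> {((x, g), (x, Suc g)) | x. x \<in> V - e} \<union>
        (if s = 1 then {((x, g), (y, Suc g)) | x y. e = {x, y} \<and> x \<noteq> y}
         else {((x, h), (y, h)) | x y h. e = {x, y} \<and> x \<noteq> y \<and> h \<in> {g, Suc g}}))"

text \<open>The last set closes the time circle: no link sits at time 0, so the last gap continues
  straight into gap 0.\<close>

definition lgraph :: "'v set \<Rightarrow> ('v set \<times> int) option list \<Rightarrow> (('v \<times> nat) \<times> ('v \<times> nat)) set" where
  "lgraph V ls = (\<Union>g<length ls. link_rel V (ls ! g) g) \<union> {((x, length ls), (x, 0)) | x. x \<in> V}"

definition nloops :: "'v set \<Rightarrow> ('v set \<times> int) option list \<Rightarrow> nat" where
  "nloops V ls = card (comps (V \<times> {0..length ls}) (lgraph V ls))"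

definition edge_on :: "'v set \<Rightarrow> 'v set \<Rightarrow> bool" where
  "edge_on V e \<longleftrightarrow> (\<exists>a b. a \<in> V \<and> b \<in> V \<and> a \<noteq> b \<and> e = {a, b})"

lemma other_end_eq: "a \<noteq> b \<Longrightarrow> other_end {a, b} a = b" "a \<noteq> b \<Longrightarrow> other_end {a, b} b = a"
  unfolding other_end_def by (auto intro!: the_equality simp: doubleton_eq_iff)

text \<open>The two graphs agree only after symmetrisation: \<open>loop_adj\<close> contains steps
  in both directions of time, whereas \<open>lgraph\<close> lists each passage from a gap to the
  next once, upwards. Components do not see the difference.\<close>

lemma num_loops_eq_nloops:
  assumes "\<forall>l\<in>set c. edge_on V (fst l)"
  shows "num_loops V c = nloops V (map Some c)"
proof -
  let ?n = "length c"
  let ?G = "lgraph V (map Some c)"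
  have up: "((v, g), up_next c (v, g)) \<in> ?G \<union> ?G\<inverse>" if "v \<in> V" "g \<le> ?n" for v g
  proof (cases "g = ?n")
    case True
    then show ?thesis using that by (auto simp: up_next_def Let_def lgraph_def)
  next
    case False
    then have g: "g < ?n" using that by simp
    obtain e s where l: "c ! g = (e, s)" by fastforce
    obtain a b where ab: "a \<in> V" "b \<in> V" "a \<noteq> b" "e = {a, b}"
      using assms g l by (metis edge_on_def fst_conv nth_mem)
    have "((v, g), up_next c (v, g)) \<in> link_rel V (map Some c ! g) g"
      using g l ab that by (auto simp: up_next_def Let_def link_rel_def other_end_eq)
    then show ?thesis using g by (auto simp: lgraph_def)
  qed
  have down: "((v, g), down_next c (v, g)) \<in> ?G \<union> ?G\<inverse>" if "v \<in> V" "g \<le> ?n" for v g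
  proof (cases g)
    case 0
    then show ?thesis using that by (auto simp: down_next_def Let_def lgraph_def)
  next
    case (Suc k)
    then have k: "k < ?n" using that by simp
    obtain e s where l: "c ! k = (e, s)" by fastforce
    obtain a b where ab: "a \<in> V" "b \<in> V" "a \<noteq> b" "e = {a, b}"
      using assms k l by (metis edge_on_def fst_conv nth_mem)
    have m: "Suc (k + ?n) mod Suc ?n = k" using k by (simp add: mod_if)
    have "((v, g), down_next c (v, g)) \<in> link_rel V (map Some c ! k) k \<union> (link_rel V (map Some c ! k) k)\<inverse>"
      using k l ab that m Suc by (auto simp: down_next_def Let_def link_rel_def other_end_eq)
    then show ?thesis using k by (auto simp: lgraph_def)
  qed
  have sub: "loop_adj V c \<subseteq> ?G \<union> ?G\<inverse>"
  proof (rule subrelI)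
    fix s t assume "(s, t) \<in> loop_adj V c"
    then have "fst s \<in> V" "snd s \<le> ?n" "t = up_next c s \<or> t = down_next c s"
      by (auto simp: loop_adj_def pieces_def)
    then show "(s, t) \<in> ?G \<union> ?G\<inverse>"
      using up[of "fst s" "snd s"] down[of "fst s" "snd s"] by (simp only: prod.collapse) blast
  qed
  have inc: "?G \<subseteq> loop_adj V c"
  proof
    fix q assume "q \<in> ?G"
    then consider (link) g where "g < ?n" "q \<in> link_rel V (Some (c ! g)) g"
      | (wrap) x where "x \<in> V" "q = ((x, ?n), (x, 0))"
      by (auto simp: lgraph_def)
    then show "q \<in> loop_adj V c"
    proof cases
      case wrap
      then show ?thesis by (auto simp: loop_adj_def pieces_def up_next_def Let_def)
    next
      case link
      obtain e s where l: "c ! g = (e, s)" by fastforce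
      obtain a b where ab: "a \<in> V" "b \<in> V" "a \<noteq> b" "e = {a, b}"
        using assms link l by (metis edge_on_def fst_conv nth_mem)
      have m: "Suc (g + ?n) mod Suc ?n = g" using link by (simp add: mod_if)
      have oth: "other_end e x = y \<and> x \<in> V \<and> y \<in> V" if "e = {x, y}" "x \<noteq> y" for x y
        using that ab by (auto simp: other_end_eq)
      from link(2) consider (str) x where "x \<in> V - e" "q = ((x, g), (x, Suc g))"
        | (cross) x y where "s = 1" "e = {x, y}" "x \<noteq> y" "q = ((x, g), (y, Suc g))"
        | (bar) x y h where "s \<noteq> 1" "e = {x, y}" "x \<noteq> y" "h \<in> {g, Suc g}" "q = ((x, h), (y, h))"
        by (auto simp: link_rel_def l split: if_splits)
      then show ?thesis
      proof cases
        case str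
        then show ?thesis using link l by (auto simp: loop_adj_def pieces_def up_next_def Let_def)
      next
        case cross
        then show ?thesis using link l oth[of x y]
          by (auto simp: loop_adj_def pieces_def up_next_def Let_def)
      next
        case bar
        from oth[OF bar(2,3)] have o: "other_end e x = y" "x \<in> V" "y \<in> V" by auto
        have "x \<in> e" using bar by simp
        then have "up_next c (x, g) = (y, g)" "down_next c (x, Suc g) = (y, Suc g)"
          using link l o bar(1) by (simp_all add: up_next_def down_next_def Let_def)
        then show ?thesis using bar(4,5) o link(1) by (auto simp: loop_adj_def pieces_def)
      qed
    qed
  qed
  have "loop_adj V c \<union> (loop_adj V c)\<inverse> = ?G \<union> ?G\<inverse>"
    using sub inc by blast
  then have "loops V c = comps (pieces V c) ?G"
    by (auto simp: loops_def comps_def conn_def Image_def)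
  then show ?thesis by (simp add: num_loops_def nloops_def pieces_def)
qed

lemma link_rel_bounds:
  assumes "(y, y') \<in> link_rel V l g" "\<forall>e s. l = Some (e, s) \<longrightarrow> edge_on V e"
  shows "fst y \<in> V \<and> fst y' \<in> V \<and> snd y \<in> {g, Suc g} \<and> snd y' \<in> {g, Suc g}"
  using assms by (auto simp: link_rel_def edge_on_def doubleton_eq_iff split: option.splits if_splits)

text \<open>A time without a link joins the two adjacent gaps at every vertex, so identifying these
  gaps has connected fibres.\<close>

lemma nloops_None:
  assumes "\<forall>e s. Some (e, s) \<in> set (xs @ ys) \<longrightarrow> edge_on V e"
  shows "nloops V (xs @ None # ys) = nloops V (xs @ ys)"
  unfolding nloops_def
proof (rule card_comps_reindex)
  let ?k = "length xs"
  let ?R = "lgraph V (xs @ None # ys)" and ?S = "lgraph V (xs @ ys)"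
  let ?\<phi> = "\<lambda>p::'a \<times> nat. (fst p, if snd p \<le> ?k then snd p else snd p - 1)"
  let ?X = "V \<times> {0..length (xs @ None # ys)}" and ?Y = "V \<times> {0..length (xs @ ys)}"
  show "?\<phi> ` ?X = ?Y"
  proof (intro set_eqI iffI)
    fix q assume "q \<in> ?\<phi> ` ?X" then show "q \<in> ?Y" by (auto split: if_splits)
  next
    fix q assume q: "q \<in> ?Y"
    have "q = ?\<phi> (fst q, if snd q \<le> ?k then snd q else Suc (snd q))" by auto
    moreover have "(fst q, if snd q \<le> ?k then snd q else Suc (snd q)) \<in> ?X" using q by auto
    ultimately show "q \<in> ?\<phi> ` ?X" by blast
  qed
  show "(?\<phi> x, ?\<phi> x') \<in> conn ?S" if "(x, x') \<in> ?R" for x x'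
  proof -
    from that consider (link) g where "g < length (xs @ None # ys)" "(x, x') \<in> link_rel V ((xs @ None # ys) ! g) g"
      | (wrap) y where "y \<in> V" "x = (y, Suc (?k + length ys))" "x' = (y, 0)"
      by (auto simp: lgraph_def)
    then show ?thesis
    proof cases
      case wrap
      then show ?thesis by (intro conn_base) (auto simp: lgraph_def)
    next
      case link
      consider "g < ?k" | "g = ?k" | "g > ?k" by linarith
      then show ?thesis
      proof cases
        case 1
        then have "(?\<phi> x, ?\<phi> x') \<in> link_rel V ((xs @ ys) ! g) g"
          using link by (auto simp: link_rel_def nth_append split: option.splits if_splits)
        then show ?thesis using 1 by (intro conn_base) (auto simp: lgraph_def)
      next
        case 2
        then show ?thesis using link by (auto simp: link_rel_def)
      next
        case 3
        then obtain h where h: "g = Suc h" "h \<ge> ?k" by (cases g) auto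
        then have "(?\<phi> x, ?\<phi> x') \<in> link_rel V ((xs @ ys) ! h) h"
          using link by (auto simp: link_rel_def nth_append nth_Cons' Suc_diff_le split: option.splits if_splits)
        then show ?thesis using h link by (intro conn_base) (auto simp: lgraph_def)
      qed
    qed
  qed
  have fib: "((v, ?k), (v, Suc ?k)) \<in> conn ?R" if "v \<in> V" for v
    using that by (intro conn_base) (auto simp: lgraph_def link_rel_def intro!: bexI[of _ ?k])
  show "(x, x') \<in> conn ?R" if "x \<in> ?X" "x' \<in> ?X" "?\<phi> x = ?\<phi> x'" for x x'
  proof -
    have "x = x' \<or> {x, x'} = {(fst x, ?k), (fst x, Suc ?k)}"
      using that by (cases x; cases x') (auto split: if_splits)
    then show ?thesis using fib[of "fst x"] that by (auto simp: doubleton_eq_iff intro: conn_sym)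
  qed
  show "\<exists>x\<in>?X. \<exists>x'\<in>?X. ?\<phi> x = y \<and> ?\<phi> x' = y' \<and> (x, x') \<in> conn ?R" if "(y, y') \<in> ?S" for y y'
  proof -
    have VV: "fst y \<in> V \<and> fst y' \<in> V \<and> snd y \<le> length (xs @ ys) \<and> snd y' \<le> length (xs @ ys)"
    proof -
      have "edge_on V e" if "g < length (xs @ ys)" "(xs @ ys) ! g = Some (e, s)" for g e s
        using that assms by (metis nth_mem)
      then have "fst y \<in> V \<and> fst y' \<in> V \<and> snd y \<in> {g, Suc g} \<and> snd y' \<in> {g, Suc g}"
        if "g < length (xs @ ys)" "(y, y') \<in> link_rel V ((xs @ ys) ! g) g" for g
        using that by (intro link_rel_bounds) auto
      moreover have "(\<exists>g < length (xs @ ys). (y, y') \<in> link_rel V ((xs @ ys) ! g) g) \<or>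
          (\<exists>x\<in>V. y = (x, length (xs @ ys)) \<and> y' = (x, 0))"
        using \<open>(y, y') \<in> ?S\<close> by (auto simp: lgraph_def)
      ultimately show ?thesis by force
    qed
    from that consider (link) g where "g < length (xs @ ys)" "(y, y') \<in> link_rel V ((xs @ ys) ! g) g"
      | (wrap) z where "z \<in> V" "y = (z, ?k + length ys)" "y' = (z, 0)"
      by (auto simp: lgraph_def)
    then show ?thesis
    proof cases
      case wrap
      then show ?thesis
        by (intro bexI[of _ "(z, Suc (?k + length ys))"] bexI[of _ "(z, 0)"] conjI conn_base)
           (auto simp: lgraph_def)
    next
      case link
      show ?thesis
      proof (cases "g < ?k")
        case True
        then have "(y, y') \<in> link_rel V ((xs @ None # ys) ! g) g"
          using link by (simp add: nth_append)
        then have "(y, y') \<in> conn ?R" using True by (intro conn_base) (auto simp: lgraph_def)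
        moreover have "snd y \<le> ?k" "snd y' \<le> ?k"
          using True link by (auto simp: link_rel_def split: option.splits if_splits)
        ultimately show ?thesis using VV
          by (intro bexI[of _ y] bexI[of _ y']) (auto simp: mem_Times_iff)
      next
        case False
        let ?z = "(fst y, Suc (snd y))" and ?z' = "(fst y', Suc (snd y'))"
        have "(?z, ?z') \<in> link_rel V ((xs @ None # ys) ! Suc g) (Suc g)"
          using False link by (auto simp: link_rel_def nth_append Suc_diff_le split: option.splits if_splits)
        then have "(?z, ?z') \<in> conn ?R" using link by (intro conn_base) (auto simp: lgraph_def)
        moreover have "snd y \<ge> ?k" "snd y' \<ge> ?k"
          using False link by (auto simp: link_rel_def split: option.splits if_splits)
        ultimately show ?thesis using VV
          by (intro bexI[of _ ?z] bexI[of _ ?z']) (auto simp: mem_Times_iff)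
      qed
    qed
  qed
qed

lemma lgraph_bounds:
  assumes "(y, y') \<in> lgraph V ls" "\<forall>e s. Some (e, s) \<in> set ls \<longrightarrow> edge_on V e"
  shows "y \<in> V \<times> {0..length ls} \<and> y' \<in> V \<times> {0..length ls}"
proof -
  have "edge_on V e" if "g < length ls" "ls ! g = Some (e, s)" for g e s
    using that assms(2) by (metis nth_mem)
  then have "fst y \<in> V \<and> fst y' \<in> V \<and> snd y \<in> {g, Suc g} \<and> snd y' \<in> {g, Suc g}"
    if "g < length ls" "(y, y') \<in> link_rel V (ls ! g) g" for g
    using that by (intro link_rel_bounds) auto
  moreover have "(\<exists>g < length ls. (y, y') \<in> link_rel V (ls ! g) g) \<or> (\<exists>x\<in>V. y = (x, length ls) \<and> y' = (x, 0))"
    using assms(1) by (auto simp: lgraph_def)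
  ultimately show ?thesis by (cases y; cases y') force
qed

lemma lgraph_split:
  "lgraph V (xs @ l # ys) =
     (\<Union>g\<in>{..<Suc (length xs + length ys)} - {length xs}. link_rel V ((xs @ None # ys) ! g) g)
       \<union> {((x, Suc (length xs + length ys)), (x, 0)) | x. x \<in> V} \<union> link_rel V l (length xs)"
proof -
  have *: "{..<length (xs @ l # ys)} = insert (length xs) ({..<Suc (length xs + length ys)} - {length xs})"
    by auto
  have **: "(\<Union>g\<in>{..<Suc (length xs + length ys)} - {length xs}. link_rel V ((xs @ l # ys) ! g) g)
     = (\<Union>g\<in>{..<Suc (length xs + length ys)} - {length xs}. link_rel V ((xs @ None # ys) ! g) g)"
    by (intro SUP_cong refl) (auto simp: nth_append nth_Cons')
  show ?thesis
    unfolding lgraph_def * UN_insert ** by auto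
qed

text \<open>Each graph generates the other after one more edge. Given the straight lines, a single
  edge between the lines of \<open>a\<close> and \<open>b\<close> yields both edges of the link;
  given the link, the straight line at \<open>a\<close> yields the one at \<open>b\<close>.\<close>

lemma nloops_Some_None:
  assumes "finite V" and e: "edge_on V e"
  shows "nloops V (xs @ Some (e, s) # ys) \<le> Suc (nloops V (xs @ None # ys))"
    and "nloops V (xs @ None # ys) \<le> Suc (nloops V (xs @ Some (e, s) # ys))"
proof -
  obtain a b where ab: "a \<in> V" "b \<in> V" "a \<noteq> b" "e = {a, b}"
    using e by (auto simp: edge_on_def)
  let ?k = "length xs" and ?X = "V \<times> {0..Suc (length xs + length ys)}"
  define H where "H = (\<Union>g\<in>{..<Suc (length xs + length ys)} - {length xs}. link_rel V ((xs @ None # ys) ! g) g)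
       \<union> {((x, Suc (length xs + length ys)), (x, 0)) | x. x \<in> V}"
  define N where "N = H \<union> link_rel V None ?k"
  define S where "S = H \<union> link_rel V (Some (e, s)) ?k"
  have nN: "nloops V (xs @ None # ys) = card (comps ?X N)"
    and nS: "nloops V (xs @ Some (e, s) # ys) = card (comps ?X S)"
    by (simp_all add: nloops_def lgraph_split N_def S_def H_def)
  have fin: "finite ?X" using assms(1) by simp
  define q where "q = (if s = 1 then ((a, ?k), (b, Suc ?k)) else ((a, ?k), (b, ?k)))"
  let ?N = "conn (insert q N)" and ?S = "conn (insert ((a, ?k), (a, Suc ?k)) S)"
  have N1: "((x, ?k), (x, Suc ?k)) \<in> ?N" if "x \<in> V" for x
    using that by (intro conn_base) (auto simp: N_def link_rel_def)
  have N2: "q \<in> ?N" by (cases q) (auto intro: conn_base)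
  have "link_rel V (Some (e, s)) ?k \<subseteq> ?N"
  proof (cases "s = 1")
    case True
    then have q: "((a, ?k), (b, Suc ?k)) \<in> ?N" using N2 by (simp add: q_def)
    have "((b, ?k), (a, Suc ?k)) \<in> ?N"
      using N1[OF ab(1)] N1[OF ab(2)] q by (meson conn_sym conn_trans)
    then show ?thesis
      using q N1 True ab by (auto simp: link_rel_def doubleton_eq_iff)
  next
    case False
    then have q: "((a, ?k), (b, ?k)) \<in> ?N" using N2 by (simp add: q_def)
    have "((a, Suc ?k), (b, Suc ?k)) \<in> ?N"
      using N1[OF ab(1)] N1[OF ab(2)] q by (meson conn_sym conn_trans)
    then show ?thesis
      using q N1 False ab by (auto simp: link_rel_def doubleton_eq_iff intro: conn_sym)
  qed
  moreover have "H \<subseteq> ?N" by (auto simp: N_def intro: conn_base)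
  ultimately have "S \<subseteq> ?N" by (simp add: S_def)
  then have "card (comps ?X (insert q N)) \<le> card (comps ?X S)"
    by (rule card_comps_mono[OF fin])
  then show "nloops V (xs @ None # ys) \<le> Suc (nloops V (xs @ Some (e, s) # ys))"
    using card_comps_insert[OF fin, of N "fst q" "snd q"] by (simp add: nN nS)
  have S0: "((a, ?k), (a, Suc ?k)) \<in> ?S" by (auto intro: conn_base)
  have S1: "((x, ?k), (x, Suc ?k)) \<in> ?S" if "x \<in> V - e" for x
    using that by (intro conn_base) (auto simp: S_def link_rel_def)
  have S2: "((b, ?k), (b, Suc ?k)) \<in> ?S"
  proof (cases "s = 1")
    case True
    then have "((a, ?k), (b, Suc ?k)) \<in> ?S" "((b, ?k), (a, Suc ?k)) \<in> ?S"
      using ab by (auto simp: S_def link_rel_def intro!: conn_base)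
    then show ?thesis using S0 by (meson conn_sym conn_trans)
  next
    case False
    then have "((a, ?k), (b, ?k)) \<in> ?S" "((a, Suc ?k), (b, Suc ?k)) \<in> ?S"
      using ab by (auto simp: S_def link_rel_def intro!: conn_base)
    then show ?thesis using S0 by (meson conn_sym conn_trans)
  qed
  have "link_rel V None ?k \<subseteq> ?S"
    using S0 S1 S2 ab(4) by (auto simp: link_rel_def)
  moreover have "H \<subseteq> ?S" by (auto simp: S_def intro: conn_base)
  ultimately have "N \<subseteq> ?S" by (simp add: N_def)
  then have "card (comps ?X (insert ((a, ?k), (a, Suc ?k)) S)) \<le> card (comps ?X N)"
    by (rule card_comps_mono[OF fin])
  then show "nloops V (xs @ Some (e, s) # ys) \<le> Suc (nloops V (xs @ None # ys))"
    using card_comps_insert[OF fin, of S "(a, ?k)" "(a, Suc ?k)"] by (simp add: nN nS)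
qed

lemma Some_links:
  "(\<forall>e s. Some (e, s) \<in> set (map Some ls) \<longrightarrow> P e) \<longleftrightarrow> (\<forall>l\<in>set ls. P (fst l))"
  by force

lemma num_loops_insert:
  assumes "finite V" "\<forall>l\<in>set (xs @ l # ys). edge_on V (fst l)"
  shows "num_loops V (xs @ l # ys) \<le> Suc (num_loops V (xs @ ys))"
    and "num_loops V (xs @ ys) \<le> Suc (num_loops V (xs @ l # ys))"
proof -
  obtain e s where l: "l = (e, s)" by fastforce
  have e: "edge_on V e" using assms(2) l by auto
  have "num_loops V (xs @ l # ys) = nloops V (map Some xs @ Some (e, s) # map Some ys)"
    using num_loops_eq_nloops[OF assms(2)] by (simp add: l)
  moreover have "num_loops V (xs @ ys) = nloops V (map Some xs @ None # map Some ys)"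
  proof -
    have wf: "\<forall>l\<in>set (xs @ ys). edge_on V (fst l)" using assms(2) by simp
    then have "\<forall>e s. Some (e, s) \<in> set (map Some xs @ map Some ys) \<longrightarrow> edge_on V e"
      by (simp only: map_append[symmetric] Some_links)
    from num_loops_eq_nloops[OF wf] nloops_None[OF this] show ?thesis by simp
  qed
  ultimately show "num_loops V (xs @ l # ys) \<le> Suc (num_loops V (xs @ ys))"
    "num_loops V (xs @ ys) \<le> Suc (num_loops V (xs @ l # ys))"
    using nloops_Some_None[OF assms(1) e] by simp_all
qed

text \<open>Two crosses on an edge with nothing incident in between cancel: exchange the two
  endpoints of the edge on the time interval between them.\<close>

lemma nloops_cancel:
  assumes e: "edge_on V e"
    and ys: "\<forall>f s. Some (f, s) \<in> set ys \<longrightarrow> f \<inter> e = {}"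
    and wf: "\<forall>f s. Some (f, s) \<in> set (xs @ ys @ zs) \<longrightarrow> edge_on V f"
  shows "nloops V (xs @ Some (e, 1) # ys @ Some (e, 1) # zs) = nloops V (xs @ None # ys @ None # zs)"
proof -
  obtain a b where ab: "a \<in> V" "b \<in> V" "a \<noteq> b" "e = {a, b}"
    using e by (auto simp: edge_on_def)
  define j where "j = length xs"
  define k where "k = j + 1 + length ys"
  define oth where "oth x = (if x = a then b else if x = b then a else x)" for x
  \<comment> \<open>Gap \<open>g\<close> lies directly before the link with list index
    \<open>g\<close>, so the gaps between the crosses with indices \<open>j\<close> and
    \<open>k\<close> are \<open>j + 1\<close> to \<open>k\<close>.\<close>
  define \<psi> where "\<psi> p = (if j < snd p \<and> snd p \<le> k then (oth (fst p), snd p) else p)" for p :: "'a \<times> nat"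
  let ?l = "xs @ Some (e, 1) # ys @ Some (e, 1) # zs"
  let ?m = "xs @ None # ys @ None # zs"
  let ?n = "length xs + length ys + length zs + 2"
  let ?X = "V \<times> {0..?n}"
  have oo: "oth (oth x) = x" "oth x \<in> V \<longleftrightarrow> x \<in> V" for x using ab by (auto simp: oth_def)
  have \<psi>\<psi>: "\<psi> (\<psi> p) = p" for p by (cases p) (auto simp: \<psi>_def oo)
  have snd\<psi>: "snd (\<psi> p) = snd p" for p by (simp add: \<psi>_def)
  have \<psi>X: "\<psi> p \<in> ?X" if "p \<in> ?X" for p using that by (auto simp: \<psi>_def oo)
  have nl: "?l ! g = (if g < j then xs ! g else if g = j then Some (e, 1) else if g < k then ys ! (g - j - 1)
      else if g = k then Some (e, 1) else zs ! (g - k - 1))" for g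
    by (auto simp: nth_append nth_Cons' j_def k_def)
  have nm: "?m ! g = (if g < j then xs ! g else if g = j then None else if g < k then ys ! (g - j - 1)
      else if g = k then None else zs ! (g - k - 1))" for g
    by (auto simp: nth_append nth_Cons' j_def k_def)
  have jk: "j < k" by (simp add: k_def)
  have out: "(\<psi> p, \<psi> p') = (p, p')" if "(p, p') \<in> link_rel V l g" "g < j \<or> g > k" for p p' l g
    using that by (auto simp: link_rel_def \<psi>_def split: option.splits if_splits)
  have mid: "(\<psi> p, \<psi> p') \<in> link_rel V l g"
    if "(p, p') \<in> link_rel V l g" "j < g" "g < k" "\<forall>f s. l = Some (f, s) \<longrightarrow> f \<inter> e = {}" for p p' l g
  proof (cases l)
    case None
    then show ?thesis using that by (auto simp: link_rel_def \<psi>_def oo)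
  next
    case (Some fs)
    obtain f s where l: "l = Some (f, s)" using Some by (cases fs) auto
    then have f: "a \<notin> f" "b \<notin> f" using that(4) ab(4) by auto
    then have of: "oth x = x" if "x \<in> f" for x using that by (auto simp: oth_def)
    have oVf: "oth x \<in> V - f" if "x \<in> V - f" for x using that f oo[of x] ab(1,2) by (auto simp: oth_def)
    have \<psi>g: "\<psi> (x, g) = (oth x, g)" "\<psi> (x, Suc g) = (oth x, Suc g)" for x
      using that(2,3) by (simp_all add: \<psi>_def)
    from that(1) consider (str) x where "x \<in> V - f" "p = (x, g)" "p' = (x, Suc g)"
      | (cross) x y where "s = 1" "f = {x, y}" "x \<noteq> y" "p = (x, g)" "p' = (y, Suc g)"
      | (bar) x y h where "s \<noteq> 1" "f = {x, y}" "x \<noteq> y" "h \<in> {g, Suc g}" "p = (x, h)" "p' = (y, h)"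
      by (auto simp: link_rel_def l split: if_splits)
    then show ?thesis
    proof cases
      case str
      then show ?thesis using oVf[of x] by (simp add: \<psi>g link_rel_def l)
    next
      case cross
      then show ?thesis using of[of x] of[of y] by (simp add: \<psi>g link_rel_def l)
    next
      case bar
      then have "\<psi> p = p" "\<psi> p' = p'" using of[of x] of[of y] \<psi>g by auto
      then show ?thesis using that(1) by simp
    qed
  qed
  have ysn: "\<forall>f s. ys ! (g - j - 1) = Some (f, s) \<longrightarrow> f \<inter> e = {}" if "j < g" "g < k" for g
  proof -
    have "g - j - 1 < length ys" using that by (simp add: k_def)
    then show ?thesis using ys by (metis nth_mem)
  qed
  have trS: "link_rel V (Some (e, 1)) g = (\<lambda>x. ((x, g), (x, Suc g))) ` (V - e) \<union>
      {((a, g), (b, Suc g)), ((b, g), (a, Suc g))}" for g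
    using ab by (auto simp: link_rel_def doubleton_eq_iff)
  have trN: "link_rel V None g = (\<lambda>x. ((x, g), (x, Suc g))) ` (V - e) \<union>
      {((a, g), (a, Suc g)), ((b, g), (b, Suc g))}" for g
    using ab by (auto simp: link_rel_def)
  have \<psi>jk: "\<psi> (x, j) = (x, j)" "\<psi> (x, Suc j) = (oth x, Suc j)" "\<psi> (x, k) = (oth x, k)" "\<psi> (x, Suc k) = (x, Suc k)" for x
    using jk by (auto simp: \<psi>_def)
  have oab: "oth a = b" "oth b = a" "x \<notin> e \<Longrightarrow> oth x = x" for x
    using ab by (auto simp: oth_def)
  have at: "(\<psi> p, \<psi> p') \<in> link_rel V None g" if "(p, p') \<in> link_rel V (Some (e, 1)) g" "g = j \<or> g = k" for p p' g
    using that unfolding trS trN by (elim UnE insertE emptyE imageE disjE) (simp_all add: \<psi>jk oab)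
  have at': "(\<psi> p, \<psi> p') \<in> link_rel V (Some (e, 1)) g" if "(p, p') \<in> link_rel V None g" "g = j \<or> g = k" for p p' g
    using that unfolding trS trN by (elim UnE insertE emptyE imageE disjE) (simp_all add: \<psi>jk oab)
  have step: "(\<psi> p, \<psi> p') \<in> link_rel V (?m ! g) g" if "(p, p') \<in> link_rel V (?l ! g) g" for p p' g
  proof -
    consider "g < j \<or> g > k" | "g = j \<or> g = k" | "j < g" "g < k" by linarith
    then show ?thesis
    proof cases
      case 1
      then show ?thesis using out[OF that] that jk unfolding nl nm by (auto split: if_splits)
    next
      case 2
      then show ?thesis using at[of p p' g] that jk unfolding nl nm by (auto split: if_splits)
    next
      case 3
      then show ?thesis using mid[OF that, OF 3] ysn[OF 3] that unfolding nl nm by auto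
    qed
  qed
  have step': "(\<psi> p, \<psi> p') \<in> link_rel V (?l ! g) g" if "(p, p') \<in> link_rel V (?m ! g) g" for p p' g
  proof -
    consider "g < j \<or> g > k" | "g = j \<or> g = k" | "j < g" "g < k" by linarith
    then show ?thesis
    proof cases
      case 1
      then show ?thesis using out[OF that] that jk unfolding nl nm by (auto split: if_splits)
    next
      case 2
      then show ?thesis using at'[of p p' g] that jk unfolding nl nm by (auto split: if_splits)
    next
      case 3
      then show ?thesis using mid[OF that, OF 3] ysn[OF 3] that unfolding nl nm by auto
    qed
  qed
  have len: "length ?l = ?n" "length ?m = ?n" by simp_all
  have wrap: "\<psi> (x, ?n) = (x, ?n)" "\<psi> (x, 0) = (x, 0)" for x
    by (auto simp: \<psi>_def k_def j_def)
  have lg: "(p, p') \<in> lgraph V ls \<longleftrightarrow>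
      (\<exists>g<length ls. (p, p') \<in> link_rel V (ls ! g) g) \<or> (\<exists>x\<in>V. p = (x, length ls) \<and> p' = (x, 0))" for p p' ls
    by (auto simp: lgraph_def)
  have E: "(\<psi> p, \<psi> p') \<in> lgraph V ?m" if "(p, p') \<in> lgraph V ?l" for p p'
    using that step wrap unfolding lg len by metis
  have E': "(\<psi> p, \<psi> p') \<in> lgraph V ?l" if "(p, p') \<in> lgraph V ?m" for p p'
    using that step' wrap unfolding lg len by metis
  have dom: "p \<in> ?X \<and> p' \<in> ?X" if "(p, p') \<in> lgraph V ?m" for p p'
    by (rule lgraph_bounds[OF that, unfolded len]) (use wf ys in auto)
  show ?thesis
    unfolding nloops_def len
  proof (rule card_comps_reindex[where \<phi> = \<psi>])
    show "\<psi> ` ?X = ?X"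
      using \<psi>X \<psi>\<psi> by (metis (no_types, lifting) image_subsetI set_eqI image_eqI subset_antisym subsetI)
    show "(\<psi> p, \<psi> p') \<in> conn (lgraph V ?m)" if "(p, p') \<in> lgraph V ?l" for p p'
      using E[OF that] by (rule conn_base)
    show "(p, p') \<in> conn (lgraph V ?l)" if "\<psi> p = \<psi> p'" for p p'
      using that \<psi>\<psi> by (metis conn_refl)
    show "\<exists>x\<in>?X. \<exists>x'\<in>?X. \<psi> x = p \<and> \<psi> x' = p' \<and> (x, x') \<in> conn (lgraph V ?l)"
      if "(p, p') \<in> lgraph V ?m" for p p'
      using E'[OF that] dom[OF that] \<psi>X \<psi>\<psi> conn_base by metis
  qed
qed

lemma num_loops_cancel:
  assumes e: "edge_on V e"
    and ys: "\<forall>l\<in>set ys. fst l \<inter> e = {}"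
    and wf: "\<forall>l\<in>set (xs @ ys @ zs). edge_on V (fst l)"
  shows "num_loops V (xs @ (e, 1) # ys @ (e, 1) # zs) = num_loops V (xs @ ys @ zs)"
proof -
  have wf': "edge_on V f" if "(f, s) \<in> set xs \<or> (f, s) \<in> set ys \<or> (f, s) \<in> set zs" for f s
    using wf that by force
  have "num_loops V (xs @ (e, 1) # ys @ (e, 1) # zs)
      = nloops V (map Some xs @ Some (e, 1) # map Some ys @ Some (e, 1) # map Some zs)"
    using wf e by (subst num_loops_eq_nloops) auto
  also have "\<dots> = nloops V (map Some xs @ None # map Some ys @ None # map Some zs)"
    by (rule nloops_cancel[OF e]) (use ys wf in \<open>simp_all only: map_append[symmetric] Some_links\<close>)
  also have "\<dots> = nloops V (map Some xs @ map Some ys @ None # map Some zs)"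
    by (rule nloops_None) (use wf' in auto)
  also have "\<dots> = nloops V ((map Some xs @ map Some ys) @ map Some zs)"
    using nloops_None[of "map Some xs @ map Some ys" "map Some zs" V] wf' by auto
  also have "\<dots> = num_loops V (xs @ ys @ zs)"
    using num_loops_eq_nloops[OF wf] by simp
  finally show ?thesis .
qed

section \<open>Blocking edges\<close>

definition del :: "nat \<Rightarrow> 'a list \<Rightarrow> 'a list" where
  "del i c = take i c @ drop (Suc i) c"

definition ins :: "nat \<Rightarrow> 'a \<Rightarrow> 'a list \<Rightarrow> 'a list" where
  "ins i l c = take i c @ l # drop i c"

definition rmv :: "'v set \<Rightarrow> 'v link_conf \<Rightarrow> 'v link_conf" where
  "rmv e c = filter (\<lambda>l. fst l \<noteq> e) c"

lemma append_Cons_split: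
  assumes "xs @ l # ys = as @ x # bs" "l \<noteq> x"
  shows "(\<exists>us. as = xs @ l # us \<and> ys = us @ x # bs) \<or> (\<exists>us. xs = as @ x # us \<and> bs = us @ l # ys)"
proof -
  obtain us where "xs = as @ us \<and> us @ l # ys = x # bs \<or> xs @ us = as \<and> l # ys = us @ x # bs"
    using assms(1) unfolding append_eq_append_conv2 by blast
  then show ?thesis using assms(2) by (cases us) auto
qed

lemma append_eq_append_ConsD:
  assumes "ys @ zs = us @ x # vs" "x \<notin> set ys"
  shows "\<exists>ws. us = ys @ ws \<and> zs = ws @ x # vs"
proof -
  obtain ts where "ys = us @ ts \<and> ts @ zs = x # vs \<or> ys @ ts = us \<and> zs = ts @ x # vs"
    using assms(1) unfolding append_eq_append_conv2 by blast
  then show ?thesis using assms(2) by (cases ts) auto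
qed

lemma split_last_unique:
  assumes "xs @ x # ys = xs' @ x' # ys'" "P x" "P x'" "\<forall>y\<in>set ys. \<not> P y" "\<forall>y\<in>set ys'. \<not> P y"
  shows "xs = xs' \<and> x = x' \<and> ys = ys'"
proof -
  obtain us where "xs = xs' @ us \<and> us @ x # ys = x' # ys' \<or> xs @ us = xs' \<and> x # ys = us @ x' # ys'"
    using assms(1) unfolding append_eq_append_conv2 by blast
  then show ?thesis using assms(2-5) by (cases us) auto
qed

lemma split_first_unique:
  assumes "xs @ x # ys = xs' @ x' # ys'" "P x" "P x'" "\<forall>y\<in>set xs. \<not> P y" "\<forall>y\<in>set xs'. \<not> P y"
  shows "xs = xs' \<and> x = x' \<and> ys = ys'"
proof -
  obtain us where "xs = xs' @ us \<and> us @ x # ys = x' # ys' \<or> xs @ us = xs' \<and> x # ys = us @ x' # ys'"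
    using assms(1) unfolding append_eq_append_conv2 by blast
  then show ?thesis using assms(2-5) by (cases us) auto
qed

lemma filter_eq_append_ConsD:
  "filter P c = xs @ x # zs \<Longrightarrow> \<exists>as bs. c = as @ x # bs \<and> filter P as = xs \<and> filter P bs = zs"
proof (induction c arbitrary: xs)
  case (Cons a c)
  show ?case
  proof (cases "P a \<and> xs = []")
    case True
    then show ?thesis using Cons.prems by (intro exI[of _ "[]"] exI[of _ c]) auto
  next
    case False
    then have "filter P c = (if P a then tl xs else xs) @ x # zs"
      using Cons.prems by (cases xs) (auto split: if_splits)
    from Cons.IH[OF this] obtain as bs where
      "c = as @ x # bs" "filter P as = (if P a then tl xs else xs)" "filter P bs = zs" by blast
    moreover have "P a \<Longrightarrow> xs = a # tl xs" using False Cons.prems by (cases xs) auto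
    ultimately show ?thesis by (intro exI[of _ "a # as"] exI[of _ bs]) auto
  qed
qed simp

lemma del_append: "del (length xs) (xs @ l # ys) = xs @ ys"
  by (simp add: del_def)

lemma nth_split: "i < length c \<Longrightarrow> c = take i c @ c ! i # drop (Suc i) c"
  by (rule id_take_nth_drop)

lemma N_e_append [simp]: "N_e e (xs @ ys) = N_e e xs + N_e e ys"
  by (simp add: N_e_def)

lemma N_e_Cons: "N_e e (l # ys) = (if fst l = e then Suc (N_e e ys) else N_e e ys)"
  by (simp add: N_e_def)

lemma N_e_0_iff: "N_e e c = 0 \<longleftrightarrow> e \<notin> fst ` set c"
  by (auto simp: N_e_def filter_empty_conv)

lemma N_e_card: "N_e e c = card {i. i < length c \<and> fst (c ! i) = e}"
  by (simp add: N_e_def length_filter_conv_card)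

definition blk :: "'v set \<Rightarrow> 'v link_conf \<Rightarrow> 'v link_conf \<Rightarrow> 'v link_conf \<Rightarrow> bool" where
  "blk e xs ys zs \<longleftrightarrow> e \<notin> fst ` set xs \<and> e \<notin> fst ` set zs \<and> (\<forall>l\<in>set ys. fst l \<inter> e = {})"

text \<open>With this factorisation, deleting, inserting and exchanging links become rewriting of
  lists instead of arithmetic on indices.\<close>

lemma blocking_iff:
  assumes "e \<noteq> {}"
  shows "blocking e c \<longleftrightarrow> (\<exists>xs ys zs. c = xs @ (e, 1) # ys @ (e, 1) # zs \<and> blk e xs ys zs)"
proof
  assume b: "blocking e c"
  then have "length (filter (\<lambda>l. fst l = e) c) = 2" by (simp add: blocking_def N_e_def)
  then obtain l1 l2 where "filter (\<lambda>l. fst l = e) c = [l1, l2]"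
    by (auto simp: numeral_2_eq_2 length_Suc_conv)
  then have l12: "filter (\<lambda>l. fst l = e) c = [] @ l1 # [l2]" by simp
  from filter_eq_append_ConsD[OF l12] obtain xs bs where
    c1: "c = xs @ l1 # bs" "filter (\<lambda>l. fst l = e) xs = []" "filter (\<lambda>l. fst l = e) bs = [] @ l2 # []" by auto
  from filter_eq_append_ConsD[OF c1(3)] obtain ys zs where
    c2: "bs = ys @ l2 # zs" "filter (\<lambda>l. fst l = e) ys = []" "filter (\<lambda>l. fst l = e) zs = []" by auto
  have "l1 \<in> set (filter (\<lambda>l. fst l = e) c)" "l2 \<in> set (filter (\<lambda>l. fst l = e) c)"
    by (simp_all only: l12) simp_all
  then have l: "fst l1 = e" "fst l2 = e" unfolding set_filter by blast+
  have c: "c = xs @ l1 # ys @ l2 # zs"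
    and n: "\<forall>l\<in>set xs. fst l \<noteq> e" "\<forall>l\<in>set zs. fst l \<noteq> e"
    using c1 c2 by (simp_all add: filter_empty_conv)
  let ?i = "length xs" and ?j = "length xs + 1 + length ys"
  have ij: "c ! ?i = l1" "c ! ?j = l2" "?i < length c" "?j < length c" by (auto simp: c nth_append)
  have s: "l1 = (e, 1)" "l2 = (e, 1)"
    using b ij l unfolding blocking_def by (metis prod.collapse)+
  have "fst y \<inter> e = {}" if y: "y \<in> set ys" for y
  proof -
    obtain k where k: "k < length ys" "y = ys ! k" using y by (auto simp: in_set_conv_nth)
    have "c ! (length xs + 1 + k) = y" using k by (auto simp: c nth_append)
    moreover have "fst (c ! (length xs + 1 + k)) \<inter> e = {}"
      using b ij l k(1) unfolding blocking_def by (smt (verit) add_less_cancel_left less_add_same_cancel1 add.assoc zero_less_one trans_less_add1)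
    ultimately show ?thesis by simp
  qed
  then show "\<exists>xs ys zs. c = xs @ (e, 1) # ys @ (e, 1) # zs \<and> blk e xs ys zs"
    using c s n by (intro exI[of _ xs] exI[of _ ys] exI[of _ zs]) (auto simp: blk_def)
next
  assume "\<exists>xs ys zs. c = xs @ (e, 1) # ys @ (e, 1) # zs \<and> blk e xs ys zs"
  then obtain xs ys zs where c: "c = xs @ (e, 1) # ys @ (e, 1) # zs" and b: "blk e xs ys zs" by blast
  have ys: "e \<notin> fst ` set ys" using b assms by (auto simp: blk_def)
  let ?i = "length xs" and ?j = "length xs + 1 + length ys"
  have nc: "c ! i = (if i < ?i then xs ! i else if i = ?i then (e, 1) else if i < ?j then ys ! (i - ?i - 1)
      else if i = ?j then (e, 1) else zs ! (i - ?j - 1))" for i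
    by (auto simp: c nth_append nth_Cons')
  have len: "length c = ?j + 1 + length zs" by (simp add: c)
  have xn: "fst (xs ! i) \<noteq> e" if "i < length xs" for i using that b by (auto simp: blk_def)
  have yn: "fst (ys ! i) \<inter> e = {}" if "i < length ys" for i using that b by (auto simp: blk_def)
  have zn: "fst (zs ! i) \<noteq> e" if "i < length zs" for i using that b by (auto simp: blk_def)
  have pos: "i = ?i \<or> i = ?j" if i: "i < length c" "fst (c ! i) = e" for i
  proof (rule ccontr)
    assume n: "\<not> (i = ?i \<or> i = ?j)"
    then consider "i < ?i" | "?i < i" "i < ?j" | "?j < i" by linarith
    then show False
    proof cases
      case 1
      then show False using xn[of i] i(2) by (simp add: nc)
    next
      case 2
      then have "i - ?i - 1 < length ys" by linarith
      then show False using 2 yn[of "i - ?i - 1"] i(2) assms by (simp add: nc)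
    next
      case 3
      then show False using zn[of "i - ?j - 1"] i by (simp add: nc len)
    qed
  qed
  have "snd (c ! i) = 1" if "i < length c" "fst (c ! i) = e" for i
    using pos[OF that] by (auto simp: nc)
  moreover have "fst (c ! k) \<inter> e = {}"
    if "i < j" "j < length c" "fst (c ! i) = e" "fst (c ! j) = e" "i < k" "k < j" for i j k
  proof -
    have "i = ?i" "j = ?j" using pos[of i] pos[of j] that by auto
    then have "?i < k" "k < ?j" "k - ?i - 1 < length ys" using that(5,6) by linarith+
    then show ?thesis using yn[of "k - ?i - 1"] by (simp add: nc)
  qed
  moreover have "N_e e c = 2"
    using b ys by (auto simp: c blk_def N_e_Cons N_e_0_iff[symmetric])
  ultimately show "blocking e c" unfolding blocking_def by blast
qed

lemma blockingI:
  assumes "c = xs @ (e, 1) # ys @ (e, 1) # zs" "blk e xs ys zs" "e \<noteq> {}"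
  shows "blocking e c"
  unfolding blocking_iff[OF assms(3)] using assms(1,2) by (intro exI conjI)

lemma blockingE:
  assumes "blocking e c" "e \<noteq> {}"
  obtains xs ys zs where "c = xs @ (e, 1) # ys @ (e, 1) # zs" "blk e xs ys zs"
  using assms(1) unfolding blocking_iff[OF assms(2)] by (elim exE conjE) (rule that)

lemma blocking_N_e: "blocking e c \<Longrightarrow> N_e e c = 2"
  by (simp add: blocking_def)

lemma blocking_filter:
  assumes "blocking f c" "f \<noteq> {}" "\<forall>l\<in>set c. fst l = f \<longrightarrow> P l"
  shows "blocking f (filter P c)"
proof -
  obtain xs ys zs where c: "c = xs @ (f, 1) # ys @ (f, 1) # zs" "blk f xs ys zs"
    using assms(1,2) by (blast elim: blockingE)
  then have "filter P c = filter P xs @ (f, 1) # filter P ys @ (f, 1) # filter P zs"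
    using assms(3) by auto
  moreover have "blk f (filter P xs) (filter P ys) (filter P zs)"
    using c(2) by (auto simp: blk_def)
  ultimately show ?thesis using assms(2) by (blast intro: blockingI)
qed

text \<open>Whether \<open>f\<close> is blocking depends only on the sublist of the links that meet
  \<open>f\<close>.\<close>

lemma blocking_filter_iff:
  assumes "f \<noteq> {}" and P: "\<forall>l\<in>set c. fst l \<inter> f \<noteq> {} \<longrightarrow> P l"
  shows "blocking f (filter P c) \<longleftrightarrow> blocking f c"
proof
  assume "blocking f (filter P c)"
  then obtain xs ys zs where "filter P c = xs @ (f, 1) # ys @ (f, 1) # zs" and b: "blk f xs ys zs"
    using assms(1) by (blast elim: blockingE)
  then obtain as bs where c: "c = as @ (f, 1) # bs" "filter P as = xs" "filter P bs = ys @ (f, 1) # zs"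
    by (metis filter_eq_append_ConsD)
  then obtain cs ds where d: "bs = cs @ (f, 1) # ds" "filter P cs = ys" "filter P ds = zs"
    by (metis filter_eq_append_ConsD)
  have P': "P l" if "l \<in> set as \<union> set cs \<union> set ds" "fst l \<inter> f \<noteq> {}" for l
    using that P c(1) d(1) by auto
  have "l \<in> set xs" if "l \<in> set as" "fst l \<inter> f \<noteq> {}" for l
    unfolding c(2)[symmetric] using that P' by auto
  moreover have "l \<in> set ys" if "l \<in> set cs" "fst l \<inter> f \<noteq> {}" for l
    unfolding d(2)[symmetric] using that P' by auto
  moreover have "l \<in> set zs" if "l \<in> set ds" "fst l \<inter> f \<noteq> {}" for l
    unfolding d(3)[symmetric] using that P' by auto
  ultimately have "blk f as cs ds"
    using b assms(1) unfolding blk_def by blast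
  then show "blocking f c" using assms(1) c d by (intro blockingI) auto
next
  assume "blocking f c"
  then show "blocking f (filter P c)" using assms by (intro blocking_filter) auto
qed

text \<open>The parts of the factorisation around \<open>g\<close> can only lose a link. So
  deletions on other edges may create blocking edges but never destroy them.\<close>

lemma blocking_remove:
  assumes "blocking g (xs @ l # ys)" "fst l \<noteq> g" "g \<noteq> {}"
  shows "blocking g (xs @ ys)"
proof -
  obtain as bs cs where eq: "xs @ l # ys = as @ (g, 1) # bs @ (g, 1) # cs" and b: "blk g as bs cs"
    using assms(1,3) by (blast elim: blockingE)
  have l: "l \<noteq> (g, 1)" using assms(2) by auto
  from append_Cons_split[OF eq l]
  consider us where "as = xs @ l # us" "ys = us @ (g, 1) # bs @ (g, 1) # cs"
    | us where "xs = as @ (g, 1) # us" "us @ l # ys = bs @ (g, 1) # cs" by metis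
  then show ?thesis
  proof cases
    case 1
    then have "blk g (xs @ us) bs cs" using b by (auto simp: blk_def)
    then show ?thesis using assms(3) 1 by (intro blockingI[OF _ \<open>blk g (xs @ us) bs cs\<close>]) auto
  next
    case 2
    from append_Cons_split[OF 2(2) l]
    consider vs where "bs = us @ l # vs" "ys = vs @ (g, 1) # cs"
      | vs where "us = bs @ (g, 1) # vs" "cs = vs @ l # ys" by metis
    then show ?thesis
    proof cases
      case 1
      then have "blk g as (us @ vs) cs" using b by (auto simp: blk_def)
      then show ?thesis using assms(3) 1 2 by (intro blockingI[OF _ \<open>blk g as (us @ vs) cs\<close>]) auto
    next
      case B: 2
      then have "blk g as bs (vs @ ys)" using b by (auto simp: blk_def)
      then show ?thesis using assms(3) B 2 by (intro blockingI[OF _ \<open>blk g as bs (vs @ ys)\<close>]) auto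
    qed
  qed
qed

text \<open>Time reversal, which turns a statement about the second of two crosses into one about
  the first.\<close>

lemma blocking_rev:
  assumes "e \<noteq> {}"
  shows "blocking e (rev c) \<longleftrightarrow> blocking e c"
proof -
  have "blocking e (rev c)" if c: "blocking e c" for c
  proof -
    obtain xs ys zs where "c = xs @ (e, 1) # ys @ (e, 1) # zs" "blk e xs ys zs"
      using c assms by (blast elim: blockingE)
    then have "rev c = rev zs @ (e, 1) # rev ys @ (e, 1) # rev xs" "blk e (rev zs) (rev ys) (rev xs)"
      by (auto simp: blk_def)
    then show ?thesis using assms by (blast intro: blockingI)
  qed
  from this[of c] this[of "rev c"] show ?thesis by auto
qed

lemma blocking_insert_disjoint:
  assumes "blocking g (xs @ ys)" "fst l \<inter> g = {}" "g \<noteq> {}"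
  shows "blocking g (xs @ l # ys)"
proof -
  define P where "P m \<longleftrightarrow> fst m \<inter> g \<noteq> {}" for m :: "'a set \<times> int"
  have "filter P (xs @ l # ys) = filter P (xs @ ys)" using assms(2) by (simp add: P_def)
  then show ?thesis
    using blocking_filter_iff[OF assms(3), of _ P] assms(1) by (metis P_def)
qed

text \<open>If \<open>g\<close> meets \<open>f\<close>, then \<open>g\<close> has no link between
  the two crosses on \<open>f\<close>; both therefore lie in the same part of any factorisation
  around \<open>g\<close>, and the second one changes nothing. If \<open>g\<close> is disjoint from
  \<open>f\<close>, neither cross matters to \<open>g\<close>. This drives the deletion of a
  neighbour's second link, the exchange \<open>swap\<close> and the insertion of the second cross on
  \<open>e\<close>.\<close>

lemma blocking_merge:
  assumes b: "blk f xs ys zs" and g: "g \<noteq> f" "g \<noteq> {}" and f: "f \<noteq> {}"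
  shows "blocking g (xs @ (f, 1) # ys @ (f, 1) # zs) \<longleftrightarrow> blocking g (xs @ (f, 1) # ys @ zs)"
proof
  assume "blocking g (xs @ (f, 1) # ys @ (f, 1) # zs)"
  then show "blocking g (xs @ (f, 1) # ys @ zs)"
    using blocking_remove[of g "xs @ (f, 1) # ys" "(f, 1)" zs] g by auto
next
  assume a: "blocking g (xs @ (f, 1) # ys @ zs)"
  show "blocking g (xs @ (f, 1) # ys @ (f, 1) # zs)"
  proof (cases "f \<inter> g = {}")
    case True
    then show ?thesis
      using a blocking_insert_disjoint[of g "xs @ (f, 1) # ys" zs "(f, 1)"] g by auto
  next
    case False
    have gys: "(g, 1) \<notin> set ys" using b False by (force simp: blk_def)
    obtain as bs cs where eq: "xs @ (f, 1) # ys @ zs = as @ (g, 1) # bs @ (g, 1) # cs" and b': "blk g as bs cs"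
      using a g(2) by (blast elim: blockingE)
    have l: "(f, 1::int) \<noteq> (g, 1)" using g by auto
    from append_Cons_split[OF eq l]
    consider us where "as = xs @ (f, 1) # us" "ys @ zs = us @ (g, 1) # bs @ (g, 1) # cs"
      | us where "xs = as @ (g, 1) # us" "us @ (f, 1) # ys @ zs = bs @ (g, 1) # cs" by metis
    then show ?thesis
    proof cases
      case 1
      then obtain ws where ws: "us = ys @ ws" "zs = ws @ (g, 1) # bs @ (g, 1) # cs"
        using append_eq_append_ConsD[OF 1(2) gys] by blast
      then have "blk g (xs @ (f, 1) # ys @ (f, 1) # ws) bs cs" using b' 1 g by (auto simp: blk_def)
      then show ?thesis using g(2) ws
        by (intro blockingI[OF _ \<open>blk g (xs @ (f, 1) # ys @ (f, 1) # ws) bs cs\<close>]) auto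
    next
      case 2
      from append_Cons_split[OF 2(2) l]
      consider vs where "bs = us @ (f, 1) # vs" 
        | vs where "us = bs @ (g, 1) # vs" "cs = vs @ (f, 1) # ys @ zs" by metis
      then show ?thesis
      proof cases
        case 1
        then show ?thesis using b' False by (auto simp: blk_def)
      next
        case B: 2
        then have "blk g as bs (vs @ (f, 1) # ys @ (f, 1) # zs)" using b' g by (auto simp: blk_def)
        then show ?thesis using g(2) B 2 by (intro blockingI[OF _ \<open>blk g as bs (vs @ (f, 1) # ys @ (f, 1) # zs)\<close>]) auto
      qed
    qed
  qed
qed

lemma blocking_merge':
  assumes b: "blk f xs ys zs" and g: "g \<noteq> f" "g \<noteq> {}" and f: "f \<noteq> {}"
  shows "blocking g (xs @ (f, 1) # ys @ (f, 1) # zs) \<longleftrightarrow> blocking g (xs @ ys @ (f, 1) # zs)"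
proof -
  have "blk f (rev zs) (rev ys) (rev xs)" using b by (auto simp: blk_def)
  note m = blocking_merge[OF this g f]
  have "rev zs @ (f, 1) # rev ys @ (f, 1) # rev xs = rev (xs @ (f, 1) # ys @ (f, 1) # zs)"
    "rev zs @ (f, 1) # rev ys @ rev xs = rev (xs @ ys @ (f, 1) # zs)" by simp_all
  then show ?thesis using m blocking_rev[OF g(2)] by metis
qed

lemma N_e_del:
  assumes "i < length c"
  shows "N_e f c = N_e f (del i c) + (if fst (c ! i) = f then 1 else 0)"
proof -
  have "N_e f c = N_e f (take i c @ c ! i # drop (Suc i) c)" using nth_split[OF assms] by simp
  then show ?thesis by (simp add: del_def N_e_Cons)
qed

lemma set_del: "set (del i c) \<subseteq> set c"
  by (auto simp: del_def dest: in_set_takeD in_set_dropD)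

lemma length_del: "i < length c \<Longrightarrow> length c = Suc (length (del i c))"
  by (simp add: del_def)

lemma rmv_del:
  assumes "i < length c" "fst (c ! i) = e"
  shows "rmv e (del i c) = rmv e c"
proof -
  have "rmv e c = rmv e (take i c @ c ! i # drop (Suc i) c)" using nth_split[OF assms(1)] by simp
  then show ?thesis using assms(2) by (simp add: rmv_def del_def)
qed

lemma append_Cons_cases:
  assumes "xs @ ys = as @ x # bs"
  shows "(\<exists>us. xs = as @ x # us \<and> bs = us @ ys) \<or> (\<exists>us. as = xs @ us \<and> ys = us @ x # bs)"
proof -
  obtain us where "xs = as @ us \<and> us @ ys = x # bs \<or> xs @ us = as \<and> ys = us @ x # bs"
    using assms unfolding append_eq_append_conv2 by blast
  then show ?thesis by (cases us) auto
qed

text \<open>An insertion into one of the outer parts preserves the factorisation around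
  \<open>g\<close>, so a destructive one falls between the two crosses.\<close>

lemma blocking_insert_between:
  assumes "blocking g (xs @ ys)" "\<not> blocking g (xs @ l # ys)" "fst l \<noteq> g" "g \<noteq> {}"
  obtains as bs bs' cs where "xs = as @ (g, 1) # bs" "ys = bs' @ (g, 1) # cs" "blk g as (bs @ bs') cs"
proof -
  obtain as bs cs where eq: "xs @ ys = as @ (g, 1) # bs @ (g, 1) # cs" and b: "blk g as bs cs"
    using assms(1,4) by (blast elim: blockingE)
  from append_Cons_cases[OF eq]
  consider us where "xs = as @ (g, 1) # us" "us @ ys = bs @ (g, 1) # cs"
    | us where "as = xs @ us" "ys = us @ (g, 1) # bs @ (g, 1) # cs" by metis
  then show thesis
  proof cases
    case 1
    from append_Cons_cases[OF 1(2)]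
    consider vs where "us = bs @ (g, 1) # vs" "cs = vs @ ys"
      | vs where "bs = us @ vs" "ys = vs @ (g, 1) # cs" by metis
    then show thesis
    proof cases
      case B: 1
      have "blk g as bs (vs @ l # ys)" using b B assms(3) by (auto simp: blk_def)
      then have "blocking g (xs @ l # ys)" using 1 B assms(4) by (intro blockingI[where xs = as and ys = bs]) auto
      then show thesis using assms(2) by simp
    next
      case B: 2
      then show thesis using 1 b that by blast
    qed
  next
    case 2
    have "blk g (xs @ l # us) bs cs" using b 2 assms(3) by (auto simp: blk_def)
    then have "blocking g (xs @ l # ys)" using 2 assms(4) by (intro blockingI[where xs = "xs @ l # us" and ys = bs]) auto
    then show thesis using assms(2) by simp
  qed
qed

text \<open>The obstructing link can be read off from \<open>c\<close>: after the first link on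
  \<open>g\<close> it is the next one that meets \<open>g\<close>. Hence each \<open>g\<close>
  obstructs the deletion of at most one link on \<open>f\<close>.\<close>

lemma blocking_insert_between_unique:
  assumes "i < length c" "j < length c" "fst (c ! i) = f" "fst (c ! j) = f" "g \<noteq> f" "f \<inter> g \<noteq> {}"
    and "\<not> blocking g c" "blocking g (del i c)" "blocking g (del j c)"
  shows "i = j"
proof -
  have g: "g \<noteq> {}" using assms(6) by auto
  have split: "\<exists>as bs bs' cs. c = as @ (g, 1) # bs @ c ! i # bs' @ (g, 1) # cs \<and> i = Suc (length as + length bs)
      \<and> blk g as (bs @ bs') cs"
    if "i < length c" "fst (c ! i) = f" "blocking g (del i c)" for i
  proof -
    have c: "c = take i c @ c ! i # drop (Suc i) c" using that(1) by (rule nth_split)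
    have "\<not> blocking g (take i c @ c ! i # drop (Suc i) c)" using assms(7) c by simp
    moreover have "blocking g (take i c @ drop (Suc i) c)" using that(3) by (simp add: del_def)
    moreover have "fst (c ! i) \<noteq> g" using that(2) assms(5) by simp
    ultimately obtain as bs bs' cs where s: "take i c = as @ (g, 1) # bs"
      "drop (Suc i) c = bs' @ (g, 1) # cs" "blk g as (bs @ bs') cs"
      using g by (elim blocking_insert_between)
    have "length (take i c) = i" using that(1) by simp
    then show ?thesis using s c by (intro exI[of _ as] exI[of _ bs] exI[of _ bs'] exI[of _ cs]) simp
  qed
  obtain as bs bs' cs where 1: "c = as @ (g, 1) # bs @ c ! i # bs' @ (g, 1) # cs"
    "i = Suc (length as + length bs)" "blk g as (bs @ bs') cs"
    using split[OF assms(1,3,8)] by blast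
  obtain as2 bs2 bs2' cs2 where 2: "c = as2 @ (g, 1) # bs2 @ c ! j # bs2' @ (g, 1) # cs2"
    "j = Suc (length as2 + length bs2)" "blk g as2 (bs2 @ bs2') cs2"
    using split[OF assms(2,4,9)] by blast
  have "as = as2 \<and> (g, 1) = (g, 1::int) \<and>
      bs @ c ! i # bs' @ (g, 1) # cs = bs2 @ c ! j # bs2' @ (g, 1) # cs2"
    by (rule split_first_unique[where P = "\<lambda>l. fst l = g"])
       (use 1 2 in \<open>auto simp: blk_def\<close>)
  moreover from this have "bs = bs2 \<and> c ! i = c ! j \<and> bs' @ (g, 1) # cs = bs2' @ (g, 1) # cs2"
    by (intro split_first_unique[where P = "\<lambda>l. fst l \<inter> g \<noteq> {}"])
       (use 1 2 assms(3,4,6) in \<open>auto simp: blk_def\<close>)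
  ultimately show ?thesis using 1(2) 2(2) by simp
qed

section \<open>Graphs of bounded degree and the reference configurations\<close>

locale loop_edges =
  fixes V :: "'v set" and E :: "'v set set" and K :: nat
  assumes finV: "finite V" and edges: "\<And>f. f \<in> E \<Longrightarrow> edge_on V f"
    and deg: "\<And>v. v \<in> V \<Longrightarrow> card {f\<in>E. v \<in> f} \<le> K"
begin

lemma finE: "finite E"
proof -
  have "E \<subseteq> Pow V" using edges by (auto simp: edge_on_def)
  then show ?thesis using finV by (meson finite_Pow_iff finite_subset)
qed

lemma edge_nonempty: "f \<in> E \<Longrightarrow> f \<noteq> {}"
  using edges by (auto simp: edge_on_def)

definition nbr :: "'v set \<Rightarrow> 'v set set" where
  "nbr f = {g \<in> E - {f}. g \<inter> f \<noteq> {}}"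

lemma finite_nbr [simp]: "finite (nbr f)"
  using finE by (simp add: nbr_def)

lemma card_nbr:
  assumes "f \<in> E"
  shows "card (nbr f) \<le> 2 * K - 2"
proof -
  obtain a b where ab: "a \<in> V" "b \<in> V" "f = {a, b}" using edges[OF assms] by (auto simp: edge_on_def)
  let ?S = "\<lambda>v. {g\<in>E. v \<in> g} - {f}"
  have "card (?S v) \<le> K - 1" if "v \<in> V" "v \<in> f" for v
    using deg[OF that(1)] that(2) assms finE by (simp add: card_Diff_singleton)
  from this[of a] this[of b] have "card (?S a) + card (?S b) \<le> 2 * K - 2" using ab by auto
  moreover have "nbr f \<subseteq> ?S a \<union> ?S b" using ab by (auto simp: nbr_def)
  then have "card (nbr f) \<le> card (?S a \<union> ?S b)" using finE by (intro card_mono) auto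
  moreover have "card (?S a \<union> ?S b) \<le> card (?S a) + card (?S b)" by (rule card_Un_le)
  ultimately show ?thesis by linarith
qed

lemma two_le_K:
  assumes "e \<in> E" "f \<in> nbr e"
  shows "2 \<le> K"
proof -
  obtain v where v: "v \<in> e" "v \<in> f" using assms(2) by (auto simp: nbr_def)
  have "v \<in> V" using edges[OF assms(1)] v by (auto simp: edge_on_def)
  have "card {e, f} \<le> card {g\<in>E. v \<in> g}"
    using assms v finE by (intro card_mono) (auto simp: nbr_def)
  moreover have "e \<noteq> f" using assms(2) by (simp add: nbr_def) metis
  ultimately show ?thesis using deg[OF \<open>v \<in> V\<close>] by simp
qed

end

locale marked_edge = loop_edges V E K for V :: "'v set" and E K +
  fixes e :: "'v set" and b :: "'v set \<Rightarrow> bool"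
  assumes eE: "e \<in> E"
begin

text \<open>The prescription is \<open>b\<close>; in \<open>Rel G\<close> the edges of \<open>G\<close> may be blocking even if \<open>b\<close> forbids it.\<close>

definition Rel :: "'v set set \<Rightarrow> 'v link_conf set" where
  "Rel G = {c. set c \<subseteq> E \<times> {-1, 1} \<and> N_e e c = 0 \<and>
     (\<forall>f\<in>E - {e}. N_e f c \<ge> 1 \<and> (f \<notin> G \<longrightarrow> (blocking f c \<longleftrightarrow> b f)) \<and> (b f \<longrightarrow> blocking f c))}"

definition Om :: "'v link_conf set" where
  "Om = {c. set c \<subseteq> E \<times> {-1, 1} \<and> N_e e c = 0 \<and> (\<forall>f\<in>E - {e}. N_e f c \<ge> 1 \<and> (blocking f c \<longleftrightarrow> b f))}"

text \<open>The conditional probability to be bounded from below is the weight of \<open>Z1\<close>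
  divided by that of \<open>Z\<close>.\<close>

definition Z :: "'v link_conf set" where
  "Z = {c. set c \<subseteq> E \<times> {-1, 1} \<and> (\<forall>f\<in>E. N_e f c \<ge> 1) \<and> (\<forall>f\<in>E - {e}. blocking f c \<longleftrightarrow> b f)}"

definition Z1 :: "'v link_conf set" where
  "Z1 = {c \<in> Z. blocking e c}"

lemma Rel_empty: "Rel {} = Om"
  by (auto simp: Rel_def Om_def)

lemma N_e_rmv: "f \<noteq> e \<Longrightarrow> N_e f (rmv e c) = N_e f c" "N_e e (rmv e c) = 0"
  by (auto simp: N_e_def rmv_def intro!: arg_cong[of _ _ length] filter_cong)

text \<open>Deleting the links on \<open>e\<close> destroys no other blocking edge and can create
  one only among the edges meeting \<open>e\<close>; hence the exemption of
  \<open>nbr e\<close>.\<close>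

lemma Z_rmv: "c \<in> Z \<Longrightarrow> rmv e c \<in> Rel (nbr e)"
proof -
  assume c: "c \<in> Z"
  have "blocking f (rmv e c)" if "f \<in> E - {e}" "blocking f c" for f
    using that edge_nonempty unfolding rmv_def by (intro blocking_filter) auto
  moreover have "blocking f (rmv e c) \<longleftrightarrow> blocking f c" if "f \<in> E - {e}" "f \<notin> nbr e" for f
    using that edge_nonempty unfolding rmv_def by (intro blocking_filter_iff) (auto simp: nbr_def)
  ultimately show ?thesis
    using c by (auto simp: Z_def Rel_def N_e_rmv) (auto simp: rmv_def)
qed

text \<open>Here \<open>f\<close> makes use of its exemption: it is blocking against the
  prescription. Deleting its second cross leaves one link on \<open>f\<close>, which keeps
  \<open>f\<close> occupied but not blocking, and \<open>blocking_merge\<close> protects all other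
  indicators.\<close>

lemma Rel_insert:
  assumes "c \<in> Rel (insert f G)" "f \<in> nbr e" "f \<notin> G" "c \<notin> Rel G"
  shows "\<exists>i<length c. c ! i = (f, 1) \<and> del i c \<in> Rel G"
proof -
  have f: "f \<in> E - {e}" "f \<noteq> {}" using assms(2) edge_nonempty by (auto simp: nbr_def)
  have fb: "blocking f c" "\<not> b f" using assms f by (auto simp: Rel_def)
  obtain xs ys zs where c: "c = xs @ (f, 1) # ys @ (f, 1) # zs" and k: "blk f xs ys zs"
    using fb f by (blast elim: blockingE)
  let ?i = "length (xs @ (f, 1) # ys)"
  have i: "?i < length c" "c ! ?i = (f, 1)" and d: "del ?i c = xs @ (f, 1) # ys @ zs"
    using del_append[of "xs @ (f, 1) # ys" "(f, 1)" zs] by (simp_all add: c nth_append)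
  have bl: "blocking g (del ?i c) \<longleftrightarrow> blocking g c" if "g \<in> E" "g \<noteq> f" for g
    using blocking_merge[OF k that(2) edge_nonempty[OF that(1)] f(2)] by (simp only: c d[unfolded c])
  have N: "N_e g (del ?i c) = N_e g c" if "g \<noteq> f" for g
    using N_e_del[OF i(1), of g] i(2) that by simp
  have Nf: "N_e f (del ?i c) = 1"
    using N_e_del[OF i(1), of f] i(2) blocking_N_e[OF fb(1)] by simp
  then have nf: "\<not> blocking f (del ?i c)" using blocking_N_e by fastforce
  have s: "set (del ?i c) \<subseteq> E \<times> {-1, 1}"
    using assms(1) set_del[of ?i c] by (simp add: Rel_def) blast
  have Ne: "N_e e (del ?i c) = 0" using N[of e] f assms(1) by (simp add: Rel_def) metis
  have "N_e g (del ?i c) \<ge> 1 \<and> (g \<notin> G \<longrightarrow> (blocking g (del ?i c) \<longleftrightarrow> b g)) \<and> (b g \<longrightarrow> blocking g (del ?i c))"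
    if "g \<in> E - {e}" for g
  proof (cases "g = f")
    case True
    then show ?thesis using Nf nf fb(2) by simp
  next
    case False
    then show ?thesis using assms(1) that bl[of g] N[of g] unfolding Rel_def by simp
  qed
  then have "del ?i c \<in> Rel G"
    unfolding Rel_def using s Ne by blast
  then show ?thesis using i by blast
qed

text \<open>What forbids deleting a link on \<open>f\<close> is some \<open>g\<close> that would
  become blocking. Such a \<open>g\<close> is a neighbour of \<open>f\<close> and is responsible for
  at most one link, so all but at most \<open>2 * K\<close> links on \<open>f\<close> can be deleted
  singly inside \<open>Om\<close>.\<close>

lemma N_e_le_removable:
  assumes c: "c \<in> Om" and f: "f \<in> nbr e"
  shows "N_e f c \<le> card {i. i < length c \<and> fst (c ! i) = f \<and> del i c \<in> Om} + 2 * K"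
\<comment> \<open>From four links on, \<open>f\<close> is blocking neither before nor after one
  deletion and stays occupied. Up to three links are covered by \<open>2 * K\<close>, since an edge
  with a neighbour forces \<open>K \<ge> 2\<close>.\<close>
proof (cases "N_e f c \<le> 3")
  case True
  then show ?thesis using two_le_K[OF eE f] by linarith
next
  case False
  have fE: "f \<in> E - {e}" "f \<noteq> {}" using f edge_nonempty by (auto simp: nbr_def)
  let ?P = "{i. i < length c \<and> fst (c ! i) = f}"
  let ?R = "{i. i < length c \<and> fst (c ! i) = f \<and> del i c \<in> Om}"
  let ?Q = "\<lambda>g. {i \<in> ?P. \<not> blocking g c \<and> blocking g (del i c)}"
  have "?P - ?R \<subseteq> (\<Union>g\<in>nbr f. ?Q g)"
  proof
    fix i assume i: "i \<in> ?P - ?R"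
    have N: "N_e g c = N_e g (del i c) + (if g = f then 1 else 0)" for g
      using N_e_del[of i c g] i by auto
    have "\<not> blocking f c" "\<not> blocking f (del i c)" using False N[of f] blocking_N_e[of f] by fastforce+
    then have "blocking f (del i c) \<longleftrightarrow> b f" using c fE by (auto simp: Om_def)
    moreover have "N_e g (del i c) \<ge> 1" if "g \<in> E - {e}" for g
    proof (cases "g = f")
      case True
      then show ?thesis using N[of f] False by simp
    next
      case False
      then have "N_e g c = N_e g (del i c)" using N[of g] by simp
      moreover have "N_e g c \<ge> 1" using c that unfolding Om_def by blast
      ultimately show ?thesis by simp
    qed
    moreover have "N_e e (del i c) = 0" using N[of e] c by (simp add: Om_def)
    moreover have "del i c \<notin> Om" using i by simp
    moreover have "set (del i c) \<subseteq> E \<times> {-1, 1}" using c set_del[of i c] unfolding Om_def by blast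
    ultimately have "blocking f (del i c) \<longleftrightarrow> b f" "\<exists>g\<in>E - {e}. blocking g (del i c) \<noteq> b g"
      unfolding Om_def by blast+
    then obtain g where g: "g \<in> E - {e}" "g \<noteq> f" "blocking g (del i c) \<noteq> b g"
      by blast
    have g0: "g \<noteq> {}" using g edge_nonempty by auto
    have cs: "c = take i c @ c ! i # drop (Suc i) c" using nth_split i by blast
    have "blocking g c \<longrightarrow> blocking g (del i c)"
      using blocking_remove[of g "take i c" "c ! i" "drop (Suc i) c"] cs g i g0 by (auto simp: del_def)
    then have gg: "\<not> blocking g c" "blocking g (del i c)" using g c by (auto simp: Om_def)
    moreover have "g \<inter> f \<noteq> {}"
      using blocking_insert_disjoint[of g "take i c" "drop (Suc i) c" "c ! i"] gg cs i g0 by (auto simp: del_def)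
    ultimately show "i \<in> (\<Union>g\<in>nbr f. ?Q g)" using i g by (auto simp: nbr_def)
  qed
  then have "card (?P - ?R) \<le> card (\<Union>g\<in>nbr f. ?Q g)" by (intro card_mono) auto
  also have "\<dots> \<le> (\<Sum>g\<in>nbr f. card (?Q g))" by (rule card_UN_le) simp
  also have "\<dots> \<le> (\<Sum>g\<in>nbr f. 1)"
  proof (rule sum_mono)
    fix g assume "g \<in> nbr f"
    then have "i = j" if "i \<in> ?Q g" "j \<in> ?Q g" for i j
      using that blocking_insert_between_unique[of i c j f g] by (auto simp: nbr_def)
    then show "card (?Q g) \<le> 1" by (auto simp: card_le_Suc0_iff_eq)
  qed
  also have "\<dots> \<le> 2 * K" using card_nbr[of f] fE by simp
  finally have "card (?P - ?R) \<le> 2 * K" .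
  moreover have "card ?P = card (?P - ?R) + card ?R"
    by (subst card_Un_disjoint[symmetric]) (auto intro!: arg_cong[of _ _ card])
  ultimately show ?thesis by (simp add: N_e_card)
qed

section \<open>One additional cross on the marked edge and the exchange chains\<close>

text \<open>\<open>U\<close> consists of the configurations of \<open>Om\<close> with one additional cross on \<open>e\<close>, and \<open>D\<close> of those where this
  cross does not destroy a blocking edge. In \<open>Ux x\<close> it destroys one at the vertex \<open>x\<close>; then
  \<open>swap x\<close> exchanges the cross with the second link of that edge.\<close>

definition U :: "'v link_conf set" where
  "U = {ws @ (e, 1) # us | ws us. ws @ us \<in> Om}"

definition D :: "'v link_conf set" where
  "D = {c \<in> U. \<forall>f\<in>E - {e}. blocking f c \<longleftrightarrow> b f}"

definition Ux :: "'v \<Rightarrow> 'v link_conf set" where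
  "Ux x = {c \<in> U. \<exists>f\<in>E. x \<in> f \<and> f \<noteq> e \<and> blocking f (rmv e c) \<and> \<not> blocking f c}"

definition swap :: "'v \<Rightarrow> 'v link_conf \<Rightarrow> 'v link_conf \<Rightarrow> bool" where
  "swap x c c' \<longleftrightarrow> (\<exists>f xs ys zs ws. x \<in> f \<and> f \<noteq> e \<and> f \<in> E \<and>
     c = xs @ (f, 1) # ys @ (e, 1) # zs @ (f, 1) # ws \<and>
     c' = xs @ (f, 1) # ys @ (f, 1) # zs @ (e, 1) # ws \<and>
     f \<notin> fst ` set xs \<and> f \<notin> fst ` set ws \<and> e \<notin> fst ` set (xs @ ys @ zs @ ws) \<and>
     (\<forall>l\<in>set (ys @ zs). fst l \<inter> f = {}))"

lemma e_nonempty: "e \<noteq> {}"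
  using eE by (rule edge_nonempty)

lemma rmv_id: "N_e e c = 0 \<Longrightarrow> rmv e c = c"
  by (auto simp: rmv_def N_e_0_iff filter_id_conv)

lemma rmv_single: "ws @ us \<in> Om \<Longrightarrow> rmv e (ws @ (e, s) # us) = ws @ us"
  using rmv_id[of "ws @ us"] by (simp add: Om_def rmv_def)

lemma OmD:
  assumes "c \<in> Om"
  shows "set c \<subseteq> E \<times> {-1, 1}" "N_e e c = 0" "f \<in> E \<Longrightarrow> f \<noteq> e \<Longrightarrow> N_e f c \<ge> 1"
    "f \<in> E \<Longrightarrow> f \<noteq> e \<Longrightarrow> blocking f c \<longleftrightarrow> b f"
  using assms unfolding Om_def by blast+

lemma U_E:
  assumes "c \<in> U"
  obtains ws us where "c = ws @ (e, 1) # us" "ws @ us \<in> Om" "rmv e c = ws @ us"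
  using assms rmv_single unfolding U_def by blast

lemma Ux_swap:
  assumes "c \<in> Ux x"
  shows "\<exists>c'. swap x c c'"
proof -
  have "c \<in> U" using assms by (simp add: Ux_def)
  then obtain ws us where c: "c = ws @ (e, 1) # us" "ws @ us \<in> Om" "rmv e c = ws @ us" by (rule U_E)
  obtain f where f: "f \<in> E" "x \<in> f" "f \<noteq> e" "blocking f (ws @ us)" "\<not> blocking f (ws @ (e, 1) # us)"
    using assms c unfolding Ux_def by auto
  have "fst (e, 1::int) \<noteq> f" using f(3) by simp
  from blocking_insert_between[OF f(4,5) this edge_nonempty[OF f(1)]]
  obtain as bs bs' cs where s: "ws = as @ (f, 1) # bs" "us = bs' @ (f, 1) # cs" "blk f as (bs @ bs') cs" .
  have "e \<notin> fst ` set (ws @ us)" using OmD(2)[OF c(2)] by (simp add: N_e_0_iff image_Un)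
  then show ?thesis
    unfolding swap_def using f s c(1)
    by (intro exI[of _ "as @ (f, 1) # bs @ (f, 1) # bs' @ (e, 1) # cs"] exI[of _ f] exI[of _ as]
        exI[of _ bs] exI[of _ bs'] exI[of _ cs]) (simp add: blk_def)
qed

text \<open>Looking back in \<open>c\<close> from its only cross on \<open>e\<close>, the first link
  that touches \<open>x\<close> is the one to exchange it with, and it also reveals the edge. This
  is why \<open>swap\<close> carries the vertex \<open>x\<close>.\<close>

lemma swap_inj:
  assumes "swap x c1 c" "swap x c2 c"
  shows "c1 = c2"
proof -
  obtain f xs ys zs ws where 1: "x \<in> f" "f \<noteq> e" "c1 = xs @ (f, 1) # ys @ (e, 1) # zs @ (f, 1) # ws"
     "c = xs @ (f, 1) # ys @ (f, 1) # zs @ (e, 1) # ws"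
     "f \<notin> fst ` set xs" "e \<notin> fst ` set (xs @ ys @ zs @ ws)" "\<forall>l\<in>set (ys @ zs). fst l \<inter> f = {}"
    using assms(1) unfolding swap_def by blast
  obtain g xs' ys' zs' ws' where 2: "x \<in> g" "g \<noteq> e" "c2 = xs' @ (g, 1) # ys' @ (e, 1) # zs' @ (g, 1) # ws'"
     "c = xs' @ (g, 1) # ys' @ (g, 1) # zs' @ (e, 1) # ws'"
     "g \<notin> fst ` set xs'" "e \<notin> fst ` set (xs' @ ys' @ zs' @ ws')" "\<forall>l\<in>set (ys' @ zs'). fst l \<inter> g = {}"
    using assms(2) unfolding swap_def by blast
  have "(xs @ (f, 1) # ys @ (f, 1) # zs) @ (e, 1) # ws = (xs' @ (g, 1) # ys' @ (g, 1) # zs') @ (e, 1) # ws'"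
    using 1(4) 2(4) by simp
  moreover have "\<forall>l\<in>set (xs @ (f, 1) # ys @ (f, 1) # zs). \<not> fst l = e" using 1(2,6) by auto
  moreover have "\<forall>l\<in>set (xs' @ (g, 1) # ys' @ (g, 1) # zs'). \<not> fst l = e" using 2(2,6) by auto
  ultimately have "xs @ (f, 1::int) # ys @ (f, 1) # zs = xs' @ (g, 1) # ys' @ (g, 1) # zs' \<and>
      (e, 1) = (e, 1::int) \<and> ws = ws'"
    by (intro split_first_unique[where P = "\<lambda>l. fst l = e"]) simp_all
  then have s1: "(xs @ (f, 1::int) # ys) @ (f, 1) # zs = (xs' @ (g, 1) # ys') @ (g, 1) # zs'" "ws = ws'"
    by simp_all
  have "\<forall>l\<in>set zs. \<not> x \<in> fst l" using 1(1,7) by auto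
  moreover have "\<forall>l\<in>set zs'. \<not> x \<in> fst l" using 2(1,7) by auto
  ultimately have "xs @ (f, 1::int) # ys = xs' @ (g, 1) # ys' \<and> (f, 1) = (g, 1::int) \<and> zs = zs'"
    using s1(1) 1(1) 2(1) by (intro split_last_unique[where P = "\<lambda>l. x \<in> fst l"]) simp_all
  then have s2: "xs @ (f, 1::int) # ys = xs' @ (g, 1) # ys'" "f = g" "zs = zs'" by blast+
  have "\<forall>l\<in>set xs. \<not> fst l = f" using 1(5) by auto
  moreover have "\<forall>l\<in>set xs'. \<not> fst l = f" using 2(5) s2(2) by auto
  ultimately have "xs = xs' \<and> (f, 1) = (g, 1::int) \<and> ys = ys'"
    using s2 by (intro split_first_unique[where P = "\<lambda>l. fst l = f"]) simp_all
  then show ?thesis using 1(3) 2(3) s1 s2 by simp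
qed

lemma edge_on_set: "set c \<subseteq> E \<times> {-1, 1} \<Longrightarrow> \<forall>l\<in>set c. edge_on V (fst l)"
  using edges by fastforce

text \<open>The neighbours of \<open>e\<close> with a link after the cross on \<open>e\<close> serve
  as termination measure: an exchange moves the cross behind the last link on
  \<open>f\<close>.\<close>

definition later :: "'v link_conf \<Rightarrow> 'v set set" where
  "later c = fst ` set (dropWhile (\<lambda>l. fst l \<noteq> e) c)"

lemma later_append: "e \<notin> fst ` set ws \<Longrightarrow> later (ws @ (e, s) # us) = insert e (fst ` set us)"
proof -
  assume "e \<notin> fst ` set ws"
  then have "dropWhile (\<lambda>l. fst l \<noteq> e) (ws @ (e, s) # us) = (e, s) # us"
    by (subst dropWhile_append2) auto
  then show ?thesis by (simp add: later_def)
qed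

text \<open>Without the cross on \<open>e\<close>, both configurations have two crosses on
  \<open>f\<close> that agree in their first and have only links disjoint from \<open>f\<close> in
  between. Merging then shows equal indicators and cancellation equal numbers of loops. After the
  exchange nothing is destroyed at \<open>x\<close>: an edge \<open>g\<close> at \<open>x\<close>
  enclosing the cross would either have the second cross on \<open>f\<close> between its own two
  crosses or have a link among those disjoint from \<open>f\<close>.\<close>

lemma swap_props:
  assumes c: "c \<in> U" and sw: "swap x c c'" and x: "x \<in> e"
  shows "c' \<in> U" "c' \<notin> Ux x" "mset c' = mset c" "num_loops V (rmv e c') = num_loops V (rmv e c)"
    "card (nbr e \<inter> later c') < card (nbr e \<inter> later c)"
proof -
  obtain f xs ys zs ws where f: "x \<in> f" "f \<noteq> e" "f \<in> E" and
     ceq: "c = xs @ (f, 1) # ys @ (e, 1) # zs @ (f, 1) # ws" and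
     c'eq: "c' = xs @ (f, 1) # ys @ (f, 1) # zs @ (e, 1) # ws" and
     fx: "f \<notin> fst ` set xs" "f \<notin> fst ` set ws" and en: "e \<notin> fst ` set (xs @ ys @ zs @ ws)" and
     dis: "\<forall>l\<in>set (ys @ zs). fst l \<inter> f = {}"
    using sw unfolding swap_def by blast
  let ?o = "xs @ (f, 1) # ys @ zs @ (f, 1) # ws" and ?o' = "xs @ (f, 1) # ys @ (f, 1) # zs @ ws"
  have f0: "f \<noteq> {}" using f by auto
  have fz: "f \<notin> fst ` set zs" using dis f0 by force
  have en': "rmv e xs = xs" "rmv e ys = ys" "rmv e zs = zs" "rmv e ws = ws"
    using en by (auto simp: rmv_def filter_id_conv)
  have r: "rmv e c = ?o" "rmv e c' = ?o'"
    using f(2) en' by (simp_all add: ceq c'eq rmv_def)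
  have "?o \<in> Om" using c r(1) by (metis U_E)
  note o = OmD[OF this]
  have k: "blk f xs (ys @ zs) ws" "blk f xs ys (zs @ ws)"
    using fx fz dis by (auto simp: blk_def)
  have bg: "blocking g ?o \<longleftrightarrow> blocking g ?o'" if "g \<in> E" for g
  proof (cases "g = f")
    case True
    have "blocking f ?o" using k(1) f0 by (intro blockingI[where xs = xs and ys = "ys @ zs"]) auto
    moreover have "blocking f ?o'" using k(2) f0 by (intro blockingI[where xs = xs and ys = ys]) auto
    ultimately show ?thesis using True by simp
  next
    case False
    then show ?thesis
      using blocking_merge[OF k(1) False edge_nonempty[OF that] f0]
        blocking_merge[OF k(2) False edge_nonempty[OF that] f0] by simp
  qed
  have Ng: "N_e g ?o' = N_e g ?o" for g by (simp add: N_e_Cons)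
  have so: "set ?o' = set ?o" by auto
  have o': "?o' \<in> Om"
    unfolding Om_def mem_Collect_eq so Ng using o bg by blast
  then have "(xs @ (f, 1) # ys @ (f, 1) # zs) @ ws \<in> Om" by simp
  then have "(xs @ (f, 1) # ys @ (f, 1) # zs) @ (e, 1) # ws \<in> U" unfolding U_def by blast
  then show "c' \<in> U" by (simp add: c'eq)
  show "mset c' = mset c" by (simp add: ceq c'eq)
  have ed: "\<forall>l\<in>set (xs @ (ys @ zs) @ ws). edge_on V (fst l)" "\<forall>l\<in>set (xs @ ys @ (zs @ ws)). edge_on V (fst l)"
    using edge_on_set[OF o(1)] by auto
  show "num_loops V (rmv e c') = num_loops V (rmv e c)"
    using num_loops_cancel[OF edges[OF f(3)] _ ed(1)] num_loops_cancel[OF edges[OF f(3)] _ ed(2)] dis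
    by (simp add: r)
  have "e \<notin> fst ` set (xs @ (f, 1) # ys)" "e \<notin> fst ` set (xs @ (f, 1::int) # ys @ (f, 1) # zs)"
    using en f(2) by auto
  from later_append[OF this(1), of 1 "zs @ (f, 1) # ws"] later_append[OF this(2), of 1 ws]
  have l: "later c = insert e (insert f (fst ` set zs \<union> fst ` set ws))" "later c' = insert e (fst ` set ws)"
    by (auto simp: ceq c'eq)
  have "f \<in> nbr e" using f x by (auto simp: nbr_def)
  moreover have "f \<in> later c" "f \<notin> later c'" using fx(2) f(2) unfolding l by simp_all
  moreover have "later c' \<subseteq> later c" unfolding l by (simp only: subset_iff insert_iff Un_iff) simp
  ultimately have "nbr e \<inter> later c' \<subseteq> nbr e \<inter> later c" "f \<in> nbr e \<inter> later c" "f \<notin> nbr e \<inter> later c'"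
    by blast+
  then have "nbr e \<inter> later c' \<subset> nbr e \<inter> later c" by (metis psubsetI)
  then show "card (nbr e \<inter> later c') < card (nbr e \<inter> later c)"
    by (intro psubset_card_mono) auto
  show "c' \<notin> Ux x"
  proof
    assume "c' \<in> Ux x"
    then obtain g where g: "g \<in> E" "x \<in> g" "g \<noteq> e" "blocking g ((xs @ (f, 1) # ys @ (f, 1) # zs) @ ws)"
        "\<not> blocking g ((xs @ (f, 1) # ys @ (f, 1) # zs) @ (e, 1) # ws)"
      using r(2) unfolding Ux_def by (auto simp: c'eq)
    have "fst (e, 1::int) \<noteq> g" using g(3) by simp
    from blocking_insert_between[OF g(4,5) this edge_nonempty[OF g(1)]]
    obtain as bs bs' cs where s: "xs @ (f, 1) # ys @ (f, 1) # zs = as @ (g, 1) # bs"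
      "ws = bs' @ (g, 1) # cs" "blk g as (bs @ bs') cs" .
    have gf: "(f, 1::int) \<noteq> (g, 1)" using s(2) fx(2) by force
    have fg: "f \<inter> g \<noteq> {}" using f g by blast
    have "(xs @ (f, 1) # ys) @ (f, 1) # zs = as @ (g, 1) # bs" using s(1) by simp
    from append_Cons_split[OF this gf] show False
    proof (elim disjE exE conjE)
      fix us assume "zs = us @ (g, 1) # bs"
      then show False using dis fg by (auto simp: Int_commute)
    next
      fix us assume "bs = us @ (f, 1) # zs"
      then show False using s(3) fg by (auto simp: blk_def)
    qed
  qed
qed

text \<open>An insertion on \<open>e\<close> creates no other blocking edge, so leaving
  \<open>D\<close> means destroying one, and that one contains an endpoint of
  \<open>e\<close>.\<close>

lemma U_cases:
  assumes "c \<in> U" "e = {x, y}"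
  shows "c \<in> D \<or> c \<in> Ux x \<or> c \<in> Ux y"
proof (rule ccontr)
  assume n: "\<not> ?thesis"
  obtain ws us where c: "c = ws @ (e, 1) # us" "ws @ us \<in> Om" "rmv e c = ws @ us" using assms(1) by (rule U_E)
  obtain f where f: "f \<in> E" "f \<noteq> e" "blocking f c \<noteq> b f" using n assms(1) unfolding D_def by blast
  have f0: "f \<noteq> {}" using edge_nonempty[OF f(1)] .
  have o: "blocking f (ws @ us) \<longleftrightarrow> b f" using OmD(4)[OF c(2) f(1,2)] .
  have "fst (e, 1::int) \<noteq> f" using f(2) by simp
  then have "blocking f c \<Longrightarrow> b f" using blocking_remove[of f ws "(e, 1)" us] f0 o c(1) by metis
  then have b: "\<not> blocking f c" "blocking f (ws @ us)" using f(3) o by blast+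
  then have "e \<inter> f \<noteq> {}"
    using blocking_insert_disjoint[of f ws us "(e, 1)"] f0 c(1) by auto
  then have "x \<in> f \<or> y \<in> f" using assms(2) by auto
  then show False using n b f assms(1) c(3) unfolding Ux_def by auto
qed

text \<open>An exchange at \<open>x\<close> leaves only \<open>y\<close> as a place of destruction,
  so the vertices alternate. Recording the length and the starting vertex makes the whole sequence
  of exchanges recoverable from its end.\<close>

primrec chain :: "nat \<Rightarrow> 'v \<Rightarrow> 'v \<Rightarrow> 'v link_conf \<Rightarrow> bool" where
  "chain 0 x y c \<longleftrightarrow> c \<in> D"
| "chain (Suc n) x y c \<longleftrightarrow> c \<in> U \<and> (\<exists>c'. swap x c c' \<and> chain n y x c')"

lemma chain_exists_aux:
  assumes "c \<in> U" "c \<notin> Ux x" "e = {x, y}"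
  shows "\<exists>n \<le> card (nbr e \<inter> later c). chain n y x c"
  using assms
proof (induction "card (nbr e \<inter> later c)" arbitrary: c x y rule: less_induct)
  case less
  show ?case
  proof (cases "c \<in> D")
    case True
    then show ?thesis by (intro exI[of _ 0]) simp
  next
    case False
    then have "c \<in> Ux y" using U_cases less.prems by blast
    then obtain c' where c': "swap y c c'" using Ux_swap by blast
    have "y \<in> e" using less.prems by simp
    note p = swap_props[OF less.prems(1) c' this]
    from less.hyps[OF p(5,1,2)] obtain n where
      "n \<le> card (nbr e \<inter> later c')" "chain n x y c'" using less.prems(3) by (auto simp: insert_commute)
    then show ?thesis using p(5) c' less.prems(1) by (intro exI[of _ "Suc n"]) auto
  qed
qed

text \<open>The possible lengths are 1 to \<open>2 * K - 2\<close>, for two starting vertices,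
  besides the empty chain: this is the origin of 4K - 3 = 1 + 2(2K - 2).\<close>

lemma chain_exists:
  assumes "c \<in> U" "e = {x, y}"
  shows "c \<in> D \<or> (\<exists>n<2 * K - 2. chain (Suc n) x y c \<or> chain (Suc n) y x c)"
proof -
  have "\<exists>n \<le> card (nbr e \<inter> later c). chain n y x c \<or> chain n x y c"
  proof (cases "c \<in> Ux x")
    case True
    then obtain c' where c': "swap x c c'" using Ux_swap by blast
    have "x \<in> e" using assms by simp
    note p = swap_props[OF assms(1) c' this]
    from chain_exists_aux[OF p(1,2) assms(2)] obtain n where
      "n \<le> card (nbr e \<inter> later c')" "chain n y x c'" by blast
    then show ?thesis using p(5) c' assms(1) by (intro exI[of _ "Suc n"]) auto
  next
    case False
    then show ?thesis using chain_exists_aux[OF assms(1) False assms(2)] by blast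
  qed
  then obtain n where n: "n \<le> card (nbr e \<inter> later c)" "chain n y x c \<or> chain n x y c" by blast
  have "card (nbr e \<inter> later c) \<le> 2 * K - 2"
    using card_nbr[OF eE] card_mono[of "nbr e" "nbr e \<inter> later c"] by simp
  then show ?thesis using n by (cases n) (auto simp: Suc_le_eq)
qed

section \<open>Gaps between incident links and the second cross\<close>

text \<open>Positions \<open>i\<close> and \<open>p\<close> lie in the same gap between links incident to \<open>e\<close> iff \<open>kcount\<close> agrees on them.\<close>

definition kcount :: "'v link_conf \<Rightarrow> nat \<Rightarrow> nat" where
  "kcount c i = length (filter (\<lambda>l. fst l \<inter> e \<noteq> {}) (take i c))"

definition slots :: "'v link_conf \<Rightarrow> nat \<Rightarrow> nat set" where
  "slots c p = {i. i \<le> length c \<and> kcount c i = kcount c p}"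

lemma finite_slots [simp]: "finite (slots c p)"
  by (simp add: slots_def)

text \<open>The positions of one gap contribute 1 in total, so the sum counts the gaps, and incident
  links separate them.\<close>

lemma sum_inverse_slots:
  "(\<Sum>p\<le>length c. 1 / real (card (slots c p))) \<le> real (length (filter (\<lambda>l. fst l \<inter> e \<noteq> {}) c)) + 1"
proof -
  let ?M = "length (filter (\<lambda>l. fst l \<inter> e \<noteq> {}) c)"
  have k: "kcount c ` {..length c} \<subseteq> {..?M}"
  proof
    fix m assume "m \<in> kcount c ` {..length c}"
    then obtain i where m: "m = kcount c i" by blast
    have "?M = length (filter (\<lambda>l. fst l \<inter> e \<noteq> {}) (take i c @ drop i c))" by simp
    then show "m \<in> {..?M}" unfolding m kcount_def filter_append length_append by simp
  qed
  have "(\<Sum>p\<le>length c. 1 / real (card (slots c p)))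
      = (\<Sum>m\<in>kcount c ` {..length c}. \<Sum>p\<in>{p\<in>{..length c}. kcount c p = m}. 1 / real (card (slots c p)))"
    by (rule sum.image_gen) simp
  also have "\<dots> \<le> (\<Sum>m\<in>kcount c ` {..length c}. 1)"
  proof (rule sum_mono)
    fix m assume m: "m \<in> kcount c ` {..length c}"
    let ?S = "{p\<in>{..length c}. kcount c p = m}"
    have "(\<Sum>p\<in>?S. 1 / real (card (slots c p))) = (\<Sum>p\<in>?S. 1 / real (card ?S))"
      by (rule sum.cong) (auto simp: slots_def intro!: arg_cong[of _ _ card])
    then show "(\<Sum>p\<in>?S. 1 / real (card (slots c p))) \<le> 1" by simp
  qed
  also have "\<dots> = real (card (kcount c ` {..length c}))" by simp
  also have "\<dots> \<le> real (card {..?M})" using k by (intro of_nat_mono card_mono) auto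
  finally show ?thesis by simp
qed

lemma length_filter_nbr:
  assumes "c \<in> Om"
  shows "length (filter (\<lambda>l. fst l \<inter> e \<noteq> {}) c) = (\<Sum>f\<in>nbr e. N_e f c)"
proof -
  have "length (filter (\<lambda>l. fst l \<in> F) c) = (\<Sum>f\<in>F. N_e f c)" if "finite F" for F and c :: "'v link_conf"
  proof (induction c)
    case (Cons l c)
    have "(\<Sum>f\<in>F. N_e f (l # c)) = (\<Sum>f\<in>F. N_e f c + (if f = fst l then 1 else 0))"
      by (rule sum.cong) (simp_all add: N_e_Cons)
    then show ?case using that Cons by (simp add: sum.distrib)
  qed (simp add: N_e_def)
  from this[OF finite_nbr, of e c] have "length (filter (\<lambda>l. fst l \<in> nbr e) c) = (\<Sum>f\<in>nbr e. N_e f c)" .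
  moreover have "filter (\<lambda>l. fst l \<in> nbr e) c = filter (\<lambda>l. fst l \<inter> e \<noteq> {}) c"
  proof (rule filter_cong)
    fix l assume l: "l \<in> set c"
    have "fst l \<in> E" using OmD(1)[OF assms] l by auto
    moreover have "fst l \<noteq> e" using OmD(2)[OF assms] l unfolding N_e_0_iff by blast
    ultimately show "(fst l \<in> nbr e) = (fst l \<inter> e \<noteq> {})" by (simp add: nbr_def)
  qed simp
  ultimately show ?thesis by simp
qed

text \<open>By merging, the other edges see the two crosses on \<open>e\<close> as either one of
  them alone, so it suffices that one of the two single-cross configurations lies in
  \<open>D\<close>.\<close>

lemma double_Z1:
  assumes c: "xs @ (e, 1) # ys @ (e, 1) # zs = c" and o: "xs @ ys @ zs \<in> Om"
    and ys: "\<forall>l\<in>set ys. fst l \<inter> e = {}"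
    and D: "xs @ ys @ (e, 1) # zs \<in> D \<or> xs @ (e, 1) # ys @ zs \<in> D"
  shows "c \<in> Z1" "num_loops V c = num_loops V (xs @ ys @ zs)"
proof -
  note o' = OmD[OF o]
  have k: "blk e xs ys zs" using o'(2) ys by (auto simp: N_e_0_iff blk_def)
  have be: "blocking e c" using k e_nonempty c by (intro blockingI[where xs = xs and ys = ys]) auto
  have "blocking g c \<longleftrightarrow> b g" if "g \<in> E - {e}" for g
    using blocking_merge[OF k _ edge_nonempty e_nonempty, of g] blocking_merge'[OF k _ edge_nonempty e_nonempty, of g]
      D that c by (auto simp: D_def)
  moreover have "N_e g c \<ge> 1" if "g \<in> E" for g
    using o'(3)[OF that] by (cases "g = e") (auto simp: c[symmetric] N_e_Cons)
  moreover have "set c \<subseteq> E \<times> {-1, 1}" using o'(1) eE by (auto simp: c[symmetric])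
  ultimately show "c \<in> Z1" using be unfolding Z1_def Z_def by blast
  show "num_loops V c = num_loops V (xs @ ys @ zs)"
    using num_loops_cancel[OF edges[OF eE] ys edge_on_set[OF o'(1)]] c by simp
qed

text \<open>The second cross may precede or follow the first. The slot of the first cross itself
  counts both ways, as list positions \<open>length ws\<close> and \<open>Suc (length ws)\<close>;
  this is the additional 1.\<close>

lemma card_second_insertions:
  assumes D: "ws @ (e, 1) # us \<in> D" and o: "ws @ us \<in> Om"
  shows "card (slots (ws @ us) (length ws)) + 1 \<le>
    card {j. j \<le> Suc (length (ws @ us)) \<and> ins j (e, 1) (ws @ (e, 1) # us) \<in> Z1 \<and>
      num_loops V (ins j (e, 1) (ws @ (e, 1) # us)) = num_loops V (ws @ us)}"
    (is "_ \<le> card ?J")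
proof -
  let ?p = "length ws" and ?o = "ws @ us"
  let ?S = "slots ?o ?p"
  have J1: "j \<in> ?J" if j: "j \<in> ?S" "j \<le> ?p" for j
  proof -
    have "kcount ?o ?p = kcount ?o j + length (filter (\<lambda>l. fst l \<inter> e \<noteq> {}) (drop j ws))"
      using j(2) append_take_drop_id[of j ws] unfolding kcount_def
      by (metis (no_types, lifting) append_eq_conv_conj filter_append length_append take_append diff_is_0_eq take0 append_Nil2)
    then have d: "\<forall>l\<in>set (drop j ws). fst l \<inter> e = {}"
      using j(1) by (auto simp: slots_def filter_empty_conv)
    have ins: "ins j (e, 1) (ws @ (e, 1) # us) = take j ws @ (e, 1) # drop j ws @ (e, 1) # us"
      using j(2) by (simp add: ins_def)
    have td: "take j ws @ drop j ws @ r = ws @ r" for r by (simp flip: append_assoc)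
    have "take j ws @ drop j ws @ us \<in> Om" "take j ws @ drop j ws @ (e, 1) # us \<in> D"
      unfolding td by (fact o, fact D)
    with ins have "ins j (e, 1) (ws @ (e, 1) # us) \<in> Z1"
      "num_loops V (ins j (e, 1) (ws @ (e, 1) # us)) = num_loops V (take j ws @ drop j ws @ us)"
      using double_Z1[OF refl _ d, of "take j ws" us] by metis+
    then show ?thesis using j(2) unfolding td by simp
  qed
  have J2: "Suc j \<in> ?J" if j: "j \<in> ?S" "?p \<le> j" for j
  proof -
    have jl: "j - ?p \<le> length us" using j by (auto simp: slots_def)
    have "kcount ?o j = kcount ?o ?p + length (filter (\<lambda>l. fst l \<inter> e \<noteq> {}) (take (j - ?p) us))"
      using j(2) unfolding kcount_def by simp
    then have d: "\<forall>l\<in>set (take (j - ?p) us). fst l \<inter> e = {}"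
      using j(1) by (auto simp: slots_def filter_empty_conv)
    have "ins (Suc j) (e, 1) (ws @ (e, 1) # us) = ws @ (e, 1) # take (j - ?p) us @ (e, 1) # drop (j - ?p) us"
      using j(2) by (simp add: ins_def Suc_diff_le)
    then show ?thesis
      using double_Z1[OF refl _ d, of ws "drop (j - ?p) us"] D o jl j(2) by simp
  qed
  let ?A = "{j \<in> ?S. j \<le> ?p}" and ?B = "{j \<in> ?S. ?p \<le> j}"
  have pS: "?p \<in> ?S" by (simp add: slots_def)
  have S: "?S = ?A \<union> (?B - {?p})" using pS by auto
  have "card ?S = card (?A \<union> (?B - {?p}))" using arg_cong[OF S, of card] .
  also have "\<dots> = card ?A + card (?B - {?p})" by (rule card_Un_disjoint) auto
  also have "card (?B - {?p}) = card ?B - 1" using pS by (simp add: card_Diff_singleton)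
  finally have "card ?S + 1 = card ?A + card ?B"
    using pS card_gt_0_iff[of ?B] by auto
  also have "card ?B = card (Suc ` ?B)" by (simp add: card_image)
  also have "card ?A + card (Suc ` ?B) = card (?A \<union> Suc ` ?B)"
    by (rule card_Un_disjoint[symmetric]) auto
  also have "\<dots> \<le> card ?J"
  proof (rule card_mono)
    show "finite ?J" by simp
    show "?A \<union> Suc ` ?B \<subseteq> ?J" using J1 J2 by blast
  qed
  finally show ?thesis .
qed

end

section \<open>Sums over configurations\<close>

text \<open>Values in \<open>ennreal\<close> let infinite sums be compared before any summability is
  known; negative terms would count as 0.\<close>

definition nsum :: "('a \<Rightarrow> real) \<Rightarrow> 'a set \<Rightarrow> ennreal" where
  "nsum f A = (\<integral>\<^sup>+x. ennreal (f x) \<partial>count_space A)"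

lemma nsum_mono: "(\<And>x. x \<in> A \<Longrightarrow> f x \<le> g x) \<Longrightarrow> nsum f A \<le> nsum g A"
  unfolding nsum_def by (intro nn_integral_mono ennreal_leI) simp

lemma nsum_cong: "(\<And>x. x \<in> A \<Longrightarrow> f x = g x) \<Longrightarrow> nsum f A = nsum g A"
  unfolding nsum_def by (intro nn_integral_cong) simp

lemma nsum_cmult: "0 \<le> k \<Longrightarrow> nsum (\<lambda>x. k * f x) A = ennreal k * nsum f A"
  unfolding nsum_def by (subst nn_integral_cmult[symmetric]) (auto simp: ennreal_mult')

lemma nsum_add:
  assumes "\<And>x. x \<in> A \<Longrightarrow> 0 \<le> f x" "\<And>x. x \<in> A \<Longrightarrow> 0 \<le> g x"
  shows "nsum (\<lambda>x. f x + g x) A = nsum f A + nsum g A"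
proof -
  have "nsum (\<lambda>x. f x + g x) A = (\<integral>\<^sup>+x. ennreal (f x) + ennreal (g x) \<partial>count_space A)"
    unfolding nsum_def using assms by (intro nn_integral_cong) simp
  then show ?thesis by (simp add: nsum_def nn_integral_add)
qed

lemma nsum_indicator: "nsum f A = (\<integral>\<^sup>+x. ennreal (f x) * indicator A x \<partial>count_space UNIV)"
proof (cases "A = UNIV")
  case False
  then show ?thesis
    unfolding nsum_def by (subst nn_integral_restrict_space[symmetric]) (simp_all add: restrict_count_space)
qed (simp add: nsum_def)

lemma nsum_subset: "A \<subseteq> B \<Longrightarrow> nsum f A \<le> nsum f B"
  unfolding nsum_indicator by (intro nn_integral_mono) (auto simp: indicator_def)

lemma nsum_Un_le: "nsum f (A \<union> B) \<le> nsum f A + nsum f B"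
  unfolding nsum_indicator
  by (subst nn_integral_add[symmetric]) (auto intro!: nn_integral_mono simp: indicator_def)

lemma nsum_UN_le: "finite I \<Longrightarrow> nsum f (\<Union>i\<in>I. A i) \<le> (\<Sum>i\<in>I. nsum f (A i))"
proof (induction I rule: finite_induct)
  case (insert i I)
  then show ?case
    using nsum_Un_le[of f "A i" "\<Union>i\<in>I. A i"] by (simp add: add_left_mono order_trans)
qed (simp add: nsum_indicator)

lemma nsum_UN_nat_le: "nsum f (\<Union>k::nat. A k) \<le> (\<Sum>k. nsum f (A k))"
proof -
  have "nsum f (\<Union>k. A k) \<le> (\<integral>\<^sup>+x. (\<Sum>k. ennreal (f x) * indicator (A k) x) \<partial>count_space UNIV)"
    unfolding nsum_indicator
  proof (rule nn_integral_mono)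
    fix x :: 'a
    show "ennreal (f x) * indicator (\<Union>k. A k) x \<le> (\<Sum>k. ennreal (f x) * indicator (A k) x)"
    proof (cases "x \<in> (\<Union>k. A k)")
      case True
      then obtain k where k: "x \<in> A k" by blast
      define F where "F k = ennreal (f x) * indicator (A k) x" for k
      have "(\<Sum>k\<in>{k}. F k) \<le> (\<Sum>k. F k)" by (rule sum_le_suminf) auto
      then have "F k \<le> (\<Sum>k. F k)" by simp
      then have "ennreal (f x) * indicator (A k) x \<le> (\<Sum>k. ennreal (f x) * indicator (A k) x)"
        unfolding F_def .
      then show ?thesis using k True by simp
    qed simp
  qed
  also have "\<dots> = (\<Sum>k. nsum f (A k))"
    unfolding nsum_indicator by (rule nn_integral_suminf) simp
  finally show ?thesis .
qed

lemma nsum_inj: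
  assumes "inj_on h A" "h ` A \<subseteq> B" "\<And>x. x \<in> A \<Longrightarrow> f x \<le> g (h x)"
  shows "nsum f A \<le> nsum g B"
proof -
  have "nsum f A \<le> nsum (\<lambda>x. g (h x)) A" using assms(3) by (rule nsum_mono)
  also have "\<dots> = nsum g (h ` A)"
    unfolding nsum_def using assms(1) by (intro nn_integral_bij_count_space) (simp add: bij_betw_def)
  also have "\<dots> \<le> nsum g B" using assms(2) by (rule nsum_subset)
  finally show ?thesis .
qed

lemma nsum_finite: "finite A \<Longrightarrow> (\<And>x. x \<in> A \<Longrightarrow> 0 \<le> f x) \<Longrightarrow> nsum f A = ennreal (sum f A)"
  by (simp add: nsum_def nn_integral_count_space_finite sum_ennreal)

lemma nsum_Sigma:
  assumes "\<And>c. c \<in> A \<Longrightarrow> finite (I c)" "\<And>c i. c \<in> A \<Longrightarrow> i \<in> I c \<Longrightarrow> 0 \<le> f c i"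
  shows "nsum (\<lambda>(c, i). f c i) (Sigma A I) = nsum (\<lambda>c. \<Sum>i\<in>I c. f c i) A"
proof -
  have "nsum (\<lambda>(c, i). f c i) (Sigma A I)
      = (\<integral>\<^sup>+p. (case p of (c, i) \<Rightarrow> ennreal (f c i) * indicator A c * indicator (I c) i) \<partial>count_space UNIV)"
    unfolding nsum_indicator by (intro nn_integral_cong) (auto simp: indicator_def)
  also have "\<dots> = (\<integral>\<^sup>+c. \<integral>\<^sup>+i. ennreal (f c i) * indicator A c * indicator (I c) i \<partial>count_space UNIV \<partial>count_space UNIV)"
    by (subst nn_integral_fst_count_space[symmetric]) simp
  also have "\<dots> = (\<integral>\<^sup>+c. ennreal (\<Sum>i\<in>I c. f c i) * indicator A c \<partial>count_space UNIV)"
  proof (rule nn_integral_cong)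
    fix c :: 'a
    show "(\<integral>\<^sup>+i. ennreal (f c i) * indicator A c * indicator (I c) i \<partial>count_space UNIV)
        = ennreal (\<Sum>i\<in>I c. f c i) * indicator A c"
    proof (cases "c \<in> A")
      case True
      then show ?thesis
        using assms nsum_finite[of "I c" "f c"] by (simp add: nsum_indicator)
    qed simp
  qed
  also have "\<dots> = nsum (\<lambda>c. \<Sum>i\<in>I c. f c i) A" by (simp add: nsum_indicator)
  finally show ?thesis .
qed

lemma ins_del: "i < length c \<Longrightarrow> ins i (c ! i) (del i c) = c"
  by (simp add: ins_def del_def id_take_nth_drop[symmetric])

lemma del_ins: "i \<le> length c \<Longrightarrow> del i (ins i l c) = c"
  by (simp add: ins_def del_def)

lemma nth_ins: "i \<le> length c \<Longrightarrow> ins i l c ! i = l"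
  by (simp add: ins_def nth_append)

lemma length_ins [simp]: "length (ins i l c) = Suc (length c)"
  by (simp add: ins_def)

text \<open>A configuration with a marked link is recovered from the remaining list, the position
  and the link, so marking and deleting is injective.\<close>

lemma nsum_delete:
  fixes f :: "'a list \<Rightarrow> nat \<Rightarrow> real"
  assumes L: "finite L"
    and I: "\<And>c i. c \<in> A \<Longrightarrow> i \<in> I c \<Longrightarrow> i < length c \<and> c ! i \<in> L \<and> del i c \<in> B \<and> f c i \<le> g (del i c) i (c ! i)"
    and f: "\<And>c i. c \<in> A \<Longrightarrow> i \<in> I c \<Longrightarrow> 0 \<le> f c i"
    and g: "\<And>c i l. c \<in> B \<Longrightarrow> l \<in> L \<Longrightarrow> 0 \<le> g c i l"
  shows "nsum (\<lambda>c. \<Sum>i\<in>I c. f c i) A \<le> nsum (\<lambda>c. \<Sum>i\<le>length c. \<Sum>l\<in>L. g c i l) B"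
proof -
  let ?h = "\<lambda>(c, i). (del i c, i, c ! i)"
  have fin: "finite (I c)" if "c \<in> A" for c
    using I[OF that] by (intro finite_subset[of "I c" "{..<length c}"]) auto
  have "nsum (\<lambda>c. \<Sum>i\<in>I c. f c i) A = nsum (\<lambda>(c, i). f c i) (Sigma A I)"
    using fin f by (rule nsum_Sigma[symmetric])
  also have "\<dots> \<le> nsum (\<lambda>(c, i, l). g c i l) (SIGMA c:B. {..length c} \<times> L)"
  proof (rule nsum_inj[where h = ?h])
    show "inj_on ?h (Sigma A I)"
    proof (rule inj_onI)
      fix p q assume p: "p \<in> Sigma A I" and q: "q \<in> Sigma A I" and "?h p = ?h q"
      then have eq: "del (snd p) (fst p) = del (snd q) (fst q)" "snd p = snd q" "fst p ! snd p = fst q ! snd q"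
        unfolding split_beta prod.inject by blast+
      have "fst p = ins (snd p) (fst p ! snd p) (del (snd p) (fst p))"
        using I[of "fst p" "snd p"] p by (subst ins_del) auto
      also have "\<dots> = ins (snd q) (fst q ! snd q) (del (snd q) (fst q))" using eq by metis
      also have "\<dots> = fst q"
        using I[of "fst q" "snd q"] q by (subst ins_del) auto
      finally show "p = q" using eq(2) by (rule prod_eqI)
    qed
    show "?h ` Sigma A I \<subseteq> (SIGMA c:B. {..length c} \<times> L)"
      using I length_del by (fastforce simp: less_Suc_eq_le)
    show "(case p of (c, i) \<Rightarrow> f c i) \<le> (case ?h p of (c, i, l) \<Rightarrow> g c i l)" if "p \<in> Sigma A I" for p
      using that I by auto
  qed
  also have "nsum (\<lambda>(c, p). case p of (i, l) \<Rightarrow> g c i l) (SIGMA c:B. {..length c} \<times> L)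
      = nsum (\<lambda>c. \<Sum>p\<in>{..length c} \<times> L. case p of (i, l) \<Rightarrow> g c i l) B"
    using L g by (intro nsum_Sigma) auto
  also have "\<dots> = nsum (\<lambda>c. \<Sum>i\<le>length c. \<Sum>l\<in>L. g c i l) B"
    by (simp add: sum.cartesian_product)
  finally show ?thesis .
qed

lemma nsum_insert:
  fixes f g :: "'a list \<Rightarrow> nat \<Rightarrow> real"
  assumes J: "\<And>c i. c \<in> A \<Longrightarrow> i \<in> J c \<Longrightarrow> i \<le> length c \<and> ins i l c \<in> B \<and> i \<in> I (ins i l c) \<and> f c i \<le> g (ins i l c) i"
    and f: "\<And>c i. c \<in> A \<Longrightarrow> i \<in> J c \<Longrightarrow> 0 \<le> f c i"
    and I: "\<And>c. c \<in> B \<Longrightarrow> finite (I c)"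
    and g: "\<And>c i. c \<in> B \<Longrightarrow> i \<in> I c \<Longrightarrow> 0 \<le> g c i"
  shows "nsum (\<lambda>c. \<Sum>i\<in>J c. f c i) A \<le> nsum (\<lambda>c. \<Sum>i\<in>I c. g c i) B"
proof -
  let ?h = "\<lambda>(c, i). (ins i l c, i)"
  have fin: "finite (J c)" if "c \<in> A" for c
    using J[OF that] by (intro finite_subset[of "J c" "{..length c}"]) auto
  have "nsum (\<lambda>c. \<Sum>i\<in>J c. f c i) A = nsum (\<lambda>(c, i). f c i) (Sigma A J)"
    using fin f by (rule nsum_Sigma[symmetric])
  also have "\<dots> \<le> nsum (\<lambda>(c, i). g c i) (Sigma B I)"
  proof (rule nsum_inj[where h = ?h])
    show "inj_on ?h (Sigma A J)"
    proof (rule inj_onI)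
      fix p q assume p: "p \<in> Sigma A J" and q: "q \<in> Sigma A J" and "?h p = ?h q"
      then have eq: "ins (snd p) l (fst p) = ins (snd q) l (fst q)" "snd p = snd q"
        unfolding split_beta prod.inject by blast+
      have "fst p = del (snd p) (ins (snd p) l (fst p))"
        using J[of "fst p" "snd p"] p by (subst del_ins) auto
      also have "\<dots> = del (snd q) (ins (snd q) l (fst q))" using eq by metis
      also have "\<dots> = fst q"
        using J[of "fst q" "snd q"] q by (subst del_ins) auto
      finally show "p = q" using eq(2) by (rule prod_eqI)
    qed
    show "?h ` Sigma A J \<subseteq> Sigma B I"
      using J by auto
    show "(case p of (c, i) \<Rightarrow> f c i) \<le> (case ?h p of (c, i) \<Rightarrow> g c i)" if "p \<in> Sigma A J" for p
      using that J by auto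
  qed
  also have "\<dots> = nsum (\<lambda>c. \<Sum>i\<in>I c. g c i) B"
    using I g by (rule nsum_Sigma)
  finally show ?thesis .
qed

lemma ennreal_cancel:
  assumes "0 < k" "0 \<le> y" "ennreal k * a \<le> ennreal y * b"
  shows "a \<le> ennreal (y / k) * b"
proof -
  have "a = ennreal (1 / k) * (ennreal k * a)"
    using assms(1) by (simp add: mult.assoc[symmetric] ennreal_mult'[symmetric])
  also have "\<dots> \<le> ennreal (1 / k) * (ennreal y * b)"
    using assms(3) by (rule mult_left_mono) simp
  also have "\<dots> = ennreal (y / k) * b"
    using assms(1,2) by (simp add: mult.assoc[symmetric] ennreal_mult'[symmetric])
  finally show ?thesis .
qed

lemma ennreal_mult_assoc: "0 \<le> a \<Longrightarrow> 0 \<le> b \<Longrightarrow> ennreal a * (ennreal b * c) = ennreal (a * b) * c"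
  by (simp add: ennreal_mult mult.assoc)

lemma suminf_exp_series:
  assumes "0 \<le> x"
  shows "(\<Sum>k. ennreal (x ^ k / fact k)) = ennreal (exp x)"
    and "(\<Sum>k. ennreal (x ^ Suc k / fact (Suc k))) = ennreal (exp x - 1)"
proof -
  have s: "(\<lambda>k. x ^ k / fact k) sums exp x"
    using exp_converges[of x] by (simp add: divide_inverse mult.commute)
  then have s': "(\<lambda>k. x ^ Suc k / fact (Suc k)) sums (exp x - 1)"
    by (subst sums_Suc_iff) simp
  show "(\<Sum>k. ennreal (x ^ k / fact k)) = ennreal (exp x)"
    by (rule suminf_ennreal_eq[OF _ s]) (use assms in simp)
  show "(\<Sum>k. ennreal (x ^ Suc k / fact (Suc k))) = ennreal (exp x - 1)"
    by (rule suminf_ennreal_eq[OF _ s']) (use assms in simp)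
qed

section \<open>Loop weights and the cost of deleting links\<close>

locale weighted_edges = loop_edges V E K for V :: "'v set" and E K +
  fixes \<beta> u \<theta> :: real
  assumes \<beta>: "0 < \<beta>" and \<theta>: "0 < \<theta>" and u: "0 < u" "u \<le> 1"
begin

definition th :: real where "th = max \<theta> (1 / \<theta>)"

definition wt :: "'v link_conf \<Rightarrow> real" where
  "wt c = \<beta> ^ length c / fact (length c) * u ^ n_cross c * (1 - u) ^ n_dbar c * \<theta> ^ num_loops V c"

definition sgw :: "'v set \<times> int \<Rightarrow> real" where
  "sgw l = (if snd l = 1 then u else 1 - u)"

lemma th_ge_1: "1 \<le> th"
  unfolding th_def using \<theta> by (cases "\<theta> \<le> 1") (auto simp: le_max_iff_disj divide_simps)

lemma th_pos: "0 < th" using th_ge_1 by linarith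

lemma x_pos: "0 < \<beta> * th"
  using \<beta> th_pos by simp

lemma wt_nonneg: "0 \<le> wt c"
  unfolding wt_def using \<beta> \<theta> u by (intro mult_nonneg_nonneg divide_nonneg_nonneg zero_le_power) auto

lemma sgw_nonneg: "0 \<le> sgw l"
  using u by (simp add: sgw_def)

lemma \<theta>_power_le:
  assumes "a \<le> Suc b" "b \<le> Suc a"
  shows "\<theta> ^ a \<le> th * \<theta> ^ b"
proof -
  have t: "\<theta> \<le> th" "1 \<le> th * \<theta>"
    using \<theta> by (auto simp: th_def max_def field_simps)
  consider "a = b" | "a = Suc b" | "b = Suc a" using assms by linarith
  then show ?thesis
  proof cases
    case 1
    then show ?thesis using th_ge_1 \<theta> by simp
  next
    case 2
    then show ?thesis using t \<theta> by simp
  next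
    case 3
    have "1 * \<theta> ^ a \<le> (th * \<theta>) * \<theta> ^ a" using t \<theta> by (intro mult_right_mono) auto
    then show ?thesis using 3 by (simp add: mult.assoc)
  qed
qed

lemma power_signs:
  assumes "snd l \<in> {-1, 1}"
  shows "u ^ n_cross (xs @ l # ys) * (1 - u) ^ n_dbar (xs @ l # ys)
    = u ^ n_cross (xs @ ys) * (1 - u) ^ n_dbar (xs @ ys) * sgw l"
  using assms by (auto simp: n_cross_def n_dbar_def sgw_def)

lemma power_fact_Suc: "\<beta> ^ Suc n / fact (Suc n) = \<beta> ^ n / fact n * (\<beta> / real (Suc n))"
  by (simp add: field_simps)

lemma wt_insert:
  assumes "set (xs @ l # ys) \<subseteq> E \<times> {-1, 1}"
  shows "wt (xs @ l # ys) \<le> wt (xs @ ys) * (\<beta> * th / real (Suc (length (xs @ ys))) * sgw l)"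
proof -
  let ?n = "length (xs @ ys)"
  let ?q = "\<beta> ^ ?n / fact ?n * (\<beta> / real (Suc ?n)) * (u ^ n_cross (xs @ ys) * (1 - u) ^ n_dbar (xs @ ys) * sgw l)"
  have l: "snd l \<in> {-1, 1}" using assms by auto
  have ed: "\<forall>k\<in>set (xs @ l # ys). edge_on V (fst k)" using assms edges by fastforce
  have len: "length (xs @ l # ys) = Suc ?n" by simp
  have "wt (xs @ l # ys) = \<beta> ^ Suc ?n / fact (Suc ?n)
      * (u ^ n_cross (xs @ l # ys) * (1 - u) ^ n_dbar (xs @ l # ys)) * \<theta> ^ num_loops V (xs @ l # ys)"
    unfolding wt_def len by (simp only: mult.assoc)
  also have "\<dots> = ?q * \<theta> ^ num_loops V (xs @ l # ys)"
    unfolding power_signs[OF l] power_fact_Suc ..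
  also have "\<dots> \<le> ?q * (th * \<theta> ^ num_loops V (xs @ ys))"
    using num_loops_insert[OF finV ed] \<beta> u sgw_nonneg
    by (intro mult_left_mono \<theta>_power_le mult_nonneg_nonneg) auto
  also have "\<dots> = wt (xs @ ys) * (\<beta> * th / real (Suc ?n) * sgw l)"
    by (simp add: wt_def)
  finally show ?thesis .
qed

lemma wt_del:
  assumes "i < length c" "set c \<subseteq> E \<times> {-1, 1}"
  shows "wt c \<le> wt (del i c) * (\<beta> * th / real (Suc (length (del i c))) * sgw (c ! i))"
proof -
  have c: "c = take i c @ c ! i # drop (Suc i) c" using assms(1) by (rule nth_split)
  have "set (take i c @ c ! i # drop (Suc i) c) \<subseteq> E \<times> {-1, 1}" using assms(2) c by simp
  from wt_insert[OF this] show ?thesis by (simp only: c[symmetric] del_def)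
qed

text \<open>The \<open>n + 1\<close> positions for a new link cancel the denominator left by the
  factorial, and the sign weights \<open>u\<close> and \<open>1 - u\<close> add up to 1.\<close>

lemma sum_slots_signs:
  assumes "finite F"
  shows "(\<Sum>i\<le>n. \<Sum>l\<in>F \<times> {-1, 1}. w * (\<beta> * th / real (Suc n) * sgw l)) = real (card F) * (\<beta> * th) * w"
proof -
  have "(\<Sum>l\<in>F \<times> {-1, 1}. sgw l) = (\<Sum>f\<in>F. \<Sum>s\<in>{-1, 1}. sgw (f, s))"
    by (simp only: sum.cartesian_product) (simp add: split_beta)
  also have "\<dots> = real (card F)" by (simp add: sgw_def)
  finally have s: "(\<Sum>l\<in>F \<times> {-1, 1}. w * (\<beta> * th / real (Suc n) * sgw l)) = w * (\<beta> * th / real (Suc n)) * real (card F)"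
    by (simp only: sum_distrib_left[symmetric] mult.assoc[symmetric])
  show ?thesis unfolding s by (simp add: field_simps)
qed

text \<open>Double counting of pairs of a configuration and a deletable link: the weight is charged
  to the configuration after the deletion, which costs \<open>\<beta> * th\<close> per edge of
  \<open>F\<close>.\<close>

lemma nsum_wt_delete:
  assumes "F \<subseteq> E" and A: "\<And>c. c \<in> A \<Longrightarrow> set c \<subseteq> E \<times> {-1, 1}"
    and I: "\<And>c i. c \<in> A \<Longrightarrow> i \<in> I c \<Longrightarrow> i < length c \<and> fst (c ! i) \<in> F \<and> del i c \<in> B"
  shows "nsum (\<lambda>c. real (card (I c)) * wt c) A \<le> ennreal (real (card F) * (\<beta> * th)) * nsum wt B"
proof -
  have finF: "finite F" using assms(1) finE finite_subset by blast
  have "nsum (\<lambda>c. real (card (I c)) * wt c) A = nsum (\<lambda>c. \<Sum>i\<in>I c. wt c) A" by simp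
  also have "\<dots> \<le> nsum (\<lambda>c. \<Sum>i\<le>length c. \<Sum>l\<in>F \<times> {-1, 1}. wt c * (\<beta> * th / real (Suc (length c)) * sgw l)) B"
  proof (rule nsum_delete)
    show "finite (F \<times> {-1, 1::int})" using finF by simp
    show "0 \<le> wt c * (\<beta> * th / real (Suc (length c)) * sgw l)" for c l
      using less_imp_le[OF x_pos] by (intro mult_nonneg_nonneg[OF wt_nonneg] mult_nonneg_nonneg[OF _ sgw_nonneg] divide_nonneg_nonneg) simp_all
    show "i < length c \<and> c ! i \<in> F \<times> {-1, 1} \<and> del i c \<in> B
        \<and> wt c \<le> wt (del i c) * (\<beta> * th / real (Suc (length (del i c))) * sgw (c ! i))"
      if "c \<in> A" "i \<in> I c" for c i
    proof -
      have i: "i < length c" "fst (c ! i) \<in> F" "del i c \<in> B" using I[OF that] by auto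
      have "c ! i \<in> E \<times> {-1, 1}" using A[OF that(1)] i(1) nth_mem by blast
      then have "c ! i \<in> F \<times> {-1, 1}" using i(2) by (cases "c ! i") auto
      then show ?thesis using i wt_del[OF i(1) A[OF that(1)]] by blast
    qed
  qed (rule wt_nonneg)
  also have "\<dots> = nsum (\<lambda>c. real (card F) * (\<beta> * th) * wt c) B"
    by (simp only: sum_slots_signs[OF finF])
  also have "\<dots> = ennreal (real (card F) * (\<beta> * th)) * nsum wt B"
    using x_pos by (intro nsum_cmult) simp
  finally show ?thesis .
qed

text \<open>Iterated deletion. With \<open>k\<close> links left to delete there are at least
  \<open>k\<close> choices, and these choices multiply up to the factorial, as for Poisson numbers
  of links.\<close>

lemma nsum_family:
  fixes A :: "nat \<Rightarrow> 'v link_conf set"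
  assumes F: "F \<subseteq> E" and A: "\<And>k c. c \<in> A k \<Longrightarrow> set c \<subseteq> E \<times> {-1, 1}"
    and I: "\<And>k c. c \<in> A (Suc k) \<Longrightarrow> Suc k \<le> card {i. i < length c \<and> fst (c ! i) \<in> F \<and> del i c \<in> A k}"
  shows "nsum wt (A k) \<le> ennreal ((real (card F) * (\<beta> * th)) ^ k / fact k) * nsum wt (A 0)"
proof (induction k)
  case (Suc k)
  let ?y = "real (card F) * (\<beta> * th)"
  have y: "0 \<le> ?y" using x_pos by simp
  have "ennreal (real (Suc k)) * nsum wt (A (Suc k)) = nsum (\<lambda>c. real (Suc k) * wt c) (A (Suc k))"
    by (rule nsum_cmult[symmetric]) simp
  also have "\<dots> \<le> nsum (\<lambda>c. real (card {i. i < length c \<and> fst (c ! i) \<in> F \<and> del i c \<in> A k}) * wt c) (A (Suc k))"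
    using I by (intro nsum_mono mult_right_mono of_nat_mono wt_nonneg)
  also have "\<dots> \<le> ennreal ?y * nsum wt (A k)"
    using A by (intro nsum_wt_delete F) auto
  finally have "nsum wt (A (Suc k)) \<le> ennreal (?y / real (Suc k)) * nsum wt (A k)"
    using y by (intro ennreal_cancel) auto
  also have "\<dots> \<le> ennreal (?y / real (Suc k)) * (ennreal (?y ^ k / fact k) * nsum wt (A 0))"
    by (intro mult_left_mono Suc.IH) simp
  also have "\<dots> = ennreal (?y ^ Suc k / fact (Suc k)) * nsum wt (A 0)"
    using y by (simp add: mult.assoc[symmetric] ennreal_mult'[symmetric])
  finally show ?case .
qed simp

lemma nsum_wt_finite: "nsum wt {c. set c \<subseteq> E \<times> {-1, 1}} < \<top>"
proof -
  define A :: "nat \<Rightarrow> 'v link_conf set" where "A k = {c. set c \<subseteq> E \<times> {-1, 1} \<and> length c = k}" for k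
  let ?y = "real (card E) * (\<beta> * th)"
  have y: "0 \<le> ?y" using x_pos by simp
  have I: "Suc k \<le> card {i. i < length c \<and> fst (c ! i) \<in> E \<and> del i c \<in> A k}" if "c \<in> A (Suc k)" for k c
  proof -
    have c: "set c \<subseteq> E \<times> {-1, 1}" "length c = Suc k" using that by (auto simp: A_def)
    have "i \<in> {i. i < length c \<and> fst (c ! i) \<in> E \<and> del i c \<in> A k}" if "i < length c" for i
    proof -
      have "c ! i \<in> E \<times> {-1, 1}" using c(1) nth_mem[OF that] by blast
      then show ?thesis using that c set_del[of i c] length_del[OF that] by (auto simp: A_def)
    qed
    then have "{i. i < length c \<and> fst (c ! i) \<in> E \<and> del i c \<in> A k} = {..<length c}" by auto
    then show ?thesis using c(2) by simp
  qed
  have "{c. set c \<subseteq> E \<times> {-1, 1}} \<subseteq> (\<Union>k. A k)" by (auto simp: A_def)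
  then have "nsum wt {c. set c \<subseteq> E \<times> {-1, 1}} \<le> (\<Sum>k. nsum wt (A k))"
    using nsum_subset nsum_UN_nat_le order_trans by blast
  also have "\<dots> \<le> (\<Sum>k. ennreal (?y ^ k / fact k) * nsum wt (A 0))"
  proof (intro suminf_le allI)
    show "nsum wt (A k) \<le> ennreal (?y ^ k / fact k) * nsum wt (A 0)" for k
      by (rule nsum_family[where F = E]) (use I in \<open>auto simp: A_def\<close>)
  qed simp_all
  also have "\<dots> = ennreal (exp ?y) * nsum wt (A 0)"
    using suminf_exp_series(1)[OF y] by (simp add: ennreal_suminf_multc)
  also have "A 0 = {[]}" by (auto simp: A_def)
  also have "ennreal (exp ?y) * nsum wt {[]} < \<top>"
    using wt_nonneg by (simp add: nsum_finite ennreal_mult_less_top)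
  finally show ?thesis .
qed

end

section \<open>Upper bounds in terms of the reference configurations\<close>

locale weighted_marked = weighted_edges V E K \<beta> u \<theta> + marked_edge V E K e b
  for V :: "'v set" and E K \<beta> u \<theta> e b
begin

text \<open>The configurations are sorted by their number of links on \<open>e\<close>. It is at
  least 1, so the exponential series lacks its term of order 0.\<close>

lemma nsum_Z_Rel: "nsum wt Z \<le> ennreal (exp (\<beta> * th) - 1) * nsum wt (Rel (nbr e))"
proof -
  define A where "A k = {c. set c \<subseteq> E \<times> {-1, 1} \<and> N_e e c = k \<and> rmv e c \<in> Rel (nbr e)}" for k
  let ?x = "\<beta> * th"
  have I: "Suc k \<le> card {i. i < length c \<and> fst (c ! i) \<in> {e} \<and> del i c \<in> A k}" if "c \<in> A (Suc k)" for k c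
  proof -
    have c: "set c \<subseteq> E \<times> {-1, 1}" "N_e e c = Suc k" "rmv e c \<in> Rel (nbr e)" using that by (auto simp: A_def)
    have "del i c \<in> A k" if "i < length c" "fst (c ! i) = e" for i
      using that c set_del[of i c] N_e_del[OF that(1), of e] rmv_del[OF that] by (auto simp: A_def)
    then have "{i. i < length c \<and> fst (c ! i) \<in> {e} \<and> del i c \<in> A k} = {i. i < length c \<and> fst (c ! i) = e}" by auto
    then show ?thesis using c(2) by (simp add: N_e_card)
  qed
  have "c \<in> (\<Union>k. A (Suc k))" if "c \<in> Z" for c
  proof -
    have "N_e e c \<ge> 1" "set c \<subseteq> E \<times> {-1, 1}" using that eE by (auto simp: Z_def)
    then have "c \<in> A (Suc (N_e e c - 1))" using Z_rmv[OF that] by (simp add: A_def)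
    then show ?thesis by blast
  qed
  then have "Z \<subseteq> (\<Union>k. A (Suc k))" by blast
  then have "nsum wt Z \<le> (\<Sum>k. nsum wt (A (Suc k)))"
    using nsum_subset nsum_UN_nat_le[of wt "\<lambda>k. A (Suc k)"] order_trans by blast
  also have "\<dots> \<le> (\<Sum>k. ennreal (?x ^ Suc k / fact (Suc k)) * nsum wt (A 0))"
  proof (intro suminf_le allI)
    have "nsum wt (A (Suc k)) \<le> ennreal ((real (card {e}) * ?x) ^ Suc k / fact (Suc k)) * nsum wt (A 0)" for k
      by (rule nsum_family[where F = "{e}"]) (use I eE in \<open>auto simp: A_def\<close>)
    then show "nsum wt (A (Suc k)) \<le> ennreal (?x ^ Suc k / fact (Suc k)) * nsum wt (A 0)" for k by simp
  qed simp_all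
  also have "\<dots> = ennreal (exp ?x - 1) * nsum wt (A 0)"
    using suminf_exp_series(2)[of ?x] x_pos by (simp only: ennreal_suminf_multc less_imp_le)
  also have "A 0 \<subseteq> Rel (nbr e)" using rmv_id by (auto simp: A_def)
  then have "nsum wt (A 0) \<le> nsum wt (Rel (nbr e))" by (rule nsum_subset)
  then have "ennreal (exp ?x - 1) * nsum wt (A 0) \<le> ennreal (exp ?x - 1) * nsum wt (Rel (nbr e))"
    by (rule mult_left_mono) simp
  finally show ?thesis .
qed

lemma nsum_Rel_Om:
  assumes "finite G" "G \<subseteq> nbr e"
  shows "nsum wt (Rel G) \<le> ennreal ((1 + \<beta> * th) ^ card G) * nsum wt Om"
  using assms
proof (induction G rule: finite_induct)
  case empty
  then show ?case by (simp add: Rel_empty)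
next
  case (insert f G)
  let ?A = "Rel (insert f G) - Rel G"
  have fE: "{f} \<subseteq> E" using insert.prems by (auto simp: nbr_def)
  \<comment> \<open>A singleton of one chosen link, so that \<open>nsum_wt_delete\<close> applies
    with multiplicity 1: the exceptional configurations cost one deletion on the single edge
    \<open>f\<close>.\<close>
  define I where "I c = {SOME i. i < length c \<and> c ! i = (f, 1) \<and> del i c \<in> Rel G}" for c
  have I: "i < length c \<and> fst (c ! i) \<in> {f} \<and> del i c \<in> Rel G" if "c \<in> ?A" "i \<in> I c" for c i
  proof -
    have "\<exists>i. i < length c \<and> c ! i = (f, 1) \<and> del i c \<in> Rel G"
      using Rel_insert[of c f G] that(1) insert.prems insert.hyps by auto
    from someI_ex[OF this] show ?thesis using that(2) by (simp add: I_def)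
  qed
  have "nsum wt ?A = nsum (\<lambda>c. real (card (I c)) * wt c) ?A" by (simp add: I_def)
  also have "\<dots> \<le> ennreal (real (card {f}) * (\<beta> * th)) * nsum wt (Rel G)"
    by (intro nsum_wt_delete fE) (use I in \<open>auto simp: Rel_def\<close>)
  finally have A: "nsum wt ?A \<le> ennreal (\<beta> * th) * nsum wt (Rel G)" by simp
  have "Rel (insert f G) \<subseteq> Rel G \<union> ?A" by blast
  then have "nsum wt (Rel (insert f G)) \<le> nsum wt (Rel G \<union> ?A)" by (rule nsum_subset)
  also have "\<dots> \<le> nsum wt (Rel G) + nsum wt ?A" by (rule nsum_Un_le)
  also have "\<dots> \<le> nsum wt (Rel G) + ennreal (\<beta> * th) * nsum wt (Rel G)" using A by (rule add_left_mono)
  also have "\<dots> = ennreal (1 + \<beta> * th) * nsum wt (Rel G)"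
    using x_pos by (simp add: ennreal_plus distrib_right del: ennreal_plus[symmetric])
  also have "\<dots> \<le> ennreal (1 + \<beta> * th) * (ennreal ((1 + \<beta> * th) ^ card G) * nsum wt Om)"
    using insert by (intro mult_left_mono) auto
  also have "\<dots> = ennreal ((1 + \<beta> * th) ^ card (insert f G)) * nsum wt Om"
    using insert.hyps x_pos by (subst ennreal_mult_assoc) auto
  finally show ?case .
qed

lemma nsum_Z_Om: "nsum wt Z \<le> ennreal ((exp (\<beta> * th) - 1) * (1 + \<beta> * th) ^ (2 * K - 2)) * nsum wt Om"
proof -
  have "nsum wt Z \<le> ennreal (exp (\<beta> * th) - 1) * nsum wt (Rel (nbr e))" by (rule nsum_Z_Rel)
  also have "\<dots> \<le> ennreal (exp (\<beta> * th) - 1) * (ennreal ((1 + \<beta> * th) ^ card (nbr e)) * nsum wt Om)"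
    by (intro mult_left_mono nsum_Rel_Om) auto
  also have "\<dots> \<le> ennreal (exp (\<beta> * th) - 1) * (ennreal ((1 + \<beta> * th) ^ (2 * K - 2)) * nsum wt Om)"
    using card_nbr[OF eE] x_pos by (intro mult_left_mono mult_right_mono ennreal_leI power_increasing) auto
  also have "\<dots> = ennreal ((exp (\<beta> * th) - 1) * (1 + \<beta> * th) ^ (2 * K - 2)) * nsum wt Om"
    using x_pos by (simp add: mult.assoc[symmetric] ennreal_mult'[symmetric])
  finally show ?thesis .
qed

text \<open>At most \<open>2 * K\<close> links on \<open>f\<close> cannot be deleted, and the
  deletable ones have mean at most \<open>\<beta> * th\<close>.\<close>

lemma nsum_N_e: 
  assumes "f \<in> nbr e"
  shows "nsum (\<lambda>c. real (N_e f c) * wt c) Om \<le> ennreal (2 * real K + \<beta> * th) * nsum wt Om"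
proof -
  let ?I = "\<lambda>c. {i. i < length c \<and> fst (c ! i) = f \<and> del i c \<in> Om}"
  have "nsum (\<lambda>c. real (N_e f c) * wt c) Om \<le> nsum (\<lambda>c. 2 * real K * wt c + real (card (?I c)) * wt c) Om"
  proof (rule nsum_mono)
    fix c assume "c \<in> Om"
    then have "real (N_e f c) \<le> real (card (?I c) + 2 * K)"
      using N_e_le_removable[OF _ assms] by (intro of_nat_mono)
    from mult_right_mono[OF this wt_nonneg[of c]]
    show "real (N_e f c) * wt c \<le> 2 * real K * wt c + real (card (?I c)) * wt c"
      by (simp add: algebra_simps)
  qed
  also have "\<dots> = nsum (\<lambda>c. 2 * real K * wt c) Om + nsum (\<lambda>c. real (card (?I c)) * wt c) Om"
    by (intro nsum_add mult_nonneg_nonneg wt_nonneg) auto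
  also have "nsum (\<lambda>c. real (card (?I c)) * wt c) Om \<le> ennreal (real (card {f}) * (\<beta> * th)) * nsum wt Om"
    by (intro nsum_wt_delete) (use assms in \<open>auto simp: nbr_def Om_def\<close>)
  also have "nsum (\<lambda>c. 2 * real K * wt c) Om = ennreal (2 * real K) * nsum wt Om"
    by (rule nsum_cmult) simp
  finally show ?thesis
    using x_pos by (simp add: distrib_right ennreal_plus add_mono)
qed

end

lemma nsum_sum:
  assumes "finite F" "\<And>f c. f \<in> F \<Longrightarrow> c \<in> A \<Longrightarrow> 0 \<le> h f c"
  shows "nsum (\<lambda>c. \<Sum>f\<in>F. h f c) A = (\<Sum>f\<in>F. nsum (h f) A)"
  using assms
proof (induction F rule: finite_induct)
  case empty
  then show ?case by (simp add: nsum_def)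
next
  case (insert f F)
  have "nsum (\<lambda>c. \<Sum>f\<in>insert f F. h f c) A = nsum (\<lambda>c. h f c + (\<Sum>f\<in>F. h f c)) A"
    using insert.hyps by simp
  also have "\<dots> = nsum (h f) A + nsum (\<lambda>c. \<Sum>f\<in>F. h f c) A"
    using insert.prems by (intro nsum_add sum_nonneg) auto
  finally show ?case using insert by simp
qed

lemma mset_eq_counts:
  assumes "mset c = mset d"
  shows "length c = length d" "n_cross c = n_cross d" "n_dbar c = n_dbar d"
proof -
  show "length c = length d" using assms by (metis size_mset)
  have "size (filter_mset P (mset c)) = length (filter P c)" for P and c :: "'a link_conf"
    by (simp flip: mset_filter)
  then show "n_cross c = n_cross d" "n_dbar c = n_dbar d"
    unfolding n_cross_def n_dbar_def using assms by metis+
qed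

lemma cancel_denom: "n \<noteq> 0 \<Longrightarrow> w * (k / n) / (s / n) = k * w * (1 / (s :: real))"
  by (simp add: field_simps)

section \<open>Lower bound for configurations in which the marked edge is blocking\<close>

context weighted_marked
begin

text \<open>The weight of a configuration in \<open>U\<close> with the loops counted as if the cross on \<open>e\<close> were absent. It is
  invariant under \<open>swap\<close>, so that no power of \<open>\<theta>\<close> is lost along a chain.\<close>

definition wh :: "'v link_conf \<Rightarrow> real" where
  "wh c = \<beta> ^ length c / fact (length c) * u ^ n_cross c * (1 - u) ^ n_dbar c * \<theta> ^ num_loops V (rmv e c)"

definition pos :: "'v link_conf \<Rightarrow> nat" where
  "pos c = length (takeWhile (\<lambda>l. fst l \<noteq> e) c)"

text \<open>\<open>length c\<close> is the number of positions at which a link can be inserted into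
  \<open>rmv e c\<close>, so this is the proportion of them in the gap of the cross on
  \<open>e\<close>.\<close>

definition gap :: "'v link_conf \<Rightarrow> real" where
  "gap c = real (card (slots (rmv e c) (pos c))) / real (length c)"

lemma wh_nonneg: "0 \<le> wh c"
  unfolding wh_def using \<beta> \<theta> u by (intro mult_nonneg_nonneg divide_nonneg_nonneg zero_le_power) auto

lemma one_le_K: "1 \<le> K"
proof -
  obtain a b where ab: "a \<in> V" "e = {a, b}" using edges[OF eE] by (auto simp: edge_on_def)
  have "card {e} \<le> card {g\<in>E. a \<in> g}"
    using ab eE finE by (intro card_mono) auto
  then show ?thesis using deg[OF ab(1)] by simp
qed

lemma pos_append: "ws @ us \<in> Om \<Longrightarrow> pos (ws @ (e, 1) # us) = length ws"
proof -
  assume "ws @ us \<in> Om"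
  then have "\<forall>l\<in>set ws. fst l \<noteq> e" using OmD(2) by (force simp: N_e_0_iff)
  then have "takeWhile (\<lambda>l. fst l \<noteq> e) (ws @ (e, 1) # us) = ws"
    by (subst takeWhile_append2) auto
  then show ?thesis by (simp add: pos_def)
qed

lemma wh_append:
  assumes "ws @ us \<in> Om"
  shows "wh (ws @ (e, 1) # us) = wt (ws @ us) * (\<beta> * u / real (Suc (length (ws @ us))))"
proof -
  have s: "u ^ n_cross (ws @ (e, 1) # us) * (1 - u) ^ n_dbar (ws @ (e, 1) # us)
    = u ^ n_cross (ws @ us) * (1 - u) ^ n_dbar (ws @ us) * u"
    using power_signs[of "(e, 1)" ws us] by (simp add: sgw_def)
  have len: "length (ws @ (e, 1::int) # us) = Suc (length (ws @ us))" by simp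
  have "wh (ws @ (e, 1) # us) = \<beta> ^ Suc (length (ws @ us)) / fact (Suc (length (ws @ us)))
      * (u ^ n_cross (ws @ (e, 1) # us) * (1 - u) ^ n_dbar (ws @ (e, 1) # us)) * \<theta> ^ num_loops V (ws @ us)"
    unfolding wh_def len rmv_single[OF assms] by (simp only: mult.assoc)
  then show ?thesis unfolding s power_fact_Suc by (simp add: wt_def)
qed

lemma gap_append:
  assumes "ws @ us \<in> Om"
  shows "gap (ws @ (e, 1) # us) = real (card (slots (ws @ us) (length ws))) / real (Suc (length (ws @ us)))"
  by (simp add: gap_def pos_append[OF assms] rmv_single[OF assms])

lemma ins_U:
  assumes "c \<in> Om" "i \<le> length c"
  shows "ins i (e, 1) c \<in> U" "pos (ins i (e, 1) c) = i"
    "wh (ins i (e, 1) c) = wt c * (\<beta> * u / real (Suc (length c)))"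
proof -
  have c: "take i c @ drop i c \<in> Om" using assms(1) by simp
  show "ins i (e, 1) c \<in> U" using c unfolding U_def ins_def by blast
  show "pos (ins i (e, 1) c) = i" "wh (ins i (e, 1) c) = wt c * (\<beta> * u / real (Suc (length c)))"
    using pos_append[OF c] wh_append[OF c] assms(2) by (simp_all add: ins_def)
qed

lemma card_slots_pos: "p \<le> length c \<Longrightarrow> 0 < card (slots c p)"
  by (subst card_gt_0_iff) (auto simp: slots_def)

lemma card_slots_le: "card (slots c p) \<le> Suc (length c)"
proof -
  have "card (slots c p) \<le> card {..length c}" by (intro card_mono) (auto simp: slots_def)
  then show ?thesis by simp
qed

lemma gap_pos: "c \<in> U \<Longrightarrow> 0 < gap c"
  by (erule U_E) (auto simp: gap_append card_slots_pos)

lemma nsum_U_ge: "ennreal (\<beta> * u) * nsum wt Om \<le> nsum wh U"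
proof -
  have "ennreal (\<beta> * u) * nsum wt Om = nsum (\<lambda>c. \<beta> * u * wt c) Om"
    using \<beta> u by (intro nsum_cmult[symmetric]) simp
  also have "\<dots> = nsum (\<lambda>c. \<Sum>i\<in>{..length c}. wt c * (\<beta> * u / real (Suc (length c)))) Om"
    by (rule nsum_cong) (simp add: field_simps)
  also have "\<dots> \<le> nsum (\<lambda>c. \<Sum>i\<in>{pos c}. wh c) U"
  proof (rule nsum_insert[where l = "(e, 1)"])
    show "i \<le> length c \<and> ins i (e, 1) c \<in> U \<and> i \<in> {pos (ins i (e, 1) c)} \<and>
        wt c * (\<beta> * u / real (Suc (length c))) \<le> wh (ins i (e, 1) c)"
      if "c \<in> Om" "i \<in> {..length c}" for c i
      using that ins_U[of c i] by simp
  qed (use \<beta> u wt_nonneg wh_nonneg in auto)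
  finally show ?thesis by simp
qed

text \<open>In the uniform choice of the first position, the reciprocal of the gap proportion leaves
  a sum of reciprocal slot numbers, that is, the number of gaps.\<close>

lemma nsum_wh_gap_le:
  "nsum (\<lambda>c. wh c / gap c) U \<le>
     ennreal (\<beta> * u) * nsum (\<lambda>c. (real (length (filter (\<lambda>l. fst l \<inter> e \<noteq> {}) c)) + 1) * wt c) Om"
proof -
  have "nsum (\<lambda>c. wh c / gap c) U = nsum (\<lambda>c. \<Sum>i\<in>{pos c}. wh c / gap c) U" by simp
  also have "\<dots> \<le> nsum (\<lambda>c. \<Sum>i\<le>length c. \<Sum>l\<in>{(e, 1::int)}. \<beta> * u * wt c * (1 / real (card (slots c i)))) Om"
  proof (rule nsum_delete[where I = "\<lambda>c. {pos c}" and f = "\<lambda>c i. wh c / gap c" and L = "{(e, 1)}"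
        and g = "\<lambda>c i l. \<beta> * u * wt c * (1 / real (card (slots c i)))"])
    fix c i assume "c \<in> U" and i: "i \<in> {pos c}"
    then obtain ws us where c: "c = ws @ (e, 1) # us" "ws @ us \<in> Om" by (blast elim: U_E)
    have i: "i = length ws" using i pos_append[OF c(2)] c(1) by simp
    have d: "del i c = ws @ us" unfolding c(1) i by (rule del_append)
    have "wh c / gap c = \<beta> * u * wt (ws @ us) * (1 / real (card (slots (ws @ us) (length ws))))"
      unfolding c(1) wh_append[OF c(2)] gap_append[OF c(2)] by (rule cancel_denom) simp
    then show "i < length c \<and> c ! i \<in> {(e, 1)} \<and> del i c \<in> Om \<and>
        wh c / gap c \<le> \<beta> * u * wt (del i c) * (1 / real (card (slots (del i c) i)))"
      unfolding d using c i by (simp add: nth_append)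
  qed (use \<beta> u wt_nonneg wh_nonneg in \<open>auto simp: gap_def\<close>)
  also have "\<dots> \<le> nsum (\<lambda>c. \<beta> * u * ((real (length (filter (\<lambda>l. fst l \<inter> e \<noteq> {}) c)) + 1) * wt c)) Om"
  proof (rule nsum_mono)
    fix c
    have "(\<Sum>i\<le>length c. \<Sum>l\<in>{(e, 1::int)}. \<beta> * u * wt c * (1 / real (card (slots c i))))
        = \<beta> * u * wt c * (\<Sum>i\<le>length c. 1 / real (card (slots c i)))"
      by (simp add: sum_distrib_left)
    also have "\<dots> \<le> \<beta> * u * wt c * (real (length (filter (\<lambda>l. fst l \<inter> e \<noteq> {}) c)) + 1)"
      using \<beta> u wt_nonneg by (intro mult_left_mono sum_inverse_slots) auto
    finally show "(\<Sum>i\<le>length c. \<Sum>l\<in>{(e, 1::int)}. \<beta> * u * wt c * (1 / real (card (slots c i))))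
        \<le> \<beta> * u * ((real (length (filter (\<lambda>l. fst l \<inter> e \<noteq> {}) c)) + 1) * wt c)"
      by (simp only: mult.assoc mult.commute mult.left_commute)
  qed
  also have "\<dots> = ennreal (\<beta> * u) * nsum (\<lambda>c. (real (length (filter (\<lambda>l. fst l \<inter> e \<noteq> {}) c)) + 1) * wt c) Om"
    using \<beta> u by (intro nsum_cmult) simp
  finally show ?thesis .
qed

text \<open>Bound for the mean number of gaps: one, plus for each of at most 2K - 2 neighbours its
  mean number of links.\<close>

definition EM :: real where
  "EM = 1 + (2 * real K - 2) * (2 * real K + \<beta> * th)"

lemma EM_ge_1: "1 \<le> EM"
  using one_le_K x_pos by (simp add: EM_def)

lemma nsum_incident_le:
  "nsum (\<lambda>c. (real (length (filter (\<lambda>l. fst l \<inter> e \<noteq> {}) c)) + 1) * wt c) Om \<le> ennreal EM * nsum wt Om"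
proof -
  let ?y = "2 * real K + \<beta> * th"
  have y: "0 \<le> ?y" using x_pos by simp
  have "nsum (\<lambda>c. (real (length (filter (\<lambda>l. fst l \<inter> e \<noteq> {}) c)) + 1) * wt c) Om
      = nsum (\<lambda>c. wt c + (\<Sum>f\<in>nbr e. real (N_e f c) * wt c)) Om"
    by (rule nsum_cong) (simp add: length_filter_nbr distrib_right sum_distrib_right add.commute)
  also have "\<dots> = nsum wt Om + (\<Sum>f\<in>nbr e. nsum (\<lambda>c. real (N_e f c) * wt c) Om)"
    by (subst nsum_add) (auto intro!: sum_nonneg mult_nonneg_nonneg wt_nonneg nsum_sum)
  also have "(\<Sum>f\<in>nbr e. nsum (\<lambda>c. real (N_e f c) * wt c) Om) \<le> (\<Sum>f\<in>nbr e. ennreal ?y * nsum wt Om)"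
    by (intro sum_mono nsum_N_e)
  also have "\<dots> = ennreal (real (card (nbr e)) * ?y) * nsum wt Om"
    using y by (simp add: ennreal_mult' ennreal_of_nat_eq_real_of_nat mult.assoc)
  also have "\<dots> \<le> ennreal ((2 * real K - 2) * ?y) * nsum wt Om"
  proof (intro mult_right_mono ennreal_leI)
    have "real (card (nbr e)) \<le> real (2 * K - 2)" using card_nbr[OF eE] by (intro of_nat_mono)
    then show "real (card (nbr e)) \<le> 2 * real K - 2" using one_le_K by (simp add: of_nat_diff)
  qed (use y in auto)
  finally have "nsum (\<lambda>c. (real (length (filter (\<lambda>l. fst l \<inter> e \<noteq> {}) c)) + 1) * wt c) Om
      \<le> ennreal 1 * nsum wt Om + ennreal ((2 * real K - 2) * ?y) * nsum wt Om"
    by (simp add: add_left_mono)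
  also have "\<dots> = ennreal EM * nsum wt Om"
    unfolding EM_def using y one_le_K by (subst ennreal_plus) (simp_all add: distrib_right)
  finally show ?thesis .
qed

text \<open>Every exchange is injective by \<open>swap_inj\<close> and preserves \<open>wh\<close>,
  so chains of a fixed length and starting vertex carry no more weight than their ends in
  \<open>D\<close>.\<close>

lemma nsum_chain:
  assumes "x \<in> e" "y \<in> e"
  shows "nsum wh {c \<in> U. chain n x y c} \<le> nsum wh D"
  using assms
proof (induction n arbitrary: x y)
  case 0
  show ?case by (rule nsum_subset) auto
next
  case (Suc n)
  let ?A = "{c \<in> U. chain (Suc n) x y c}" and ?B = "{c \<in> U. chain n y x c}"
  define h where "h c = (SOME c'. swap x c c' \<and> chain n y x c')" for c
  have h: "swap x c (h c) \<and> chain n y x (h c)" if "c \<in> ?A" for c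
  proof -
    have "\<exists>c'. swap x c c' \<and> chain n y x c'" using that by auto
    then show ?thesis unfolding h_def by (rule someI_ex)
  qed
  have "nsum wh ?A \<le> nsum wh ?B"
  proof (rule nsum_inj[where h = h])
    show "inj_on h ?A"
    proof (rule inj_onI)
      fix c d assume "c \<in> ?A" "d \<in> ?A" "h c = h d"
      then show "c = d" using h[of c] h[of d] swap_inj[of x c "h c" d] by simp
    qed
    show "h ` ?A \<subseteq> ?B"
    proof
      fix d assume "d \<in> h ` ?A"
      then obtain c where c: "c \<in> ?A" "d = h c" by blast
      then show "d \<in> ?B" using h[OF c(1)] swap_props(1)[of c x "h c"] Suc.prems by simp
    qed
    show "wh c \<le> wh (h c)" if "c \<in> ?A" for c
    proof -
      have "c \<in> U" using that by simp
      note p = swap_props[OF this conjunct1[OF h[OF that]] Suc.prems(1)]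
      show ?thesis using mset_eq_counts[OF p(3)] p(4) by (simp add: wh_def)
    qed
  qed
  also have "\<dots> \<le> nsum wh D" using Suc.IH[OF Suc.prems(2,1)] .
  finally show ?case .
qed

lemma nsum_U_le: "nsum wh U \<le> ennreal (4 * real K - 3) * nsum wh D"
proof -
  obtain x y where e: "e = {x, y}" using edges[OF eE] by (auto simp: edge_on_def)
  let ?C = "\<lambda>n x y. {c \<in> U. chain (Suc n) x y c}"
  let ?N = "{..<2 * K - 2}"
  have "U \<subseteq> D \<union> (\<Union>n\<in>?N. ?C n x y \<union> ?C n y x)"
    using chain_exists[OF _ e] by fastforce
  then have "nsum wh U \<le> nsum wh (D \<union> (\<Union>n\<in>?N. ?C n x y \<union> ?C n y x))" by (rule nsum_subset)
  also have "\<dots> \<le> nsum wh D + nsum wh (\<Union>n\<in>?N. ?C n x y \<union> ?C n y x)" by (rule nsum_Un_le)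
  also have "nsum wh (\<Union>n\<in>?N. ?C n x y \<union> ?C n y x) \<le> (\<Sum>n\<in>?N. nsum wh (?C n x y \<union> ?C n y x))"
    by (rule nsum_UN_le) simp
  also have "\<dots> \<le> (\<Sum>n\<in>?N. ennreal 2 * nsum wh D)"
  proof (rule sum_mono)
    fix n
    have "nsum wh (?C n x y \<union> ?C n y x) \<le> nsum wh (?C n x y) + nsum wh (?C n y x)" by (rule nsum_Un_le)
    also have "\<dots> \<le> nsum wh D + nsum wh D" using e by (intro add_mono nsum_chain) auto
    finally show "nsum wh (?C n x y \<union> ?C n y x) \<le> ennreal 2 * nsum wh D" by (simp add: mult_2)
  qed
  also have "\<dots> = ennreal (real (2 * K - 2) * 2) * nsum wh D"
    by (simp only: sum_constant card_lessThan ennreal_of_nat_eq_real_of_nat) (rule ennreal_mult_assoc; simp)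
  finally have "nsum wh U \<le> ennreal 1 * nsum wh D + ennreal (real (2 * K - 2) * 2) * nsum wh D"
    by (simp add: add_left_mono)
  also have "\<dots> = ennreal (1 + real (2 * K - 2) * 2) * nsum wh D"
    by (subst ennreal_plus) (simp_all add: distrib_right)
  also have "1 + real (2 * K - 2) * 2 = 4 * real K - 3" using one_le_K by (simp add: of_nat_diff)
  finally show ?thesis .
qed

lemma wt_second_insertion:
  assumes "j \<le> length c" "num_loops V (ins j (e, 1) c) = num_loops V (rmv e c)"
  shows "wt (ins j (e, 1) c) = wh c * (\<beta> * u / real (Suc (length c)))"
proof -
  have s: "u ^ n_cross (ins j (e, 1) c) * (1 - u) ^ n_dbar (ins j (e, 1) c)
    = u ^ n_cross c * (1 - u) ^ n_dbar c * u"
    using power_signs[of "(e, 1)" "take j c" "drop j c"] by (simp add: sgw_def ins_def)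
  have "wt (ins j (e, 1) c) = \<beta> ^ Suc (length c) / fact (Suc (length c))
      * (u ^ n_cross (ins j (e, 1) c) * (1 - u) ^ n_dbar (ins j (e, 1) c)) * \<theta> ^ num_loops V (rmv e c)"
    unfolding wt_def assms(2) length_ins by (simp only: mult.assoc)
  then show ?thesis unfolding s power_fact_Suc by (simp add: wh_def)
qed

text \<open>Either of the two crosses on \<open>e\<close> may have been inserted second, so each
  configuration of \<open>Z1\<close> is reached in two ways; hence the factor 2.\<close>

lemma nsum_Z1_ge: "ennreal (\<beta> * u) * nsum (\<lambda>c. wh c * gap c) D \<le> ennreal 2 * nsum wt Z1"
proof -
  let ?J = "\<lambda>c. {j. j \<le> length c \<and> ins j (e, 1) c \<in> Z1 \<and> num_loops V (ins j (e, 1) c) = num_loops V (rmv e c)}"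
  let ?I = "\<lambda>c::'v link_conf. {i. i < length c \<and> fst (c ! i) = e}"
  have bu: "0 \<le> \<beta> * u" using \<beta> u by simp
  have "ennreal (\<beta> * u) * nsum (\<lambda>c. wh c * gap c) D = nsum (\<lambda>c. \<beta> * u * (wh c * gap c)) D"
    using bu by (rule nsum_cmult[symmetric])
  also have "\<dots> \<le> nsum (\<lambda>c. \<Sum>j\<in>?J c. wh c * (\<beta> * u / real (Suc (length c)))) D"
  proof (rule nsum_mono)
    fix c assume cD: "c \<in> D"
    then have "c \<in> U" by (simp add: D_def)
    then obtain ws us where c: "c = ws @ (e, 1) # us" "ws @ us \<in> Om" "rmv e c = ws @ us" by (rule U_E)
    let ?s = "card (slots (ws @ us) (length ws))" and ?n = "Suc (length (ws @ us))"
    have len: "length c = ?n" by (simp add: c(1))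
    have J: "?s + 1 \<le> card (?J c)"
      using card_second_insertions[of ws us] cD c(2) c(3) len by (simp add: c(1))
    have "gap c = real ?s / real ?n" unfolding c(1) by (rule gap_append[OF c(2)])
    \<comment> \<open>The list has grown by the first cross, so the second choice has one position
      more; the additional insertion found in \<open>card_second_insertions\<close> makes up for it,
      because \<open>?s \<le> ?n\<close>.\<close>
    also have "\<dots> \<le> real (?s + 1) / real (Suc ?n)"
      using card_slots_le[of "ws @ us" "length ws"] by (simp add: field_simps)
    also have "\<dots> \<le> real (card (?J c)) / real (Suc ?n)"
      using J by (intro divide_right_mono of_nat_mono) simp_all
    finally have g: "gap c \<le> real (card (?J c)) / real (Suc (length c))" by (simp only: len)
    have "\<beta> * u * (wh c * gap c) \<le> \<beta> * u * (wh c * (real (card (?J c)) / real (Suc (length c))))"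
      using bu wh_nonneg by (intro mult_left_mono g)
    then show "\<beta> * u * (wh c * gap c) \<le> (\<Sum>j\<in>?J c. wh c * (\<beta> * u / real (Suc (length c))))"
      by (simp add: mult.commute mult.left_commute)
  qed
  also have "\<dots> \<le> nsum (\<lambda>c. \<Sum>i\<in>?I c. wt c) Z1"
  proof (rule nsum_insert[where l = "(e, 1)"])
    show "j \<le> length c \<and> ins j (e, 1) c \<in> Z1 \<and> j \<in> ?I (ins j (e, 1) c) \<and>
        wh c * (\<beta> * u / real (Suc (length c))) \<le> wt (ins j (e, 1) c)" if "c \<in> D" "j \<in> ?J c" for c j
      using that wt_second_insertion[of j c] by (auto simp: nth_ins)
  qed (use bu wt_nonneg wh_nonneg in auto)
  also have "\<dots> = nsum (\<lambda>c. 2 * wt c) Z1"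
  proof (rule nsum_cong)
    fix c assume "c \<in> Z1"
    then have "card (?I c) = 2" using blocking_N_e[of e c] by (simp add: Z1_def N_e_card)
    then show "(\<Sum>i\<in>?I c. wt c) = 2 * wt c" by simp
  qed
  also have "\<dots> = ennreal 2 * nsum wt Z1" by (rule nsum_cmult) simp
  finally show ?thesis .
qed

text \<open>Cauchy-Schwarz for \<open>wh\<close> on \<open>D\<close>, in the form \<open>2t \<le> gap + t\<^sup>2 / gap\<close> with the constant \<open>t\<close> chosen in advance.\<close>

lemma nsum_Z1_Om:
  "ennreal ((\<beta> * u)\<^sup>2 / (2 * (4 * real K - 3)\<^sup>2 * EM)) * nsum wt Om \<le> nsum wt Z1"
proof -
  define k where "k = 4 * real K - 3"
  \<comment> \<open>With A = \<beta> u w / k below the \<open>wh\<close>-weight of \<open>D\<close>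
    and B = \<beta> u M w above that of \<open>wh / gap\<close>, where M is \<open>EM\<close> and w
    the weight of \<open>Om\<close>, the bound 2tA - t^2 B is maximal at t = A/B = 1/(k M). Its
    value there is A^2/B = y w.\<close>
  define t where "t = 1 / (k * EM)"
  define y where "y = \<beta> * u / (k\<^sup>2 * EM)"
  have k: "1 \<le> k" using one_le_K by (simp add: k_def)
  have E: "1 \<le> EM" by (rule EM_ge_1)
  have bu: "0 < \<beta> * u" using \<beta> u by simp
  have t: "0 < t" using k E by (simp add: t_def)
  have y: "0 < y" using k E bu by (simp add: y_def)
  have y1: "2 * t * (\<beta> * u / k) = 2 * y" "t\<^sup>2 * (\<beta> * u * EM) = y"
    using k E by (simp_all add: y_def t_def power2_eq_square field_simps)
  have DU: "D \<subseteq> U" by (auto simp: D_def)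
  \<comment> \<open>Finiteness of the weight of \<open>Om\<close> is what later allows
    \<open>y * w\<close> to be cancelled in \<open>ennreal\<close>.\<close>
  have "Om \<subseteq> {c. set c \<subseteq> E \<times> {-1, 1}}" by (auto simp: Om_def)
  then have "nsum wt Om < \<top>" using nsum_subset nsum_wt_finite by (metis le_less_trans)
  then obtain w where w: "nsum wt Om = ennreal w" "0 \<le> w" by (cases "nsum wt Om") auto
  have "ennreal (\<beta> * u) * nsum wt Om \<le> ennreal k * nsum wh D"
    using nsum_U_ge nsum_U_le unfolding k_def by (rule order_trans)
  then have "ennreal (\<beta> * u / k * w) \<le> nsum wh D"
    using bu k w by (cases "nsum wh D") (auto simp: ennreal_mult'[symmetric] field_simps)
  then have "ennreal (2 * t) * ennreal (\<beta> * u / k * w) \<le> ennreal (2 * t) * nsum wh D"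
    by (rule mult_left_mono) simp
  moreover have "ennreal (2 * t) * ennreal (\<beta> * u / k * w) = ennreal (2 * y * w)"
    using t y1(1) by (subst ennreal_mult'[symmetric], simp, metis mult.assoc)
  ultimately have 1: "ennreal (2 * y * w) \<le> ennreal (2 * t) * nsum wh D" by simp
  have "ennreal (2 * t) * nsum wh D = nsum (\<lambda>c. 2 * t * wh c) D"
    using t by (intro nsum_cmult[symmetric]) simp
  also have "\<dots> \<le> nsum (\<lambda>c. wh c * gap c + t\<^sup>2 * (wh c / gap c)) D"
  proof (rule nsum_mono)
    fix c assume "c \<in> D"
    then have g: "0 < gap c" using gap_pos DU by blast
    have "0 \<le> (gap c - t)\<^sup>2 / gap c" using g by simp
    then have "2 * t \<le> gap c + t\<^sup>2 / gap c" using g by (simp add: field_simps power2_eq_square)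
    from mult_left_mono[OF this wh_nonneg[of c]]
    show "2 * t * wh c \<le> wh c * gap c + t\<^sup>2 * (wh c / gap c)" by (simp add: field_simps)
  qed
  also have "\<dots> = nsum (\<lambda>c. wh c * gap c) D + nsum (\<lambda>c. t\<^sup>2 * (wh c / gap c)) D"
    using wh_nonneg by (intro nsum_add mult_nonneg_nonneg divide_nonneg_nonneg) (auto simp: gap_def)
  also have "nsum (\<lambda>c. t\<^sup>2 * (wh c / gap c)) D = ennreal (t\<^sup>2) * nsum (\<lambda>c. wh c / gap c) D"
    by (rule nsum_cmult) simp
  also have "\<dots> \<le> ennreal (t\<^sup>2) * nsum (\<lambda>c. wh c / gap c) U"
    by (intro mult_left_mono nsum_subset DU) simp
  also have "\<dots> \<le> ennreal (t\<^sup>2) * (ennreal (\<beta> * u) * (ennreal EM * nsum wt Om))"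
    by (intro mult_left_mono order_trans[OF nsum_wh_gap_le] nsum_incident_le) simp_all
  also have "\<dots> = ennreal (y * w)"
    using bu E y1(2) w by (simp add: ennreal_mult'[symmetric] mult.assoc[symmetric])
  finally have "ennreal (2 * t) * nsum wh D \<le> nsum (\<lambda>c. wh c * gap c) D + ennreal (y * w)"
    by (simp add: add_left_mono)
  with 1 have "ennreal (2 * y * w) \<le> nsum (\<lambda>c. wh c * gap c) D + ennreal (y * w)"
    by (rule order_trans)
  then have "ennreal (y * w) \<le> nsum (\<lambda>c. wh c * gap c) D"
    using y w by (cases "nsum (\<lambda>c. wh c * gap c) D") (auto simp: ennreal_plus[symmetric] mult.commute[of y w] simp del: ennreal_plus)
  then have "ennreal (\<beta> * u) * ennreal (y * w) \<le> ennreal (\<beta> * u) * nsum (\<lambda>c. wh c * gap c) D"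
    by (rule mult_left_mono) simp
  also have "\<dots> \<le> ennreal 2 * nsum wt Z1" by (rule nsum_Z1_ge)
  finally have "ennreal (\<beta> * u * (y * w)) \<le> ennreal 2 * nsum wt Z1"
    using bu by (simp add: ennreal_mult')
  then have "ennreal (1 / 2) * ennreal (\<beta> * u * (y * w)) \<le> ennreal (1 / 2) * (ennreal 2 * nsum wt Z1)"
    by (rule mult_left_mono) simp
  also have "\<dots> = nsum wt Z1" by (subst ennreal_mult_assoc) simp_all
  also have "ennreal (1 / 2) * ennreal (\<beta> * u * (y * w)) = ennreal (\<beta> * u * (y * w) / 2)"
    by (subst ennreal_mult'[symmetric]) simp_all
  finally have "ennreal (\<beta> * u * (y * w) / 2) \<le> nsum wt Z1" .
  moreover have "(\<beta> * u)\<^sup>2 / (2 * k\<^sup>2 * EM) * w = \<beta> * u * (y * w) / 2"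
    using k E by (simp add: y_def power2_eq_square field_simps)
  moreover have "ennreal ((\<beta> * u)\<^sup>2 / (2 * k\<^sup>2 * EM)) * ennreal w = ennreal ((\<beta> * u)\<^sup>2 / (2 * k\<^sup>2 * EM) * w)"
    using w(2) by (rule ennreal_mult''[symmetric])
  ultimately show ?thesis
    unfolding k_def[symmetric] w(1) by metis
qed

end

section \<open>Stochastic domination from conditional bounds\<close>

lemma pmf_bind_bernoulli:
  assumes "0 \<le> q" "q \<le> 1"
  shows "pmf (bind_pmf (bernoulli_pmf q) f) i = q * pmf (f True) i + (1 - q) * pmf (f False) i"
  using assms by (simp add: pmf_bind)

lemma rel_pmf_bernoulli:
  assumes "0 \<le> p" "p \<le> q" "q \<le> 1"
  shows "rel_pmf (\<longrightarrow>) (bernoulli_pmf p) (bernoulli_pmf q)"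
proof -
  \<comment> \<open>Thinning: a success of the larger variable is kept with probability
    \<open>p / q\<close>. For \<open>q = 0\<close> also \<open>p = 0\<close>, and the quotient is
    0.\<close>
  define k where "k b = (if b then bernoulli_pmf (p / q) else return_pmf False)" for b
  have pq: "0 \<le> p / q" "p / q \<le> 1" using assms by (auto simp: divide_le_eq_1)
  have "pmf (bind_pmf (bernoulli_pmf q) k) i = pmf (bernoulli_pmf p) i" for i
    using assms pq by (cases i) (auto simp: pmf_bind_bernoulli k_def field_simps)
  then have p: "bernoulli_pmf p = bind_pmf (bernoulli_pmf q) k" by (intro pmf_eqI) simp
  have "rel_pmf (\<longrightarrow>) (bind_pmf (bernoulli_pmf q) k) (bind_pmf (bernoulli_pmf q) return_pmf)"
  proof (rule rel_pmf_bindI)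
    show "rel_pmf (=) (bernoulli_pmf q) (bernoulli_pmf q)" by (rule pmf.rel_refl) simp
    show "rel_pmf (\<longrightarrow>) (k a) (return_pmf b)" if "a = b" for a b
      using that by (auto simp: k_def rel_pmf_return_pmf2)
  qed
  then show ?thesis by (simp add: p[symmetric] bind_return_pmf')
qed

lemma pmf_map_fun_upd_False:
  "pmf (map_pmf (\<lambda>\<omega>. (fun_upd \<omega> a False)) p) \<eta> =
     (if \<eta> a then 0 else pmf p (fun_upd \<eta> a True) + pmf p (fun_upd \<eta> a False))"
proof -
  have "(\<lambda>\<omega>. (fun_upd \<omega> a False)) -` {\<eta>} = (if \<eta> a then {} else {(fun_upd \<eta> a True), (fun_upd \<eta> a False)})"
    by (auto simp: fun_eq_iff split: if_splits)
  moreover have "(fun_upd \<eta> a True) \<noteq> (fun_upd \<eta> a False)" by (auto simp: fun_eq_iff)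
  ultimately show ?thesis by (simp add: pmf_map measure_measure_pmf_finite)
qed

text \<open>Disintegration along one coordinate: resetting it to \<open>False\<close> encodes the
  marginal \<open>p'\<close> of the others, and \<open>r\<close> is the conditional probability of
  \<open>True\<close>. Where the marginal vanishes, \<open>r\<close> is 0 and has no effect.\<close>

lemma pmf_eq_bind_fun_upd:
  fixes p :: "('a \<Rightarrow> bool) pmf" and a :: 'a
  defines "p' \<equiv> map_pmf (\<lambda>\<omega>. (fun_upd \<omega> a False)) p"
  defines "r \<equiv> \<lambda>\<eta>. pmf p (fun_upd \<eta> a True) / pmf p' \<eta>"
  shows "p = bind_pmf p' (\<lambda>\<eta>. map_pmf (\<lambda>y. (fun_upd \<eta> a y)) (bernoulli_pmf (r \<eta>)))"
proof (rule pmf_eqI)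
  fix \<zeta> :: "'a \<Rightarrow> bool"
  let ?\<eta> = "(fun_upd \<zeta> a False)"
  let ?k = "\<lambda>\<eta>. map_pmf (\<lambda>y. (fun_upd \<eta> a y)) (bernoulli_pmf (r \<eta>))"
  have p': "pmf p' ?\<eta> = pmf p (fun_upd ?\<eta> a True) + pmf p ?\<eta>"
    unfolding p'_def pmf_map_fun_upd_False by simp
  have r: "0 \<le> r ?\<eta>" "r ?\<eta> \<le> 1"
    unfolding r_def p' by (auto simp: divide_le_eq_1 add_nonneg_eq_0_iff less_le)
  have "pmf (bind_pmf p' ?k) \<zeta> = (\<integral>\<eta>. pmf (?k \<eta>) \<zeta> \<partial>measure_pmf p')" by (rule pmf_bind)
  also have "\<dots> = (\<Sum>\<eta>\<in>{?\<eta>}. pmf (?k \<eta>) \<zeta> * pmf p' \<eta>)"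
  proof (rule integral_measure_pmf_real)
    fix \<eta> assume \<eta>: "\<eta> \<in> set_pmf p'" and "pmf (?k \<eta>) \<zeta> \<noteq> 0"
    then have "\<zeta> \<in> set_pmf (?k \<eta>)" by (meson set_pmf_iff)
    then obtain y where "\<zeta> = (fun_upd \<eta> a y)" by auto
    moreover have "\<not> \<eta> a" using \<eta> by (auto simp: p'_def)
    ultimately show "\<eta> \<in> {?\<eta>}" by (auto simp: fun_eq_iff)
  qed simp
  also have "\<dots> = pmf (?k ?\<eta>) \<zeta> * pmf p' ?\<eta>" by simp
  also have "pmf (?k ?\<eta>) \<zeta> = pmf (bernoulli_pmf (r ?\<eta>)) (\<zeta> a)"
  proof -
    have "inj (\<lambda>y. (fun_upd ?\<eta> a y))" by (rule injI) (metis fun_upd_same)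
    from pmf_map_inj'[OF this, of "bernoulli_pmf (r ?\<eta>)" "\<zeta> a"] show ?thesis by simp
  qed
  also have "pmf (bernoulli_pmf (r ?\<eta>)) (\<zeta> a) * pmf p' ?\<eta> = pmf p \<zeta>"
  proof (cases "pmf p' ?\<eta> = 0")
    case True
    then have "pmf p (fun_upd ?\<eta> a True) = 0" "pmf p ?\<eta> = 0"
      unfolding p' by (simp_all add: add_nonneg_eq_0_iff)
    moreover have "\<zeta> = (fun_upd ?\<eta> a True) \<or> \<zeta> = ?\<eta>" by (cases "\<zeta> a") (auto simp: fun_eq_iff)
    ultimately show ?thesis using True by auto
  next
    case False
    show ?thesis
    proof (cases "\<zeta> a")
      case True
      then have "\<zeta> = (fun_upd ?\<eta> a True)" by (auto simp: fun_eq_iff)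
      then show ?thesis using True r False by (simp add: r_def)
    next
      case F: False
      then have "\<zeta> = ?\<eta>" by (auto simp: fun_eq_iff)
      then have "pmf p \<zeta> = pmf p' ?\<eta> - r ?\<eta> * pmf p' ?\<eta>" using False p' by (simp add: r_def)
      then show ?thesis using F r by (simp add: algebra_simps)
    qed
  qed
  finally show "pmf p \<zeta> = pmf (bind_pmf p' ?k) \<zeta>" ..
qed

text \<open>The hypothesis bounds the conditional probability of a coordinate given all others.
  Summing over the value at \<open>a\<close> passes it on to the marginal, so the other coordinates
  are coupled by induction and \<open>a\<close> is then added by thinning.\<close>

lemma rel_pmf_Pi_bernoulli:
  fixes p :: "('a \<Rightarrow> bool) pmf"
  assumes "finite A" "0 \<le> \<delta>" "\<delta> \<le> 1"
    and "\<And>x \<omega>. x \<in> A \<Longrightarrow> \<delta> * (pmf p (fun_upd \<omega> x True) + pmf p (fun_upd \<omega> x False)) \<le> pmf p (fun_upd \<omega> x True)"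
  shows "rel_pmf (\<lambda>\<omega> \<eta>. \<forall>x\<in>A. \<omega> x \<longrightarrow> \<eta> x) (Pi_pmf A False (\<lambda>_. bernoulli_pmf \<delta>)) p"
  using assms(1,4)
proof (induction A arbitrary: p rule: finite_induct)
  case empty
  then show ?case by (simp add: rel_pmf_return_pmf1)
next
  case (insert a A)
  define p' where "p' = map_pmf (\<lambda>\<omega>. (fun_upd \<omega> a False)) p"
  define r where "r \<eta> = pmf p (fun_upd \<eta> a True) / pmf p' \<eta>" for \<eta>
  have pmf_p': "pmf p' \<eta> = (if \<eta> a then 0 else pmf p (fun_upd \<eta> a True) + pmf p (fun_upd \<eta> a False))" for \<eta>
    unfolding p'_def by (rule pmf_map_fun_upd_False)
  have pr: "\<delta> * (pmf p (fun_upd \<eta> a True) + pmf p (fun_upd \<eta> a False)) \<le> pmf p (fun_upd \<eta> a True)" for \<eta>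
    using insert.prems[of a \<eta>] by (simp add: fun_upd_def)
  have IH: "rel_pmf (\<lambda>\<omega> \<eta>. \<forall>x\<in>A. \<omega> x \<longrightarrow> \<eta> x) (Pi_pmf A False (\<lambda>_. bernoulli_pmf \<delta>)) p'"
  proof (rule insert.IH)
    fix x :: 'a and \<omega> :: "'a \<Rightarrow> bool"
    assume x: "x \<in> A"
    then have "x \<noteq> a" using insert.hyps by auto
    then have tw: "fun_upd (fun_upd \<omega> x v) a w = fun_upd (fun_upd \<omega> a w) x v" for v w
      by (simp add: fun_eq_iff)
    have p'x: "pmf p' (fun_upd \<omega> x v) =
        (if \<omega> a then 0 else pmf p (fun_upd (fun_upd \<omega> a True) x v) + pmf p (fun_upd (fun_upd \<omega> a False) x v))" for v
      unfolding pmf_p' tw using \<open>x \<noteq> a\<close> by simp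
    show "\<delta> * (pmf p' (fun_upd \<omega> x True) + pmf p' (fun_upd \<omega> x False)) \<le> pmf p' (fun_upd \<omega> x True)"
      using insert.prems[OF insertI2[OF x], of "fun_upd \<omega> a True"]
        insert.prems[OF insertI2[OF x], of "fun_upd \<omega> a False"]
      unfolding p'x by (auto simp only: distrib_left split: if_split)
  qed
  have p: "p = bind_pmf p' (\<lambda>\<eta>. map_pmf (\<lambda>y. (fun_upd \<eta> a y)) (bernoulli_pmf (r \<eta>)))"
    unfolding p'_def r_def[abs_def] by (rule pmf_eq_bind_fun_upd)
  have Pi: "Pi_pmf (insert a A) False (\<lambda>_. bernoulli_pmf \<delta>) =
      bind_pmf (Pi_pmf A False (\<lambda>_. bernoulli_pmf \<delta>)) (\<lambda>f. map_pmf (\<lambda>y. (fun_upd f a y)) (bernoulli_pmf \<delta>))"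
    unfolding Pi_pmf_insert'[OF insert.hyps] map_pmf_def by (rule bind_commute_pmf)
  \<comment> \<open>Restricting to the support of \<open>p'\<close> ensures that
    \<open>\<eta> a\<close> is \<open>False\<close> and that the denominator of \<open>r\<close> is
    positive.\<close>
  have "rel_pmf (\<lambda>\<omega> \<eta>. (\<forall>x\<in>A. \<omega> x \<longrightarrow> \<eta> x) \<and> \<eta> \<in> set_pmf p') (Pi_pmf A False (\<lambda>_. bernoulli_pmf \<delta>)) p'"
    using IH by (rule pmf.rel_mono_strong) auto
  then show ?case
    unfolding Pi
    apply (subst p)
  proof (rule rel_pmf_bindI)
    fix f \<eta> assume f\<eta>: "(\<forall>x\<in>A. f x \<longrightarrow> \<eta> x) \<and> \<eta> \<in> set_pmf p'"
    then have na: "\<not> \<eta> a" by (auto simp: p'_def)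
    have pos: "0 < pmf p' \<eta>" using f\<eta> by (simp add: pmf_positive)
    then have "\<delta> \<le> r \<eta>" "r \<eta> \<le> 1"
      using pr[of \<eta>] na by (auto simp: r_def pmf_p' pos_le_divide_eq divide_le_eq_1)
    then have "rel_pmf (\<longrightarrow>) (bernoulli_pmf \<delta>) (bernoulli_pmf (r \<eta>))"
      using assms(2) by (intro rel_pmf_bernoulli)
    then show "rel_pmf (\<lambda>\<omega> \<eta>. \<forall>x\<in>insert a A. \<omega> x \<longrightarrow> \<eta> x)
        (map_pmf (\<lambda>y. (fun_upd f a y)) (bernoulli_pmf \<delta>)) (map_pmf (\<lambda>y. (fun_upd \<eta> a y)) (bernoulli_pmf (r \<eta>)))"
      unfolding pmf.rel_map using f\<eta> by (elim pmf.rel_mono_strong) auto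
  qed
qed

section \<open>The numerical inequality\<close>

lemma exp_minus_1_lower:
  fixes x :: real
  assumes "0 \<le> x"
  shows "x * (1 + x / 2 + x ^ 2 / 6 + x ^ 3 / 24) \<le> exp x - 1"
proof -
  have s: "(\<lambda>k. x ^ k / fact k) sums exp x"
    using exp_converges[of x] by (simp add: divide_inverse mult.commute)
  have "(\<Sum>k<5. x ^ k / fact k) \<le> (\<Sum>k. x ^ k / fact k)"
    by (rule sum_le_suminf[OF sums_summable[OF s]]) (use assms in simp_all)
  then have "(\<Sum>k<5. x ^ k / fact k) \<le> exp x"
    using sums_unique[OF s] by simp
  moreover have "(\<Sum>k<5. x ^ k / fact k) = 1 + x + x ^ 2 / 2 + x ^ 3 / 6 + x ^ 4 / 24"
    by (simp add: eval_nat_numeral fact_numeral field_simps)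
  ultimately show ?thesis by (simp add: field_simps power2_eq_square power3_eq_cube power4_eq_xxxx)
qed

text \<open>The affine bound is chosen so that four times it, 12/5 + 2x/5, exceeds 1 and grows with
  x; its powers can then absorb the polynomial in the degree.\<close>

lemma exp_minus_1_ratio:
  fixes x :: real
  assumes "0 < x"
  shows "3 / 5 + x / 10 \<le> ((exp x - 1) / (x * (1 + x))) ^ 2"
proof -
  let ?r = "1 + x / 2 + x ^ 2 / 6 + x ^ 3 / 24"
  have "(3 / 5 + x / 10) * (1 + x) ^ 2 \<le> ?r ^ 2"
  proof -
    \<comment> \<open>Certificate of nonnegativity: the square takes up all negative coefficients,
      and the remainder has nonnegative ones.\<close>
    have "?r ^ 2 - (3 / 5 + x / 10) * (1 + x) ^ 2 = (6 / 10 - x / 4 - 26 / 100 * x ^ 2) ^ 2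
        + (4 / 100 + 197 / 6000 * x ^ 2 + 2 / 100 * x ^ 3
        + 83 / 45000 * x ^ 4 + x ^ 5 / 72 + x ^ 6 / 576)"
      by (simp add: eval_nat_numeral field_simps)
    also have "\<dots> \<ge> 0" using assms by (intro add_nonneg_nonneg mult_nonneg_nonneg) auto
    finally show ?thesis by linarith
  qed
  also have "?r ^ 2 \<le> ((exp x - 1) / x) ^ 2"
    using exp_minus_1_lower[of x] assms by (intro power_mono) (auto simp: field_simps)
  finally have "3 / 5 + x / 10 \<le> ((exp x - 1) / x) ^ 2 / (1 + x) ^ 2"
    using assms by (simp add: pos_le_divide_eq)
  then show ?thesis by (simp add: power_divide power_mult_distrib)
qed

lemma power_Bernoulli_le:
  fixes a t :: real
  assumes "0 < a" "0 \<le> t"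
  shows "a ^ m + real m * a ^ (m - 1) * t \<le> (a + t) ^ m"
proof (induction m)
  case (Suc m)
  have "(a + t) * (a ^ m + real m * a ^ (m - 1) * t) \<le> (a + t) * (a + t) ^ m"
    using Suc assms by (intro mult_left_mono) auto
  moreover have "a ^ Suc m + real (Suc m) * a ^ (Suc m - 1) * t \<le> (a + t) * (a ^ m + real m * a ^ (m - 1) * t)"
  proof (cases m)
    case (Suc k)
    have "0 \<le> real m * a ^ k * t * t" using assms by simp
    then show ?thesis by (simp add: Suc algebra_simps)
  qed simp
  ultimately show ?case by simp
qed simp

text \<open>For m = 3 and x = 0 the inequality fails, as 49 exceeds 3 (12/5)^3. From m = 4 on, the
  left side grows by at most the factor 12/5 in each step.\<close>

lemma quadratic_le_power:
  fixes x :: real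
  assumes "4 \<le> m" "0 \<le> x"
  shows "(2 * real m + 1)\<^sup>2 + 2 * real m * x \<le> 3 * (12 / 5 + 2 / 5 * x) ^ m"
  using assms(1)
proof (induction m rule: dec_induct)
  case base
  show ?case using power_Bernoulli_le[of "12 / 5" "2 / 5 * x" 4] assms(2) by (simp add: eval_nat_numeral)
next
  case (step m)
  let ?q = "12 / 5 + 2 / 5 * x" and ?m = "real m"
  have m: "4 \<le> ?m" using step by simp
  have "(2 * real (Suc m) + 1)\<^sup>2 + 2 * real (Suc m) * x \<le> 12 / 5 * ((2 * ?m + 1)\<^sup>2 + 2 * ?m * x)"
  proof -
    have "0 \<le> (?m - 4) * (28 / 5 * ?m + 20) + 367 / 5 + (14 / 5 * ?m - 2) * x"
      using m assms(2) by (intro add_nonneg_nonneg mult_nonneg_nonneg) auto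
    also have "\<dots> = 12 / 5 * ((2 * ?m + 1)\<^sup>2 + 2 * ?m * x) - ((2 * real (Suc m) + 1)\<^sup>2 + 2 * real (Suc m) * x)"
      by (simp add: power2_eq_square field_simps)
    finally show ?thesis by simp
  qed
  also have "\<dots> \<le> ?q * ((2 * ?m + 1)\<^sup>2 + 2 * ?m * x)"
    using assms(2) by (intro mult_right_mono) auto
  also have "\<dots> \<le> ?q * (3 * ?q ^ m)"
    using step assms(2) by (intro mult_left_mono) auto
  finally show ?case by simp
qed

text \<open>For large m the factor 48 splits as 16 times 3, using 4m + 1 \<le> 4(m + 1). This is too
  wasteful for m below 4, where the first two binomial terms settle each case.\<close>

lemma degree_le_power:
  fixes x :: real
  assumes "0 \<le> x"
  shows "(4 * real m + 1)\<^sup>2 * ((2 * real m + 1)\<^sup>2 + 2 * real m * x)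
    \<le> 48 * (real m + 1)\<^sup>2 * (12 / 5 + 2 / 5 * x) ^ m"
proof -
  have B: "(12 / 5) ^ m + real m * (12 / 5) ^ (m - 1) * (2 / 5 * x) \<le> (12 / 5 + 2 / 5 * x) ^ m"
    using assms by (intro power_Bernoulli_le) auto
  consider "m = 0" | "m = 1" | "m = 2" | "m = 3" | "4 \<le> m" by linarith
  then show ?thesis
  proof cases
    case 5
    have "(4 * real m + 1)\<^sup>2 \<le> 16 * (real m + 1)\<^sup>2" by (simp add: power2_eq_square algebra_simps)
    then have "(4 * real m + 1)\<^sup>2 * ((2 * real m + 1)\<^sup>2 + 2 * real m * x)
        \<le> 16 * (real m + 1)\<^sup>2 * (3 * (12 / 5 + 2 / 5 * x) ^ m)"
      using quadratic_le_power[OF 5 assms] assms by (intro mult_mono) auto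
    then show ?thesis by simp
  qed (use B assms in \<open>simp_all add: eval_nat_numeral\<close>)
qed

text \<open>For m = K - 1 one has 3 * 4^(K+1) = 48 * 4^m, so every pair of factors \<open>s\<close>
  comes with one factor 4, which turns 3/5 + x/10 into 12/5 + 2x/5.\<close>

lemma delta_bound_aux:
  fixes x :: real
  assumes "0 < x" "1 \<le> K"
  shows "(4 * real K - 3)\<^sup>2 * (1 + (2 * real K - 2) * (2 * real K + x)) * (x * (1 + x) / (exp x - 1)) ^ (2 * K - 2)
    \<le> (real K)\<^sup>2 * (x + 3 * 4 ^ (K + 1))"
proof -
  define m where "m = K - 1"
  have K: "K = Suc m" using assms(2) by (simp add: m_def)
  define s where "s = (exp x - 1) / (x * (1 + x))"
  have ex: "0 < exp x - 1" using assms(1) by simp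
  have s: "0 < s" using assms(1) ex by (simp add: s_def)
  have q: "3 / 5 + x / 10 \<le> s ^ 2" unfolding s_def by (rule exp_minus_1_ratio[OF assms(1)])
  have "(4 * real K - 3)\<^sup>2 * (1 + (2 * real K - 2) * (2 * real K + x))
      = (4 * real m + 1)\<^sup>2 * ((2 * real m + 1)\<^sup>2 + 2 * real m * x)"
    by (simp add: K power2_eq_square algebra_simps)
  also have "\<dots> \<le> 48 * (real m + 1)\<^sup>2 * (12 / 5 + 2 / 5 * x) ^ m"
    using assms(1) by (intro degree_le_power) simp
  also have "\<dots> = 48 * (real m + 1)\<^sup>2 * (4 ^ m * (3 / 5 + x / 10) ^ m)"
    by (simp add: power_mult_distrib[symmetric] algebra_simps)
  also have "\<dots> \<le> 48 * (real m + 1)\<^sup>2 * (4 ^ m * (s ^ 2) ^ m)"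
    using q assms(1) by (intro mult_left_mono power_mono) auto
  also have "\<dots> = (real K)\<^sup>2 * (3 * 4 ^ (K + 1)) * s ^ (2 * K - 2)"
    by (simp add: K power_mult[symmetric] mult.commute mult.left_commute add.commute)
  also have "\<dots> \<le> (real K)\<^sup>2 * (x + 3 * 4 ^ (K + 1)) * s ^ (2 * K - 2)"
    using assms(1) s by (intro mult_right_mono mult_left_mono) auto
  finally have "(4 * real K - 3)\<^sup>2 * (1 + (2 * real K - 2) * (2 * real K + x)) / s ^ (2 * K - 2)
      \<le> (real K)\<^sup>2 * (x + 3 * 4 ^ (K + 1))"
    using s by (simp add: pos_divide_le_eq)
  moreover have "x * (1 + x) / (exp x - 1) = inverse s" by (simp add: s_def)
  ultimately show ?thesis by (simp add: power_inverse divide_inverse)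
qed

section \<open>Conclusion\<close>

lemma min_inverse_eq: "0 < t \<Longrightarrow> min t (1 / t) = 1 / max t (1 / (t :: real))"
  by (cases "t \<le> 1 / t") (simp_all add: min_def max_def)

lemma delta_eq:
  fixes t :: real
  assumes "0 < t"
  defines "th \<equiv> max t (1 / t)"
  shows "delta K \<beta> u t = 1 / 2 * (u * (1 / th) / real K) ^ 2
    * (\<beta> * (1 / th) ^ 3 / (\<beta> * (1 / th) ^ 3 + 3 * 4 ^ (K + 1)))
    * (\<beta> * th / (exp (\<beta> * th) - 1)) ^ (2 * K - 1)"
  unfolding delta_def Let_def min_inverse_eq[OF assms(1)] th_def ..

lemma nsum_Un_disjoint:
  "A \<inter> B = {} \<Longrightarrow> nsum f (A \<union> B) = nsum f A + nsum f B"
  unfolding nsum_indicator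
  by (subst nn_integral_add[symmetric]) (auto intro!: nn_integral_cong simp: indicator_def)

lemma nsum_Int_support:
  "(\<And>x. x \<in> A \<Longrightarrow> x \<notin> S \<Longrightarrow> f x = 0) \<Longrightarrow> nsum f A = nsum f (A \<inter> S)"
  unfolding nsum_indicator by (intro nn_integral_cong) (auto simp: indicator_def)

lemma nsum_ge_point: "x \<in> A \<Longrightarrow> ennreal (f x) \<le> nsum f A"
  unfolding nsum_def by (rule nn_integral_ge_point)

lemma infsum_eq_nsum:
  assumes "\<And>x. 0 \<le> f x" "nsum f UNIV < \<top>"
  shows "ennreal (infsum f UNIV) = nsum f UNIV"
proof -
  have "integrable (count_space UNIV) f"
    using assms by (intro integrableI_nonneg) (auto simp: nsum_def)
  then have s: "Infinite_Set_Sum.abs_summable_on f UNIV"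
    by (simp add: Infinite_Set_Sum.abs_summable_on_def)
  have "nsum f UNIV = ennreal (infsetsum f UNIV)"
    unfolding nsum_def using s assms(1) by (intro nn_integral_conv_infsetsum) auto
  then show ?thesis by (simp add: infsetsum_infsum[OF s])
qed

context weighted_edges
begin

lemma \<beta>_eq: "\<beta> = \<beta> * th * (1 / th)"
  using th_pos by simp

lemma delta_nonneg: "0 \<le> delta K \<beta> u \<theta>"
proof -
  have "0 \<le> exp (\<beta> * th) - 1" using x_pos by simp
  then show ?thesis
    unfolding delta_eq[OF \<theta>] th_def[symmetric]
    using \<beta> th_pos x_pos u by (intro mult_nonneg_nonneg divide_nonneg_nonneg zero_le_power add_nonneg_nonneg) auto
qed

lemma delta_le_1: "delta K \<beta> u \<theta> \<le> 1"
proof (cases "K = 0")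
  case True
  \<comment> \<open>Division by \<open>real 0\<close> yields 0, so \<open>delta\<close> vanishes
    here.\<close>
  then show ?thesis by (simp add: delta_def)
next
  case False
  let ?y = "\<beta> * (1 / th) ^ 3" and ?C = "3 * 4 ^ (K + 1) :: real" and ?x = "\<beta> * th"
  have y: "0 < ?y" using \<beta> th_pos by simp
  have C: "0 < ?C" by simp
  have ex: "?x \<le> exp ?x - 1" using exp_ge_add_one_self[of ?x] by linarith
  have "u * (1 / th) \<le> 1 * 1" using u th_ge_1 by (intro mult_mono) auto
  also have "\<dots> \<le> real K" using False by simp
  finally have "u * (1 / th) / real K \<le> 1" using False by (subst pos_divide_le_eq) simp_all
  moreover have "0 \<le> u * (1 / th) / real K" using u th_pos by simp
  ultimately have a: "(u * (1 / th) / real K) ^ 2 \<le> 1" by (simp add: power_le_one)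
  have "p / (p + q) \<le> 1" if "0 < p" "0 < q" for p q :: real using that by simp
  from this[OF y C] have b: "?y / (?y + ?C) \<le> 1" .
  have b0: "0 \<le> ?y / (?y + ?C)" using y C by (intro divide_nonneg_nonneg) linarith+
  have c: "(?x / (exp ?x - 1)) ^ (2 * K - 1) \<le> 1"
    using ex x_pos by (intro power_le_one) (auto simp: divide_le_eq_1)
  have c0: "0 \<le> (?x / (exp ?x - 1)) ^ (2 * K - 1)"
    using ex x_pos by (intro zero_le_power divide_nonneg_nonneg) auto
  have "1 / 2 * (u * (1 / th) / real K) ^ 2 * (?y / (?y + ?C)) * (?x / (exp ?x - 1)) ^ (2 * K - 1)
      \<le> 1 * 1 * 1 * 1"
    using a b c b0 c0 by (intro mult_mono mult_nonneg_nonneg) auto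
  then show ?thesis unfolding delta_eq[OF \<theta>] th_def[symmetric] by simp
qed

lemma loop_weight_eq:
  "loop_weight V E \<beta> u \<theta> c = (if c \<in> confs E then wt c else 0)"
  by (simp add: loop_weight_def wt_def)

lemma confs_eq: "confs E = {c. set c \<subseteq> E \<times> {-1, 1}}"
  by (simp add: confs_def)

text \<open>The normalising sum is finite by \<open>nsum_wt_finite\<close> and positive because of
  the empty configuration, so the weights really define a probability.\<close>

lemma pmf_loop_measure:
  obtains z where "0 < z"
    "\<And>c. pmf (loop_measure V E \<beta> u \<theta>) c = loop_weight V E \<beta> u \<theta> c / z"
proof -
  let ?f = "loop_weight V E \<beta> u \<theta>"
  have f0: "0 \<le> ?f c" for c by (simp add: loop_weight_eq wt_nonneg)
  have "nsum ?f UNIV = nsum ?f (UNIV \<inter> confs E)"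
    by (rule nsum_Int_support) (simp add: loop_weight_eq)
  also have "\<dots> = nsum wt (confs E)"
    unfolding Int_UNIV_left by (rule nsum_cong) (simp add: loop_weight_eq)
  also have "\<dots> < \<top>" using nsum_wt_finite by (simp add: confs_eq)
  finally have fin: "nsum ?f UNIV < \<top>" .
  define z where "z = infsum ?f UNIV"
  have z: "nsum ?f UNIV = ennreal z"
    unfolding z_def by (rule infsum_eq_nsum[OF f0 fin, symmetric])
  have "0 < wt []" using \<theta> by (simp add: wt_def n_cross_def n_dbar_def)
  then have "0 < ?f []" by (simp add: loop_weight_eq confs_def)
  then have "0 < ennreal (?f [])" by simp
  also have "\<dots> \<le> nsum ?f UNIV" by (rule nsum_ge_point) simp
  finally have "0 < nsum ?f UNIV" .
  then have zp: "0 < z" unfolding z by simp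
  have "(\<integral>\<^sup>+c. ennreal (?f c / z) \<partial>count_space UNIV) = nsum (\<lambda>c. 1 / z * ?f c) UNIV"
    by (simp add: nsum_def)
  also have "\<dots> = ennreal (1 / z) * ennreal z"
    using zp by (subst nsum_cmult) (simp_all add: z)
  also have "\<dots> = 1" using zp by (simp add: ennreal_mult'[symmetric])
  finally have "pmf (loop_measure V E \<beta> u \<theta>) c = ?f c / z" for c
    unfolding loop_measure_def z_def[symmetric] using f0 zp
    by (subst pmf_embed_pmf) auto
  with zp show thesis by (rule that)
qed

end

context weighted_marked
begin

text \<open>Writing \<beta> as \<open>x * tl\<close> turns (\<beta> u)^2 into x^2 times the (u tl)^2
  of \<delta>. Moreover \<beta> tl^3 = x tl^4 is at most x, so its fraction in \<delta> is at most x
  / (x + C), and \<open>delta_bound_aux\<close> applies in terms of x alone.\<close>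

lemma delta_mult_le:
  "delta K \<beta> u \<theta> * ((exp (\<beta> * th) - 1) * (1 + \<beta> * th) ^ (2 * K - 2))
    \<le> (\<beta> * u)\<^sup>2 / (2 * (4 * real K - 3)\<^sup>2 * EM)"
proof -
  define x where "x = \<beta> * th"
  define g where "g = exp x - 1"
  define n where "n = 2 * K - 2"
  define tl where "tl = 1 / th"
  define y where "y = \<beta> * tl ^ 3"
  define C :: real where "C = 3 * 4 ^ (K + 1)"
  define k where "k = real K"
  define D where "D = (4 * real K - 3)\<^sup>2 * EM"
  have x: "0 < x" using x_pos by (simp add: x_def)
  have g: "0 < g" using x by (simp add: g_def)
  have tl: "0 < tl" "tl \<le> 1" using th_pos th_ge_1 by (auto simp: tl_def)
  have b: "\<beta> = x * tl" using th_pos by (simp add: x_def tl_def)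
  have C: "0 < C" by (simp add: C_def)
  have k: "1 \<le> k" using one_le_K by (simp add: k_def)
  have D: "0 < D" using k EM_ge_1 by (auto simp: D_def k_def intro!: mult_pos_pos)
  have n: "2 * K - 1 = Suc n" using one_le_K by (simp add: n_def)
  have y: "0 < y" "y \<le> x"
  proof -
    show "0 < y" using \<beta> tl by (simp add: y_def)
    have "x * tl ^ 4 \<le> x * 1" using x tl by (intro mult_left_mono power_le_one) auto
    then show "y \<le> x" by (simp add: y_def b power4_eq_xxxx power3_eq_cube mult.assoc)
  qed
  have yx: "y / (y + C) \<le> x / (x + C)"
    using y C x by (simp add: divide_simps) (simp add: algebra_simps)
  have aux: "D * (x * (1 + x) / g) ^ n \<le> k\<^sup>2 * (x + C)"
    using delta_bound_aux[OF x one_le_K] by (simp add: D_def EM_def g_def n_def k_def C_def x_def)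
  have "delta K \<beta> u \<theta> * (g * (1 + x) ^ n)
      = 1 / 2 * (u * tl / k) ^ 2 * (y / (y + C)) * (x / g) ^ Suc n * (g * (1 + x) ^ n)"
    unfolding delta_eq[OF \<theta>] th_def[symmetric] n
    by (simp add: x_def g_def tl_def y_def C_def k_def)
  also have "\<dots> = 1 / 2 * (u * tl / k) ^ 2 * x * (x * (1 + x) / g) ^ n * (y / (y + C))"
  proof -
    have "(x / g) ^ Suc n * (g * (1 + x) ^ n) = x * (x * (1 + x) / g) ^ n"
      using g by (simp add: power_divide power_mult_distrib)
    then have eq: "c * (x / g) ^ Suc n * (g * (1 + x) ^ n) = c * (x * (x * (1 + x) / g) ^ n)" for c
      by (simp only: mult.assoc)
    show ?thesis unfolding eq by (simp only: ac_simps)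
  qed
  also have "\<dots> \<le> 1 / 2 * (u * tl / k) ^ 2 * x * (x * (1 + x) / g) ^ n * (x / (x + C))"
    using yx x g by (intro mult_left_mono mult_nonneg_nonneg) auto
  also have "\<dots> = 1 / 2 * (u * tl / k) ^ 2 * x * (x / (x + C)) * (x * (1 + x) / g) ^ n"
    by (simp only: ac_simps)
  also have "\<dots> \<le> 1 / 2 * (u * tl / k) ^ 2 * x * (x / (x + C)) * (k\<^sup>2 * (x + C) / D)"
    using aux x C D by (intro mult_left_mono mult_nonneg_nonneg) (auto simp: pos_le_divide_eq mult.commute)
  also have "\<dots> = (\<beta> * u)\<^sup>2 / (2 * D)"
  proof -
    have "x + C \<noteq> 0" "k \<noteq> 0" using x C k by auto
    then show ?thesis by (simp add: b power2_eq_square divide_simps)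
  qed
  finally show ?thesis by (simp add: D_def x_def g_def n_def mult.assoc)
qed

lemma delta_nsum_Z: "ennreal (delta K \<beta> u \<theta>) * nsum wt Z \<le> nsum wt Z1"
proof -
  let ?C1 = "(exp (\<beta> * th) - 1) * (1 + \<beta> * th) ^ (2 * K - 2)"
  have C1: "0 \<le> ?C1" using x_pos by simp
  have "ennreal (delta K \<beta> u \<theta>) * nsum wt Z \<le> ennreal (delta K \<beta> u \<theta>) * (ennreal ?C1 * nsum wt Om)"
    by (intro mult_left_mono nsum_Z_Om) simp
  also have "\<dots> = ennreal (delta K \<beta> u \<theta> * ?C1) * nsum wt Om"
    using delta_nonneg C1 by (rule ennreal_mult_assoc)
  also have "\<dots> \<le> ennreal ((\<beta> * u)\<^sup>2 / (2 * (4 * real K - 3)\<^sup>2 * EM)) * nsum wt Om"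
    by (intro mult_right_mono ennreal_leI delta_mult_le) simp
  also have "\<dots> \<le> nsum wt Z1" by (rule nsum_Z1_Om)
  finally show ?thesis .
qed

end

theorem theorem1p1:
  fixes V :: "'v set" and E :: "'v set set" and K :: nat and \<beta> u \<theta> :: real
    and Et :: "'v set set"
  assumes "finite V"
    and "\<forall>e\<in>E. \<exists>a b. a \<in> V \<and> b \<in> V \<and> a \<noteq> b \<and> e = {a, b}"
    and "\<forall>v\<in>V. card {e\<in>E. v \<in> e} \<le> K"
    and "\<beta> > 0" and "\<theta> > 0" and "0 < u" and "u \<le> 1"
    and "Et \<subseteq> E"
  shows "rel_pmf (\<lambda>\<omega> b. \<forall>e\<in>Et. \<omega> e \<longrightarrow> b e)
           (Pi_pmf Et False (\<lambda>_. bernoulli_pmf (delta K \<beta> u \<theta>)))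
           (map_pmf (\<lambda>c e. if e \<in> Et then blocking e c else False)
              (cond_pmf (loop_measure V E \<beta> u \<theta>) (occ_event E Et)))"
proof -
  interpret W: weighted_edges V E K \<beta> u \<theta>
    using assms by unfold_locales (auto simp: edge_on_def)
  \<comment> \<open>The weight \<open>wt\<close> does not involve the edge set, so the estimates for
    \<open>Et\<close> speak of the same weights as the measure on \<open>E\<close>.\<close>
  have T: "weighted_edges V Et K \<beta> u \<theta>"
  proof unfold_locales
    fix v assume "v \<in> V"
    have "card {f \<in> Et. v \<in> f} \<le> card {f \<in> E. v \<in> f}"
      using W.finE assms(8) by (intro card_mono) auto
    then show "card {f \<in> Et. v \<in> f} \<le> K" using W.deg[OF \<open>v \<in> V\<close>] by linarith
  qed (use assms in \<open>auto simp: edge_on_def\<close>)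
  have finEt: "finite Et" using W.finE assms(8) finite_subset by blast
  let ?M = "loop_measure V E \<beta> u \<theta>" and ?occ = "occ_event E Et"
  let ?g = "\<lambda>c e. if e \<in> Et then blocking e c else False"
  obtain z where z: "0 < z" "\<And>c. pmf ?M c = loop_weight V E \<beta> u \<theta> c / z"
    by (rule W.pmf_loop_measure) blast
  define Oc where "Oc = {c. set c \<subseteq> Et \<times> {-1, 1} \<and> (\<forall>f\<in>Et. N_e f c \<ge> 1)}"
  have occ: "?occ \<inter> confs E = Oc"
  proof (intro set_eqI iffI)
    fix c assume "c \<in> ?occ \<inter> confs E"
    then have c: "\<forall>f\<in>Et. N_e f c \<ge> 1" "\<forall>f\<in>E - Et. f \<notin> fst ` set c" "set c \<subseteq> E \<times> {-1, 1}"
      by (auto simp: occ_event_def confs_def N_e_0_iff)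
    have "l \<in> Et \<times> {-1, 1}" if "l \<in> set c" for l
    proof -
      have "l \<in> E \<times> {-1, 1}" "fst l \<in> fst ` set c" using that c(3) by auto
      then show ?thesis using c(2) by (cases l) auto
    qed
    then show "c \<in> Oc" using c(1) by (auto simp: Oc_def)
  next
    fix c assume "c \<in> Oc"
    then show "c \<in> ?occ \<inter> confs E"
      using assms(8) unfolding Oc_def occ_event_def confs_def by (force simp: N_e_0_iff)
  qed
  have ne: "set_pmf ?M \<inter> ?occ \<noteq> {}"
  proof -
    obtain es where es: "set es = Et" using finEt finite_list by blast
    \<comment> \<open>One cross per edge of \<open>Et\<close>; crosses only, since double bars have
      weight 0 when \<open>u = 1\<close>.\<close>
    define c where "c = map (\<lambda>f. (f, 1::int)) es"
    have "N_e f c \<ge> 1" if "f \<in> Et" for f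
      using that es by (auto simp: c_def N_e_0_iff Suc_le_eq image_image simp flip: neq0_conv)
    then have c: "c \<in> Oc" by (auto simp: Oc_def c_def es)
    have "n_dbar c = 0" by (simp add: c_def n_dbar_def filter_empty_conv)
    then have "0 < W.wt c" using assms by (simp add: W.wt_def)
    then have "pmf ?M c \<noteq> 0" using c occ z by (auto simp: W.loop_weight_eq)
    then show ?thesis using c occ by (auto simp: set_pmf_iff)
  qed
  define m where "m = measure (measure_pmf ?M) ?occ"
  have m: "0 < m" unfolding m_def using ne measure_pmf_posI by fastforce
  define k where "k = 1 / (z * m)"
  have k: "0 < k" using z m by (simp add: k_def)
  have pmfB: "ennreal (pmf (map_pmf ?g (cond_pmf ?M ?occ)) \<omega>) = ennreal k * nsum W.wt {c \<in> Oc. ?g c = \<omega>}" for \<omega>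
  proof -
    have "ennreal (pmf (map_pmf ?g (cond_pmf ?M ?occ)) \<omega>) = emeasure (cond_pmf ?M ?occ) (?g -` {\<omega>})"
      by (simp add: pmf_map measure_pmf.emeasure_eq_measure)
    also have "\<dots> = nsum (pmf (cond_pmf ?M ?occ)) (?g -` {\<omega>})"
      by (simp add: nsum_def nn_integral_pmf)
    also have "\<dots> = nsum (pmf (cond_pmf ?M ?occ)) (?g -` {\<omega>} \<inter> Oc)"
      by (rule nsum_Int_support) (auto simp: pmf_cond[OF ne] z(2) W.loop_weight_eq occ[symmetric])
    also have "?g -` {\<omega>} \<inter> Oc = {c \<in> Oc. ?g c = \<omega>}" by blast
    also have "nsum (pmf (cond_pmf ?M ?occ)) {c \<in> Oc. ?g c = \<omega>} = nsum (\<lambda>c. k * W.wt c) {c \<in> Oc. ?g c = \<omega>}"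
    proof (rule nsum_cong)
      fix c assume "c \<in> {c \<in> Oc. ?g c = \<omega>}"
      then have "c \<in> ?occ" "c \<in> confs E" using occ by auto
      then show "pmf (cond_pmf ?M ?occ) c = k * W.wt c"
        by (simp add: pmf_cond[OF ne] z(2) W.loop_weight_eq k_def m_def)
    qed
    also have "\<dots> = ennreal k * nsum W.wt {c \<in> Oc. ?g c = \<omega>}" using k by (intro nsum_cmult) simp
    finally show ?thesis .
  qed
  let ?B = "map_pmf ?g (cond_pmf ?M ?occ)" and ?d = "delta K \<beta> u \<theta>"
  show ?thesis
  proof (rule rel_pmf_Pi_bernoulli[OF finEt W.delta_nonneg W.delta_le_1])
    fix e and \<omega> :: "'v set \<Rightarrow> bool"
    assume e: "e \<in> Et"
    interpret weighted_marked V Et K \<beta> u \<theta> e \<omega>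
      by (intro weighted_marked.intro T marked_edge.intro marked_edge_axioms.intro e weighted_edges.axioms(1)[OF T])
    let ?A = "\<lambda>v. {c \<in> Oc. ?g c = fun_upd \<omega> e v}"
    show "?d * (pmf ?B (fun_upd \<omega> e True) + pmf ?B (fun_upd \<omega> e False)) \<le> pmf ?B (fun_upd \<omega> e True)"
    \<comment> \<open>The coupling criterion quantifies over all \<open>\<omega>\<close>; those that
      are \<open>True\<close> somewhere outside \<open>Et\<close> have probability 0.\<close>
    proof (cases "\<exists>x. x \<notin> Et \<and> \<omega> x")
      case True
      then have "?A v = {}" for v using e by (auto simp: fun_eq_iff)
      then have "ennreal (pmf ?B (fun_upd \<omega> e v)) = 0" for v
        unfolding pmfB by (simp add: nsum_indicator)
      then show ?thesis by simp
    next
      case False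
      have g: "?g c = fun_upd \<omega> e v \<longleftrightarrow> (blocking e c \<longleftrightarrow> v) \<and> (\<forall>f\<in>Et - {e}. blocking f c \<longleftrightarrow> \<omega> f)" for c v
        using False e by (auto simp: fun_eq_iff)
      have AT: "?A True = Z1" unfolding g by (auto simp: Z1_def Z_def Oc_def)
      have AZ: "?A True \<union> ?A False = Z" unfolding g by (auto simp: Z_def Oc_def)
      have "?A True \<inter> ?A False = {}" unfolding g by blast
      from nsum_Un_disjoint[OF this, of W.wt]
      have Z: "nsum W.wt Z = nsum W.wt (?A True) + nsum W.wt (?A False)" unfolding AZ .
      have "ennreal (?d * (pmf ?B (fun_upd \<omega> e True) + pmf ?B (fun_upd \<omega> e False)))
          = ennreal ?d * (ennreal k * nsum W.wt Z)"
        using W.delta_nonneg by (simp add: ennreal_mult' pmfB Z distrib_left)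
      also have "\<dots> = ennreal k * (ennreal ?d * nsum W.wt Z)" by (simp only: ac_simps)
      also have "\<dots> \<le> ennreal k * nsum W.wt Z1"
        by (intro mult_left_mono delta_nsum_Z) simp
      also have "\<dots> = ennreal (pmf ?B (fun_upd \<omega> e True))" unfolding pmfB AT ..
      finally show ?thesis by simp
    qed
  qed
qed

end
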